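(* Let $G_0=\sum_{k=1}^{K_0}\tilde\alpha^0_k\delta_{\theta^0_k}\in\mathcal{E}_{K_0}$ and take $K=K_0$. Assume: (P1) there is $c_0>0$ such that $\theta^0_{kv}\ge c_0$ for all $v\in\{1,\dots,V\}$, $k\in\{1,\dots,K_0\}$; (P2) the priors $\Pi_\alpha$ on $\Delta^{K_0-1}$ (for $\tilde\alpha$) and $\Pi_\theta$ on $\Delta^{V-1}$ (for each topic, independently) are regular and their supports contain $\tilde\alpha^0$ and $\theta^0_1,\dots,\theta^0_{K_0}$, respectively. Assume further that $\theta^0_1,\dots,\theta^0_{K_0}$ are linearly independent and $N\ge3$. Let $\tilde q^0\in\Delta^{K_0-1}$, and let the data be generated as $$(\tilde X_{[\tilde N]},X^{[m]}_{[N]})\sim\Big(\bigotimes_{j=1}^{\tilde N}\mathrm{Multi}\big(\tilde X_j\,\big|\,\textstyle\sum_{k=1}^{K_0}\tilde q^0_k\theta^0_k\big)\Big)\otimes\Big(\bigotimes_{i=1}^mp^{\mathscr{L}}_{G_0,N}(X^i_{[N]})\Big).$$ Then, as $m,\tilde N\to\infty$ with $\tilde N\lesssim mN$, for any slowly increasing sequence $C_{m,\tilde N}\to\infty$, $$\mathbb{E}\,\Pi\left(\min_{\tau}\big\|\tau\tilde q-\tilde q^0\big\|\ge C_{m,\tilde N}\left(\Big(\frac{\log(mN)}{m}\Big)^{1/2}+\Big(\frac{\log\tilde N}{\tilde N}\Big)^{1/2}\right)\ \Big|\ \tilde X_{[\tilde N]},X^{[m]}_{[N]}\right)\to0,$$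 where the minimum is over permutations $\tau$ of $\{1,\dots,K_0\}$, $\tau\tilde q=(\tilde q_{\tau(1)},\dots,\tilde q_{\tau(K_0)})$, and the expectation is with respect to the data-generating distribution above.
   Context: $\Delta^{D-1}$ is the set of probability vectors in $\mathbb{R}^D$; $\|\cdot\|$ is the Euclidean norm. $\mathcal{E}_K$ is the set of discrete probability measures on $\Delta^{V-1}$ with exactly $K$ atoms. A concentration parameter $\overline{\alpha}>0$ is known and fixed. $\mathrm{Multi}(\cdot\mid\eta)$ is the multinomial distribution with one trial (categorical distribution on $\{1,\dots,V\}$) with parameter $\eta\in\Delta^{V-1}$. For $G=\sum_k\tilde\alpha_k\delta_{\theta_k}$, the LDA probability mass function on $\{1,\dots,V\}^N$ is $p^{\mathscr{L}}_{G,N}(x)=\mathbb{E}_{q\sim\mathrm{Dir}_{\overline{\alpha}\tilde\alpha}}\prod_{j=1}^N(\sum_kq_k\theta_{kx_j})$. Fitted Bayesian model, whose posterior is $\Pi(\cdot\mid\tilde X_{[\tilde N]},X^{[m]}_{[N]})$: $\tilde\alpha\sim\Pi_\alpha$; independently $\theta_1,\dots,\theta_{K_0}$ are independently drawn from $\Pi_\theta$; $G=\sum_{k=1}^{K_0}\tilde\alpha_k\delta_{\theta_k}$, $\alpha=\overline{\alpha}\tilde\alpha$; given $(\alpha,\Theta)$, the documents $X^1_{[N]},\dots,X^m_{[N]}$ are i.i.d. from $p^{\mathscr{L}}_{G,N}$ and, independently of them, $\tilde q\sim\mathrm{Dir}_\alpha$ and the words $\tilde X_1,\dots,\tilde X_{\tilde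 N}$ of the extra document are, given $\tilde q$, i.i.d. from $\mathrm{Multi}(\cdot\mid\sum_k\tilde q_k\theta_k)$. Thus all $m+1$ documents are modelled jointly by LDA. A probability measure $P$ supported on $\Omega\subset\Delta^{D-1}$ is regular if for some constant $c=c(D)>0$, $\inf_{\eta^*\in\Omega}P(\{\eta\in\Omega:\|\eta-\eta^*\|<\epsilon\})\ge c\,\epsilon^{D-1}$ for all sufficiently small $\epsilon>0$. $\tilde N\lesssim mN$ means $\tilde N\le c_1mN$ for a constant $c_1$ not depending on $m,N,\tilde N$. *)

theory Defs
  imports "HOL-Probability.Probability" "HOL-Combinatorics.Permutations"
begin

definition prob_simplex :: "(real^'d) set" where
  "prob_simplex = {x. (\<forall>i. 0 \<le> x $ i) \<and> (\<Sum>i\<in>UNIV. x $ i) = 1}"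

abbreviation simplex_borel :: "(real^'d) measure" where
  "simplex_borel \<equiv> restrict_space borel prob_simplex"

(* The mixing measure sum_k a_k delta_(Theta k) is represented by its weights a and atoms Theta;
   the predicate says that it is a probability measure on the simplex with exactly CARD('k) atoms. *)
definition exact_atoms :: "real^'k \<Rightarrow> ('k \<Rightarrow> real^'v) \<Rightarrow> bool" where
  "exact_atoms a \<Theta> \<longleftrightarrow>
     a \<in> prob_simplex \<and> (\<forall>k. 0 < a $ k) \<and> range \<Theta> \<subseteq> prob_simplex \<and> inj \<Theta>"

(* Dirichlet distribution with parameter alpha. On the face S of indices with positive parameter it
   is given by the usual density in the coordinates S - {l}, the l-th coordinate being one minus
   the sum of the others; it does not depend on the choice of l. Coordinates with parameter 0 vanish
   almost surely. If all parameters are positive then S = UNIV and this is the standard definition.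
   The choice S = {} never arises for a parameter proportional to a probability vector. *)
definition dirichlet :: "real^'k \<Rightarrow> (real^'k) measure" where
  "dirichlet \<alpha> =
     (let S = {k. 0 < \<alpha> $ k}; l = (SOME l. l \<in> S); T = S - {l};
          dens = (\<lambda>x. indicator {x. (\<forall>k\<in>T. 0 < x k) \<and> (\<Sum>k\<in>T. x k) < 1} x *
                    (Gamma (\<Sum>k\<in>S. \<alpha> $ k) / (\<Prod>k\<in>S. Gamma (\<alpha> $ k)) *
                     (\<Prod>k\<in>T. x k powr (\<alpha> $ k - 1)) * (1 - (\<Sum>k\<in>T. x k)) powr (\<alpha> $ l - 1)));
          emb = (\<lambda>x. \<chi> k. if k \<in> T then x k else if k = l then 1 - (\<Sum>j\<in>T. x j) else 0)
      in restrict_space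
           (distr (density (\<Pi>\<^sub>M k\<in>T. (lborel :: real measure)) (\<lambda>x. ennreal (dens x))) borel emb)
           prob_simplex)"

definition multi :: "real^'v \<Rightarrow> 'v pmf" where
  "multi \<eta> = embed_pmf (\<lambda>v. \<eta> $ v)"

definition lda_prob :: "real \<Rightarrow> real^'k \<Rightarrow> ('k \<Rightarrow> real^'v) \<Rightarrow> 'v list \<Rightarrow> real" where
  "lda_prob \<alpha>bar a \<Theta> x =
     (\<integral>q. (\<Prod>j<length x. \<Sum>k\<in>UNIV. q $ k * \<Theta> k $ (x ! j)) \<partial>dirichlet (\<alpha>bar *\<^sub>R a))"

definition lda_pmf :: "real \<Rightarrow> nat \<Rightarrow> real^'k \<Rightarrow> ('k \<Rightarrow> real^'v) \<Rightarrow> 'v list pmf" where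
  "lda_pmf \<alpha>bar N a \<Theta> = embed_pmf (\<lambda>x. if length x = N then lda_prob \<alpha>bar a \<Theta> x else 0)"

(* Joint law of the extra document (n words) and of m documents of N words, given the mixing
   measure and the topic proportions q of the extra document. *)
definition documents_pmf ::
  "real \<Rightarrow> nat \<Rightarrow> nat \<Rightarrow> nat \<Rightarrow> real^'k \<Rightarrow> ('k \<Rightarrow> real^'v) \<Rightarrow> real^'k \<Rightarrow> ('v list \<times> 'v list list) pmf"
where
  "documents_pmf \<alpha>bar N m n a \<Theta> q =
     pair_pmf (replicate_pmf n (multi (\<Sum>k\<in>UNIV. q $ k *\<^sub>R \<Theta> k)))
              (replicate_pmf m (lda_pmf \<alpha>bar N a \<Theta>))"

(* Joint law of the topic proportions of the extra document and of the data. *)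
definition lda_model ::
  "real \<Rightarrow> (real^'k) measure \<Rightarrow> (real^'v) measure \<Rightarrow> nat \<Rightarrow> nat \<Rightarrow> nat \<Rightarrow>
     ((real^'k) \<times> ('v list \<times> 'v list list)) measure" where
  "lda_model \<alpha>bar \<Pi>\<^sub>\<alpha> \<Pi>\<^sub>\<theta> N m n =
     do {
       a \<leftarrow> \<Pi>\<^sub>\<alpha>;
       \<Theta> \<leftarrow> (\<Pi>\<^sub>M k\<in>(UNIV :: 'k set). \<Pi>\<^sub>\<theta>);
       q \<leftarrow> dirichlet (\<alpha>bar *\<^sub>R a);
       d \<leftarrow> measure_pmf (documents_pmf \<alpha>bar N m n a \<Theta> q);
       return (simplex_borel \<Otimes>\<^sub>M count_space UNIV) (q, d)
     }"

(* The data space is discrete, so the posterior is an elementary conditional probability. *)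
definition posterior ::
  "real \<Rightarrow> (real^'k) measure \<Rightarrow> (real^'v) measure \<Rightarrow> nat \<Rightarrow> nat \<Rightarrow> nat \<Rightarrow>
     'v list \<times> 'v list list \<Rightarrow> (real^'k) set \<Rightarrow> real" where
  "posterior \<alpha>bar \<Pi>\<^sub>\<alpha> \<Pi>\<^sub>\<theta> N m n d A =
     cond_prob (lda_model \<alpha>bar \<Pi>\<^sub>\<alpha> \<Pi>\<^sub>\<theta> N m n) (\<lambda>\<omega>. fst \<omega> \<in> A) (\<lambda>\<omega>. snd \<omega> = d)"

(* The infimum over Omega of the ball masses is bounded below by bounding every ball mass. *)
definition regular_measure :: "(real^'d) measure \<Rightarrow> bool" where
  "regular_measure P \<longleftrightarrow>
     (\<exists>\<Omega>\<in>sets P. \<Omega> \<subseteq> prob_simplex \<and> measure P \<Omega> = 1 \<and>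
        (\<exists>c>0. \<forall>\<^sub>F \<epsilon> in at_right 0. \<forall>\<eta>'\<in>\<Omega>.
           measure P {\<eta>\<in>\<Omega>. norm (\<eta> - \<eta>') < \<epsilon>} \<ge> c * \<epsilon> ^ (CARD('d) - 1)))"

definition measure_support :: "'a::topological_space measure \<Rightarrow> 'a set" where
  "measure_support P = {x \<in> space P. \<forall>U. open U \<longrightarrow> x \<in> U \<longrightarrow> 0 < emeasure P (U \<inter> space P)}"

definition regime :: "real \<Rightarrow> nat \<Rightarrow> (nat \<times> nat) filter" where
  "regime c N = inf (sequentially \<times>\<^sub>F sequentially)
                    (principal {(m, n). real n \<le> c * (real m * real N)})"

definition perm_dist :: "real^'k \<Rightarrow> real^'k \<Rightarrow> real" where
  "perm_dist q q' = (MIN \<tau>\<in>{\<tau>. \<tau> permutes (UNIV :: 'k set)}. norm ((\<chi> k. q $ \<tau> k) - q'))"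

end

theory Submission
  imports Defs "HOL-Real_Asymp.Real_Asymp"
begin

text \<open>
  All words come from a finite alphabet, so the argument runs on likelihood ratios over finite sample
  spaces. If \<open>p0\<close> is the true law of \<open>m\<close> observations and Pearson's statistic of the sample is at most
  \<open>L\<close>, then the likelihood ratio of any \<open>p\<close> against \<open>p0\<close> is at most \<open>exp (2 L - m |p - p0|^2 / 8)\<close>
  (\<open>likelihood_ratio_le\<close>). The mean of the statistic is less than the number of outcomes, so by Markov's
  inequality the sample is typical in this sense with probability close to 1 when \<open>L\<close> is large
  (\<open>prob_pearson_ge\<close>). On typical data everything is deterministic, and the posterior mass of the bad
  set is at most a constant times \<open>1/m + 1/n\<close> (\<open>posterior_le_on_typical_data\<close>). The theorem follows by
  letting first \<open>m\<close>, \<open>n\<close> and then \<open>L\<close> tend to infinity.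

  Identifiability (\<open>lda_identifiable\<close>): the error in the topics and weights is at most a constant times
  the error in the law of a document, up to a permutation, once the latter is small. The law of three words determines, through
  the Dirichlet moments and the known concentration parameter, the second and third moments of the
  mixing measure. In a basis dual to the true topics these say that a square matrix \<open>Y\<close> has
  \<open>Y Y^T\<close> close to the identity, and that \<open>Y D_l Y^T\<close>, with \<open>D_l\<close> the diagonal matrix of the \<open>l\<close>-th dual
  coordinates of the fitted topics, is close to the \<open>l\<close>-th coordinate projection. Since the fitted and
  the true number of topics agree, \<open>Y^T Y\<close> is close to the identity as well; hence \<open>D_l\<close> is close to a
  matrix of rank one, and being diagonal it is close to a coordinate projection.

  The posterior is then split. A mixing measure \<open>G\<close> whose document law is further than a large multiple
  of \<open>sqrt (ln m / m)\<close> from the truth has likelihood ratio at most a large negative power of \<open>m\<close>, which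
  beats the evidence: the latter is at least a power of \<open>1/m\<close> times the true likelihood, because the
  priors and the Dirichlet laws charge balls of radius of order \<open>1/m\<close> (\<open>evidence_ge\<close>). For the remaining
  \<open>G\<close> this comparison is too crude, since \<open>n\<close> may be far smaller than \<open>m\<close>, for instance of order \<open>ln m\<close>,
  and the \<open>n\<close> words cannot make up for a power of \<open>1/m\<close>. There the topic proportions are handled
  conditionally on \<open>G\<close>: the numerator and the denominator share the factor of the \<open>m\<close> documents, and the
  denominator is bounded below by the Dirichlet mass of a ball of radius \<open>sqrt (ln n / n)\<close>, which is at
  least a power of \<open>1/n\<close> (\<open>conditional_posterior_bound\<close>). The topics are only known up to an error of order
  \<open>sqrt (ln m / m)\<close>, but this is dominated by \<open>sqrt (ln n / n)\<close> because \<open>n\<close> is at most a multiple of \<open>m N\<close>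
  (\<open>ln_ratio_le\<close>).
\<close>

section \<open>The Dirichlet distribution\<close>

lemma nn_integral_Beta_scaled:
  fixes a b s :: real
  assumes a: "0 < a" and b: "0 < b" and s: "0 < s"
  shows "(\<integral>\<^sup>+ y. ennreal (if 0 < y \<and> y < s then y powr (a - 1) * (s - y) powr (b - 1) else 0) \<partial>lborel)
           = ennreal (Beta a b * s powr (a + b - 1))"
proof -
  let ?f = "\<lambda>s y. if 0 < y \<and> y < s then y powr (a - 1) * (s - y) powr (b - 1) else (0::real)"
  have meas: "?f s \<in> borel_measurable borel" for s
    by measurable
  have scale: "?f s (0 + s * y) = s powr (a + b - 2) * ?f 1 y" for y
  proof (cases "0 < y \<and> y < 1")
    case True
    have "s - s * y = s * (1 - y)" by (simp add: algebra_simps)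
    moreover have "s powr (a + b - 2) = s powr (a - 1) * s powr (b - 1)"
      by (simp flip: powr_add)
    ultimately show ?thesis
      using True s by (simp add: powr_mult)
  next
    case False
    then show ?thesis using s by (auto simp: zero_less_mult_iff)
  qed
  have "(?f 1 has_integral Beta a b) {0..1}"
    by (rule has_integral_spike[OF _ _ has_integral_Beta_real[OF a b], of "{}"]) auto
  then have "(?f 1 has_integral Beta a b) UNIV"
    by (rule has_integral_on_superset) auto
  then have one: "(\<integral>\<^sup>+ y. ennreal (?f 1 y) \<partial>lborel) = ennreal (Beta a b)"
    by (intro nn_integral_has_integral_lborel meas) auto
  have "(\<integral>\<^sup>+ y. ennreal (?f s y) \<partial>lborel) = \<bar>s\<bar> * (\<integral>\<^sup>+ y. ennreal (?f s (0 + s * y)) \<partial>lborel)"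
    using s by (intro nn_integral_real_affine) measurable
  also have "\<dots> = ennreal s * (\<integral>\<^sup>+ y. ennreal (s powr (a + b - 2)) * ennreal (?f 1 y) \<partial>lborel)"
    unfolding scale using s by (subst ennreal_mult) auto
  also have "\<dots> = ennreal s * (ennreal (s powr (a + b - 2)) * ennreal (Beta a b))"
    using meas[of 1] by (subst nn_integral_cmult) (auto simp: one)
  also have "\<dots> = ennreal (s * (s powr (a + b - 2) * Beta a b))"
    using s by (simp add: ennreal_mult')
  also have "s * (s powr (a + b - 2) * Beta a b) = Beta a b * s powr (a + b - 1)"
    using s by (simp add: powr_mult_base)
  finally show ?thesis .
qed

text \<open>
  The unnormalised Dirichlet density with its last coordinate eliminated, on a simplex of total
  mass \<open>s\<close> rather than 1: integrating out one coordinate leaves a kernel of smaller total mass, which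
  is what the induction below needs.
\<close>
definition simplex_kernel :: "'i set \<Rightarrow> ('i \<Rightarrow> real) \<Rightarrow> real \<Rightarrow> real \<Rightarrow> ('i \<Rightarrow> real) \<Rightarrow> real" where
  "simplex_kernel T \<alpha> \<beta> s x =
     (if (\<forall>k\<in>T. 0 < x k) \<and> (\<Sum>k\<in>T. x k) < s
      then (\<Prod>k\<in>T. x k powr (\<alpha> k - 1)) * (s - (\<Sum>k\<in>T. x k)) powr (\<beta> - 1) else 0)"

lemma simplex_kernel_nonneg: "0 \<le> simplex_kernel T \<alpha> \<beta> s x"
  by (auto simp: simplex_kernel_def intro!: mult_nonneg_nonneg prod_nonneg)

lemma measurable_simplex_kernel [measurable]:
  assumes [measurable]: "\<And>k. k \<in> T \<Longrightarrow> (\<lambda>z. g z k) \<in> borel_measurable M"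
    "\<And>k. k \<in> T \<Longrightarrow> (\<lambda>z. h z k) \<in> borel_measurable M" "b \<in> borel_measurable M"
    "s \<in> borel_measurable M" and [simp]: "finite T"
  shows "(\<lambda>z. simplex_kernel T (g z) (b z) (s z) (h z)) \<in> borel_measurable M"
  unfolding simplex_kernel_def by measurable

text \<open>
  Integrating out the coordinate \<open>i\<close> reduces \<open>s\<close> to \<open>s - y\<close>; the induction hypothesis then leaves a
  scaled Beta integral in \<open>y\<close>.
\<close>
lemma nn_integral_simplex_kernel:
  fixes \<alpha> :: "'i \<Rightarrow> real"
  assumes "finite T" and "\<And>k. k \<in> T \<Longrightarrow> 0 < \<alpha> k" and \<beta>: "0 < \<beta>" and "0 < s"
  shows "(\<integral>\<^sup>+ x. ennreal (simplex_kernel T \<alpha> \<beta> s x) \<partial>(\<Pi>\<^sub>M k\<in>T. lborel))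
           = ennreal ((\<Prod>k\<in>T. Gamma (\<alpha> k)) * Gamma \<beta> / Gamma (sum \<alpha> T + \<beta>) * s powr (sum \<alpha> T + \<beta> - 1))"
  using assms(1,2,4)
proof (induction T arbitrary: s rule: finite_induct)
  case empty
  interpret product_sigma_finite "\<lambda>_::'i. lborel :: real measure" by standard
  have "Gamma \<beta> > 0" using \<beta> by (rule Gamma_real_pos)
  then show ?case using empty by (simp add: PiM_empty nn_integral_count_space_finite simplex_kernel_def)
next
  case (insert i T)
  interpret product_sigma_finite "\<lambda>_::'i. lborel :: real measure" by standard
  define A where "A = sum \<alpha> T + \<beta>"
  define c where "c = (\<Prod>k\<in>T. Gamma (\<alpha> k)) * Gamma \<beta> / Gamma A"
  have A: "0 < A" unfolding A_def using insert.prems \<beta>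
    by (intro add_nonneg_pos sum_nonneg) (auto intro: less_imp_le)
  have c: "0 \<le> c" unfolding c_def using insert.prems \<beta> A
    by (intro divide_nonneg_pos mult_nonneg_nonneg prod_nonneg) (auto intro!: Gamma_real_pos less_imp_le)
  have ai: "0 < \<alpha> i" using insert by auto
  have upd: "simplex_kernel (insert i T) \<alpha> \<beta> s (x(i := y)) =
      (if 0 < y \<and> y < s then y powr (\<alpha> i - 1) else 0) * simplex_kernel T \<alpha> \<beta> (s - y) x" for x y
  proof -
    have 1: "(\<Sum>k\<in>T. (x(i := y)) k) = (\<Sum>k\<in>T. x k)"
      using insert.hyps by (intro sum.cong) auto
    have 2: "(\<Prod>k\<in>T. (x(i := y)) k powr (\<alpha> k - 1)) = (\<Prod>k\<in>T. x k powr (\<alpha> k - 1))"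
      using insert.hyps by (intro prod.cong) auto
    have 3: "(\<forall>k\<in>T. 0 < (x(i := y)) k) = (\<forall>k\<in>T. 0 < x k)"
      using insert.hyps by auto
    have 4: "y < s" if "(\<forall>k\<in>T. 0 < x k)" "y + (\<Sum>k\<in>T. x k) < s"
      using sum_nonneg[of T x] that by force
    have 5: "s - y - sum x T = s - (y + sum x T)" by simp
    show ?thesis
    proof (cases "0 < y \<and> (\<forall>k\<in>T. 0 < x k) \<and> y + (\<Sum>k\<in>T. x k) < s")
      case True
      then have "y < s" using 4 by auto
      moreover have "\<forall>k\<in>insert i T. 0 < (x(i := y)) k" using True 3 by auto
      moreover have "sum (x(i := y)) (insert i T) < s"
        using True 1 insert.hyps by simp
      ultimately show ?thesis
        using True unfolding simplex_kernel_def sum.insert[OF insert.hyps] prod.insert[OF insert.hyps] 1 2 5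
        by simp
    next
      case False
      moreover have "(\<forall>k\<in>insert i T. 0 < (x(i := y)) k) \<longleftrightarrow> 0 < y \<and> (\<forall>k\<in>T. 0 < x k)"
      proof -
        have "(\<forall>k\<in>insert i T. 0 < (x(i := y)) k) \<longleftrightarrow> 0 < (x(i := y)) i \<and> (\<forall>k\<in>T. 0 < (x(i := y)) k)"
          by blast
        then show ?thesis unfolding 3 by (simp only: fun_upd_same)
      qed
      moreover have "sum (x(i := y)) (insert i T) = y + (\<Sum>k\<in>T. x k)"
        by (simp only: sum.insert[OF insert.hyps] 1 fun_upd_same)
      ultimately have "\<not> ((\<forall>k\<in>insert i T. 0 < (x(i := y)) k) \<and> sum (x(i := y)) (insert i T) < s)"
        by argo
      then have "simplex_kernel (insert i T) \<alpha> \<beta> s (x(i := y)) = 0"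
        unfolding simplex_kernel_def by (rule if_not_P)
      moreover have "(if 0 < y \<and> y < s then y powr (\<alpha> i - 1) else 0) * simplex_kernel T \<alpha> \<beta> (s - y) x = 0"
        using False unfolding simplex_kernel_def by auto
      ultimately show ?thesis by simp
    qed
  qed
  have "(\<integral>\<^sup>+ x. ennreal (simplex_kernel (insert i T) \<alpha> \<beta> s x) \<partial>(\<Pi>\<^sub>M k\<in>insert i T. lborel))
     = (\<integral>\<^sup>+ y. \<integral>\<^sup>+ x. ennreal (simplex_kernel (insert i T) \<alpha> \<beta> s (x(i := y))) \<partial>(\<Pi>\<^sub>M k\<in>T. lborel) \<partial>lborel)"
    using insert.hyps by (intro product_nn_integral_insert_rev) measurable
  also have "\<dots> = (\<integral>\<^sup>+ y. ennreal c * ennreal (if 0 < y \<and> y < s then y powr (\<alpha> i - 1) * (s - y) powr (A - 1) else 0) \<partial>lborel)"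
  proof (intro nn_integral_cong)
    fix y
    have [measurable]: "simplex_kernel T \<alpha> \<beta> (s - y) \<in> borel_measurable (\<Pi>\<^sub>M k\<in>T. lborel)"
      using insert.hyps by measurable
    show "(\<integral>\<^sup>+ x. ennreal (simplex_kernel (insert i T) \<alpha> \<beta> s (x(i := y))) \<partial>(\<Pi>\<^sub>M k\<in>T. lborel))
       = ennreal c * ennreal (if 0 < y \<and> y < s then y powr (\<alpha> i - 1) * (s - y) powr (A - 1) else 0)"
    proof (cases "0 < y \<and> y < s")
      case True
      then have "(\<integral>\<^sup>+ x. ennreal (simplex_kernel (insert i T) \<alpha> \<beta> s (x(i := y))) \<partial>(\<Pi>\<^sub>M k\<in>T. lborel))
        = (\<integral>\<^sup>+ x. ennreal (y powr (\<alpha> i - 1)) * ennreal (simplex_kernel T \<alpha> \<beta> (s - y) x) \<partial>(\<Pi>\<^sub>M k\<in>T. lborel))"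
        unfolding upd by (simp add: ennreal_mult simplex_kernel_nonneg)
      also have "\<dots> = ennreal (y powr (\<alpha> i - 1)) * ennreal (c * (s - y) powr (A - 1))"
        using True insert.prems by (subst nn_integral_cmult) (auto simp: insert.IH c_def A_def)
      finally show ?thesis using True c by (simp add: ennreal_mult ac_simps)
    next
      case False
      have "simplex_kernel (insert i T) \<alpha> \<beta> s (x(i := y)) = 0" for x
        unfolding upd using False by auto
      then show ?thesis unfolding if_not_P[OF False] by simp
    qed
  qed
  also have "\<dots> = ennreal c * ennreal (Beta (\<alpha> i) A * s powr (\<alpha> i + A - 1))"
    using nn_integral_Beta_scaled[OF ai A insert.prems(2)]
    by (subst nn_integral_cmult) auto
  also have "\<dots> = ennreal (c * (Beta (\<alpha> i) A * s powr (\<alpha> i + A - 1)))"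
    using c by (simp add: ennreal_mult')
  also have "c * (Beta (\<alpha> i) A * s powr (\<alpha> i + A - 1)) =
     (\<Prod>k\<in>insert i T. Gamma (\<alpha> k)) * Gamma \<beta> / Gamma (sum \<alpha> (insert i T) + \<beta>) * s powr (sum \<alpha> (insert i T) + \<beta> - 1)"
    using insert.hyps Gamma_real_pos[OF A] by (simp add: c_def A_def Beta_def add_ac)
  finally show ?case .
qed

text \<open>
  The choices that the definition of the Dirichlet law makes on the face of positive parameters are
  named here, so that integrals against it become integrals over the free coordinates.
\<close>
definition dir_last :: "real^'k \<Rightarrow> 'k" where
  "dir_last \<alpha> = (SOME l. l \<in> {k. 0 < \<alpha> $ k})"

definition dir_free :: "real^'k \<Rightarrow> 'k set" where
  "dir_free \<alpha> = {k. 0 < \<alpha> $ k} - {dir_last \<alpha>}"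

definition dir_embed :: "'k set \<Rightarrow> 'k \<Rightarrow> ('k \<Rightarrow> real) \<Rightarrow> real^'k" where
  "dir_embed T l x = (\<chi> k. if k \<in> T then x k else if k = l then 1 - (\<Sum>j\<in>T. x j) else 0)"

definition dir_density :: "'k set \<Rightarrow> 'k \<Rightarrow> real^'k \<Rightarrow> ('k \<Rightarrow> real) \<Rightarrow> real" where
  "dir_density T l \<alpha> x =
     Gamma (\<Sum>k\<in>insert l T. \<alpha> $ k) / (\<Prod>k\<in>insert l T. Gamma (\<alpha> $ k)) *
       simplex_kernel T (\<lambda>k. \<alpha> $ k) (\<alpha> $ l) 1 x"

lemma borel_measurable_vec_iff:
  fixes f :: "'a \<Rightarrow> real^'n"
  shows "f \<in> borel_measurable M \<longleftrightarrow> (\<forall>i. (\<lambda>x. f x $ i) \<in> borel_measurable M)"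
  unfolding borel_measurable_euclidean_space[of f]
  by (auto simp: Basis_vec_def inner_axis)

lemma measurable_vec_nth [measurable (raw)]:
  fixes f :: "'a \<Rightarrow> real^'n"
  shows "f \<in> borel_measurable M \<Longrightarrow> (\<lambda>x. f x $ i) \<in> borel_measurable M"
  by (simp add: borel_measurable_vec_iff)

lemma sets_prob_simplex [measurable]: "(prob_simplex :: (real^'k) set) \<in> sets borel"
  unfolding prob_simplex_def by measurable

lemma measurable_dir_embed [measurable]:
  "dir_embed T l \<in> borel_measurable (\<Pi>\<^sub>M k\<in>T. (lborel :: real measure))"
  unfolding borel_measurable_vec_iff
proof
  fix i
  show "(\<lambda>x. dir_embed T l x $ i) \<in> borel_measurable (\<Pi>\<^sub>M k\<in>T. (lborel :: real measure))"
    by (cases "i \<in> T") (auto simp: dir_embed_def)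
qed

lemma simplex_kernel_eq_0:
  "dir_embed T l x \<notin> prob_simplex \<Longrightarrow> l \<notin> T \<Longrightarrow> simplex_kernel T \<alpha> \<beta> 1 x = 0"
  for T :: "'k::finite set"
proof (rule ccontr)
  assume *: "dir_embed T l x \<notin> prob_simplex" "l \<notin> T" "simplex_kernel T \<alpha> \<beta> 1 x \<noteq> 0"
  then have 1: "\<forall>k\<in>T. 0 < x k" "(\<Sum>k\<in>T. x k) < 1"
    by (auto simp: simplex_kernel_def split: if_splits)
  have "(\<Sum>k\<in>UNIV. dir_embed T l x $ k) = (\<Sum>k\<in>insert l T. dir_embed T l x $ k)"
    by (rule sum.mono_neutral_right) (auto simp: dir_embed_def)
  also have "\<dots> = 1"
    using *(2) by (simp add: dir_embed_def cong: sum.cong)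
  finally have "dir_embed T l x \<in> prob_simplex"
    using 1 by (auto simp: prob_simplex_def dir_embed_def)
  with * show False by simp
qed

lemma dir_last_in: "0 < \<alpha> $ j \<Longrightarrow> 0 < \<alpha> $ dir_last \<alpha>"
  unfolding dir_last_def by (rule someI2[of _ j]) auto

lemma insert_dir_free: "0 < \<alpha> $ j \<Longrightarrow> insert (dir_last \<alpha>) (dir_free \<alpha>) = {k. 0 < \<alpha> $ k}"
  using dir_last_in[of \<alpha> j] by (auto simp: dir_free_def)

lemma dir_last_notin_free [simp]: "dir_last \<alpha> \<notin> dir_free \<alpha>"
  by (simp add: dir_free_def)

lemma dirichlet_eq:
  fixes \<alpha> :: "real^'k"
  assumes "0 < \<alpha> $ j"
  shows "dirichlet \<alpha> = restrict_space (distr (density (\<Pi>\<^sub>M k\<in>dir_free \<alpha>. lborel)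
     (\<lambda>x. ennreal (dir_density (dir_free \<alpha>) (dir_last \<alpha>) \<alpha> x))) borel (dir_embed (dir_free \<alpha>) (dir_last \<alpha>))) prob_simplex"
proof -
  have *: "indicator {x. (\<forall>k\<in>T. 0 < x k) \<and> (\<Sum>k\<in>T. x k) < 1} x *
                    (a / b *
                     (\<Prod>k\<in>T. x k powr (\<alpha> $ k - 1)) * (1 - (\<Sum>k\<in>T. x k)) powr (\<alpha> $ l - 1)) =
     a / b * simplex_kernel T (\<lambda>k. \<alpha> $ k) (\<alpha> $ l) 1 x" for a b :: real and T l x
    by (auto simp: simplex_kernel_def)
  show ?thesis
    unfolding dirichlet_def Let_def dir_density_def insert_dir_free[OF assms] *
    unfolding dir_embed_def[abs_def] dir_free_def dir_last_def ..
qed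

lemma sets_dirichlet [simp, measurable_cong]:
  "0 < \<alpha> $ j \<Longrightarrow> sets (dirichlet \<alpha>) = sets simplex_borel"
  by (simp add: dirichlet_eq sets_restrict_space)

lemma measurable_dir_density [measurable]:
  fixes l :: "'k::finite"
  shows "dir_density T l \<alpha> \<in> borel_measurable (\<Pi>\<^sub>M k\<in>T. lborel)"
  unfolding dir_density_def by measurable

lemma nn_integral_dirichlet:
  fixes \<alpha> :: "real^'k"
  assumes "0 < \<alpha> $ j" and [measurable]: "f \<in> borel_measurable borel"
  shows "(\<integral>\<^sup>+ q. f q \<partial>dirichlet \<alpha>) = (\<integral>\<^sup>+ x. ennreal (dir_density (dir_free \<alpha>) (dir_last \<alpha>) \<alpha> x) *
            f (dir_embed (dir_free \<alpha>) (dir_last \<alpha>) x) \<partial>(\<Pi>\<^sub>M k\<in>dir_free \<alpha>. lborel))"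
proof -
  let ?T = "dir_free \<alpha>" and ?l = "dir_last \<alpha>"
  have "(\<integral>\<^sup>+ q. f q \<partial>dirichlet \<alpha>) = (\<integral>\<^sup>+ q. f q * indicator prob_simplex q
     \<partial>distr (density (\<Pi>\<^sub>M k\<in>?T. lborel) (\<lambda>x. ennreal (dir_density ?T ?l \<alpha> x))) borel (dir_embed ?T ?l))"
    unfolding dirichlet_eq[OF assms(1)] by (rule nn_integral_restrict_space) simp
  also have "\<dots> = (\<integral>\<^sup>+ x. ennreal (dir_density ?T ?l \<alpha> x) * (f (dir_embed ?T ?l x) * indicator prob_simplex (dir_embed ?T ?l x))
     \<partial>(\<Pi>\<^sub>M k\<in>?T. lborel))"
    by (subst nn_integral_distr, simp, simp, subst nn_integral_density) auto
  also have "\<dots> = (\<integral>\<^sup>+ x. ennreal (dir_density ?T ?l \<alpha> x) * f (dir_embed ?T ?l x) \<partial>(\<Pi>\<^sub>M k\<in>?T. lborel))"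
    by (intro nn_integral_cong)
      (auto simp: dir_density_def indicator_def simplex_kernel_eq_0)
  finally show ?thesis .
qed

lemma Gamma_shift: "0 < (x::real) \<Longrightarrow> Gamma (x + real n) = pochhammer x n * Gamma x"
proof -
  assume x: "0 < x"
  then have "x \<notin> \<int>\<^sub>\<le>\<^sub>0" by (auto elim!: nonpos_Ints_cases)
  then show ?thesis using Gamma_real_pos[OF x] pochhammer_Gamma[of x n] by simp
qed

text \<open>
  Multiplying the density by a monomial shifts the exponents, so the integral is again of Dirichlet
  type and only the Gamma factors change. The Pochhammer form also covers parameters equal to 0, where
  a positive power of the coordinate integrates to 0. The case of exponents 0 shows that the Dirichlet
  law is normalised.
\<close>
lemma nn_integral_dirichlet_monomial:
  fixes \<alpha> :: "real^'k"
  assumes pos: "0 < \<alpha> $ j" and nonneg: "\<And>k. 0 \<le> \<alpha> $ k"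
  shows "(\<integral>\<^sup>+ q. ennreal (\<Prod>k\<in>UNIV. (q $ k) ^ n k) \<partial>dirichlet \<alpha>) =
     ennreal ((\<Prod>k\<in>UNIV. pochhammer (\<alpha> $ k) (n k)) / pochhammer (\<Sum>k\<in>UNIV. \<alpha> $ k) (\<Sum>k\<in>UNIV. n k))"
proof -
  define T l S where "T = dir_free \<alpha>" and "l = dir_last \<alpha>" and "S = {k. 0 < \<alpha> $ k}"
  have ins: "insert l T = S" and l: "l \<notin> T"
    unfolding T_def l_def S_def using insert_dir_free[OF pos] by auto
  have fin: "finite T" by simp
  have S_pos: "0 < \<alpha> $ k" if "k \<in> S" for k using that by (simp add: S_def)
  have l_pos: "0 < \<alpha> $ l" and T_pos: "\<And>k. k \<in> T \<Longrightarrow> 0 < \<alpha> $ k" using ins S_pos by auto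
  have not_S: "\<alpha> $ k = 0" if "k \<notin> S" for k
    using that nonneg[of k] by (simp add: S_def)
  have sumS: "(\<Sum>k\<in>UNIV. \<alpha> $ k) = (\<Sum>k\<in>S. \<alpha> $ k)"
    by (rule sum.mono_neutral_right) (auto simp: not_S)
  have sumS_pos: "0 < (\<Sum>k\<in>S. \<alpha> $ k)"
    using ins by (intro sum_pos) (auto simp: S_pos)
  let ?\<beta> = "\<lambda>k. \<alpha> $ k + real (n k)"
  let ?C = "Gamma (\<Sum>k\<in>S. \<alpha> $ k) / (\<Prod>k\<in>S. Gamma (\<alpha> $ k))"
  have C: "0 \<le> ?C" using sumS_pos S_pos
    by (intro divide_nonneg_nonneg prod_nonneg) (auto intro!: Gamma_real_pos less_imp_le)
  have start: "(\<integral>\<^sup>+ q. ennreal (\<Prod>k\<in>UNIV. (q $ k) ^ n k) \<partial>dirichlet \<alpha>) =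
    (\<integral>\<^sup>+ x. ennreal (dir_density T l \<alpha> x) * ennreal (\<Prod>k\<in>UNIV. (dir_embed T l x $ k) ^ n k) \<partial>(\<Pi>\<^sub>M k\<in>T. lborel))"
    unfolding T_def l_def by (rule nn_integral_dirichlet[OF pos]) measurable
  show ?thesis
  proof (cases "\<forall>k. k \<notin> S \<longrightarrow> n k = 0")
    case False
    then obtain k where k: "k \<notin> S" "n k \<noteq> 0" by auto
    have "dir_embed T l x $ k = 0" for x
      using k ins by (auto simp: dir_embed_def)
    then have 1: "(\<Prod>k\<in>UNIV. (dir_embed T l x $ k) ^ n k) = 0" for x
      using k by (intro prod_zero) (auto intro!: exI[of _ k])
    have 2: "(\<Prod>k\<in>UNIV. pochhammer (\<alpha> $ k) (n k)) = 0"
      using k not_S by (intro prod_zero) (auto intro!: exI[of _ k] simp: pochhammer_0_left)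
    show ?thesis unfolding start 1 2 by simp
  next
    case True
    have sumn: "(\<Sum>k\<in>UNIV. n k) = (\<Sum>k\<in>S. n k)"
      by (rule sum.mono_neutral_right) (use True in auto)
    have dens_nonneg: "0 \<le> dir_density T l \<alpha> x" for x
      unfolding dir_density_def ins using C by (intro mult_nonneg_nonneg simplex_kernel_nonneg)
    have "dir_density T l \<alpha> x * (\<Prod>k\<in>UNIV. (dir_embed T l x $ k) ^ n k) =
       ?C * simplex_kernel T ?\<beta> (?\<beta> l) 1 x" for x
    proof (cases "(\<forall>k\<in>T. 0 < x k) \<and> (\<Sum>k\<in>T. x k) < 1")
      case *: True
      have "(\<Prod>k\<in>UNIV. (dir_embed T l x $ k) ^ n k) = (\<Prod>k\<in>insert l T. (dir_embed T l x $ k) ^ n k)"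
        by (rule prod.mono_neutral_right) (use True ins in auto)
      also have "\<dots> = (1 - (\<Sum>k\<in>T. x k)) ^ n l * (\<Prod>k\<in>T. x k ^ n k)"
        using l by (simp add: dir_embed_def cong: prod.cong)
      finally have "(\<Prod>k\<in>UNIV. (dir_embed T l x $ k) ^ n k) =
        (1 - (\<Sum>k\<in>T. x k)) powr real (n l) * (\<Prod>k\<in>T. x k powr real (n k))"
        using * by (simp add: powr_realpow cong: prod.cong)
      moreover have "(\<Prod>k\<in>T. x k powr (?\<beta> k - 1)) = (\<Prod>k\<in>T. x k powr (\<alpha> $ k - 1)) * (\<Prod>k\<in>T. x k powr real (n k))"
        unfolding prod.distrib[symmetric] by (intro prod.cong) (auto simp flip: powr_add simp: algebra_simps)
      moreover have "(1 - (\<Sum>k\<in>T. x k)) powr (?\<beta> l - 1) = (1 - (\<Sum>k\<in>T. x k)) powr (\<alpha> $ l - 1) * (1 - (\<Sum>k\<in>T. x k)) powr real (n l)"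
        by (simp flip: powr_add add: algebra_simps)
      ultimately show ?thesis using * unfolding dir_density_def ins simplex_kernel_def by simp
    next
      case *: False
      then show ?thesis unfolding dir_density_def simplex_kernel_def if_not_P[OF *] by simp
    qed
    note kernel = this
    have "(\<integral>\<^sup>+ q. ennreal (\<Prod>k\<in>UNIV. (q $ k) ^ n k) \<partial>dirichlet \<alpha>) =
      (\<integral>\<^sup>+ x. ennreal ?C * ennreal (simplex_kernel T ?\<beta> (?\<beta> l) 1 x) \<partial>(\<Pi>\<^sub>M k\<in>T. lborel))"
      unfolding start
    proof (intro nn_integral_cong)
      fix x
      show "ennreal (dir_density T l \<alpha> x) * ennreal (\<Prod>k\<in>UNIV. (dir_embed T l x $ k) ^ n k) =
        ennreal ?C * ennreal (simplex_kernel T ?\<beta> (?\<beta> l) 1 x)"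
        unfolding ennreal_mult'[OF dens_nonneg, symmetric] ennreal_mult'[OF C, symmetric] kernel ..
    qed
    also have "\<dots> = ennreal ?C * ennreal ((\<Prod>k\<in>T. Gamma (?\<beta> k)) * Gamma (?\<beta> l) / Gamma (sum ?\<beta> T + ?\<beta> l) * 1 powr (sum ?\<beta> T + ?\<beta> l - 1))"
      using l_pos T_pos
      by (subst nn_integral_cmult, simp)
        (subst nn_integral_simplex_kernel, auto intro!: add_pos_nonneg)
    also have "\<dots> = ennreal (?C * ((\<Prod>k\<in>S. Gamma (?\<beta> k)) / Gamma (sum ?\<beta> S)))"
    proof -
      have "(\<Prod>k\<in>T. Gamma (?\<beta> k)) * Gamma (?\<beta> l) / Gamma (sum ?\<beta> T + ?\<beta> l) * 1 powr (sum ?\<beta> T + ?\<beta> l - 1) =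
        (\<Prod>k\<in>S. Gamma (?\<beta> k)) / Gamma (sum ?\<beta> S)"
        unfolding ins[symmetric] prod.insert[OF fin l] sum.insert[OF fin l]
        by (simp only: powr_one_eq_one mult_1_right mult.commute add.commute)
      then show ?thesis by (simp only: ennreal_mult'[OF C])
    qed
    also have "(\<Prod>k\<in>S. Gamma (?\<beta> k)) = (\<Prod>k\<in>S. pochhammer (\<alpha> $ k) (n k)) * (\<Prod>k\<in>S. Gamma (\<alpha> $ k))"
      unfolding prod.distrib[symmetric] by (intro prod.cong refl Gamma_shift S_pos)
    also have "sum ?\<beta> S = (\<Sum>k\<in>S. \<alpha> $ k) + real (\<Sum>k\<in>S. n k)"
      by (simp add: sum.distrib)
    also have "Gamma \<dots> = pochhammer (\<Sum>k\<in>S. \<alpha> $ k) (\<Sum>k\<in>S. n k) * Gamma (\<Sum>k\<in>S. \<alpha> $ k)"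
      by (rule Gamma_shift[OF sumS_pos])
    also have "(\<Prod>k\<in>S. pochhammer (\<alpha> $ k) (n k)) = (\<Prod>k\<in>UNIV. pochhammer (\<alpha> $ k) (n k))"
      by (rule prod.mono_neutral_left) (use True in auto)
    also have "?C * ((\<Prod>k\<in>UNIV. pochhammer (\<alpha> $ k) (n k)) * (\<Prod>k\<in>S. Gamma (\<alpha> $ k)) /
        (pochhammer (\<Sum>k\<in>S. \<alpha> $ k) (\<Sum>k\<in>S. n k) * Gamma (\<Sum>k\<in>S. \<alpha> $ k))) =
       (\<Prod>k\<in>UNIV. pochhammer (\<alpha> $ k) (n k)) / pochhammer (\<Sum>k\<in>S. \<alpha> $ k) (\<Sum>k\<in>S. n k)"
    proof -
      have "Gamma (\<Sum>k\<in>S. \<alpha> $ k) \<noteq> 0" using Gamma_real_pos[OF sumS_pos] by simp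
      moreover have "(\<Prod>k\<in>S. Gamma (\<alpha> $ k)) \<noteq> 0"
        using Gamma_real_pos[OF S_pos] by (metis finite prod_zero_iff less_irrefl)
      ultimately show ?thesis by simp
    qed
    finally show ?thesis by (simp add: sumS sumn)
  qed
qed

lemma prob_space_dirichlet:
  fixes \<alpha> :: "real^'k"
  assumes pos: "0 < \<alpha> $ j" and nonneg: "\<And>k. 0 \<le> \<alpha> $ k"
  shows "prob_space (dirichlet \<alpha>)"
proof
  have "emeasure (dirichlet \<alpha>) (space (dirichlet \<alpha>)) = (\<integral>\<^sup>+ q. ennreal (\<Prod>k\<in>UNIV. (q $ k) ^ 0) \<partial>dirichlet \<alpha>)"
    by simp
  also have "\<dots> = 1"
    by (subst nn_integral_dirichlet_monomial[OF assms]) simp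
  finally show "emeasure (dirichlet \<alpha>) (space (dirichlet \<alpha>)) = 1" .
qed

lemma prob_simplexD:
  assumes "q \<in> prob_simplex"
  shows "0 \<le> q $ k" "(\<Sum>k\<in>UNIV. q $ k) = 1" "q $ k \<le> 1"
proof -
  show nonneg: "0 \<le> q $ k" for k using assms by (auto simp: prob_simplex_def)
  show sum: "(\<Sum>k\<in>UNIV. q $ k) = 1" using assms by (auto simp: prob_simplex_def)
  have "q $ k \<le> (\<Sum>k\<in>UNIV. q $ k)"
    by (rule member_le_sum) (auto simp: nonneg)
  then show "q $ k \<le> 1" by (simp add: sum)
qed

lemma pochhammer_ge_0: "0 \<le> (x::real) \<Longrightarrow> 0 \<le> pochhammer x n"
  by (auto simp: pochhammer_prod intro!: prod_nonneg)

lemma abs_prob_simplex_le: "q \<in> prob_simplex \<Longrightarrow> \<bar>q $ k\<bar> \<le> 1"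
  using prob_simplexD(1,3)[of q k] by simp

lemma prob_simplex_obtain_pos:
  assumes "q \<in> prob_simplex"
  obtains k where "0 < q $ k"
proof -
  have "\<exists>k. 0 < q $ k"
  proof (rule ccontr)
    assume "\<nexists>k. 0 < q $ k"
    then have "(\<Sum>k\<in>UNIV. q $ k) \<le> 0" by (intro sum_nonpos) (auto simp: not_less)
    then show False using prob_simplexD(2)[OF assms] by simp
  qed
  then show thesis using that by blast
qed

lemma convex_combination_prob_simplex:
  assumes q: "q \<in> prob_simplex" and \<Theta>: "\<And>k. \<Theta> k \<in> prob_simplex"
  shows "(\<Sum>k\<in>UNIV. q $ k *\<^sub>R \<Theta> k) \<in> prob_simplex"
proof -
  have "(\<Sum>v\<in>UNIV. (\<Sum>k\<in>UNIV. q $ k *\<^sub>R \<Theta> k) $ v) = (\<Sum>k\<in>UNIV. q $ k * (\<Sum>v\<in>UNIV. \<Theta> k $ v))"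
    by (simp add: sum_distrib_left) (rule sum.swap)
  also have "\<dots> = 1" using prob_simplexD(2)[OF \<Theta>] prob_simplexD(2)[OF q] by simp
  finally show ?thesis
    using prob_simplexD(1)[OF q] prob_simplexD(1)[OF \<Theta>]
    by (auto simp: prob_simplex_def intro!: sum_nonneg)
qed

lemma space_simplex_borel [simp]: "space simplex_borel = prob_simplex"
  by (simp add: space_restrict_space)

lemma sum_dirichlet_parameter: "a \<in> prob_simplex \<Longrightarrow> (\<Sum>k\<in>UNIV. (\<alpha>bar *\<^sub>R a) $ k) = \<alpha>bar"
  using prob_simplexD(2)[of a] by (simp flip: sum_distrib_left)

context
  fixes \<alpha>bar :: real and a :: "real^'k"
  assumes \<alpha>bar: "0 < \<alpha>bar" and a: "a \<in> prob_simplex"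
begin

lemma sets_dirichlet_scaled [simp, measurable_cong]: "sets (dirichlet (\<alpha>bar *\<^sub>R a)) = sets simplex_borel"
proof -
  obtain k where "0 < a $ k" using a by (rule prob_simplex_obtain_pos)
  then show ?thesis using \<alpha>bar by (intro sets_dirichlet[of _ k]) simp
qed

lemma space_dirichlet_scaled [simp]: "space (dirichlet (\<alpha>bar *\<^sub>R a)) = prob_simplex"
  using sets_eq_imp_space_eq[OF sets_dirichlet_scaled] by simp

lemma prob_space_dirichlet_scaled: "prob_space (dirichlet (\<alpha>bar *\<^sub>R a))"
proof -
  obtain k where "0 < a $ k" using a by (rule prob_simplex_obtain_pos)
  then show ?thesis using \<alpha>bar prob_simplexD(1)[OF a] by (intro prob_space_dirichlet[of _ k]) auto
qed

lemma measurable_dirichlet_scaled: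
  "f \<in> borel_measurable borel \<Longrightarrow> f \<in> borel_measurable (dirichlet (\<alpha>bar *\<^sub>R a))"
  by (subst measurable_cong_sets[OF sets_dirichlet_scaled refl]) (rule measurable_restrict_space1)

lemma integrable_dirichlet:
  fixes f :: "real^'k \<Rightarrow> real"
  assumes "f \<in> borel_measurable borel" and "\<And>q. q \<in> prob_simplex \<Longrightarrow> \<bar>f q\<bar> \<le> B"
  shows "integrable (dirichlet (\<alpha>bar *\<^sub>R a)) f"
proof -
  interpret prob_space "dirichlet (\<alpha>bar *\<^sub>R a)" by (rule prob_space_dirichlet_scaled)
  show ?thesis
    by (rule integrable_const_bound[of _ B])
      (use assms in \<open>auto intro!: AE_I2 measurable_dirichlet_scaled\<close>)
qed

text \<open>
  The closed form of the Dirichlet moments; polynomial in the weights \<open>a\<close>, which makes measurability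
  and perturbation bounds in \<open>a\<close> immediate.
\<close>
definition dir_moment :: "('k \<Rightarrow> nat) \<Rightarrow> real" where
  "dir_moment n = (\<Prod>k\<in>UNIV. pochhammer (\<alpha>bar * a $ k) (n k)) / pochhammer \<alpha>bar (\<Sum>k\<in>UNIV. n k)"

lemma integral_dirichlet_monomial:
  "(\<integral>q. (\<Prod>k\<in>UNIV. (q $ k) ^ n k) \<partial>dirichlet (\<alpha>bar *\<^sub>R a)) = dir_moment n"
proof -
  obtain j where j: "0 < a $ j" using a by (rule prob_simplex_obtain_pos)
  have "(\<integral>q. (\<Prod>k\<in>UNIV. (q $ k) ^ n k) \<partial>dirichlet (\<alpha>bar *\<^sub>R a)) =
    enn2real (\<integral>\<^sup>+ q. ennreal (\<Prod>k\<in>UNIV. (q $ k) ^ n k) \<partial>dirichlet (\<alpha>bar *\<^sub>R a))"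
    by (intro integral_eq_nn_integral measurable_dirichlet_scaled AE_I2)
      (auto intro!: prod_nonneg zero_le_power prob_simplexD(1))
  also have "\<dots> = enn2real (ennreal (dir_moment n))"
    using j \<alpha>bar prob_simplexD(1)[OF a]
    by (subst nn_integral_dirichlet_monomial[of _ j])
      (simp_all add: dir_moment_def sum_dirichlet_parameter[OF a, simplified])
  also have "\<dots> = dir_moment n"
    using \<alpha>bar prob_simplexD(1)[OF a] unfolding dir_moment_def
    by (intro enn2real_ennreal divide_nonneg_nonneg prod_nonneg)
      (auto intro!: pochhammer_ge_0)
  finally show ?thesis .
qed

lemma dir_moment_Suc:
  "dir_moment (n(l := Suc (n l))) = dir_moment n * (\<alpha>bar * a $ l + real (n l)) / (\<alpha>bar + real (sum n UNIV))"
proof -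
  have "(\<Prod>k\<in>UNIV. pochhammer (\<alpha>bar * a $ k) ((n(l := Suc (n l))) k)) =
    pochhammer (\<alpha>bar * a $ l) (Suc (n l)) * (\<Prod>k\<in>UNIV-{l}. pochhammer (\<alpha>bar * a $ k) (n k))"
    by (subst prod.remove[of _ l]) auto
  also have "\<dots> = (\<Prod>k\<in>UNIV. pochhammer (\<alpha>bar * a $ k) (n k)) * (\<alpha>bar * a $ l + real (n l))"
    by (subst (2) prod.remove[of _ l]) (auto simp: pochhammer_Suc)
  finally have 1: "(\<Prod>k\<in>UNIV. pochhammer (\<alpha>bar * a $ k) ((n(l := Suc (n l))) k)) = \<dots>" .
  have "sum (n(l := Suc (n l))) UNIV = Suc (sum n UNIV)"
    by (subst sum.remove[of _ l], simp, simp, subst (2) sum.remove[of _ l]) auto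
  then show ?thesis unfolding dir_moment_def 1 by (simp add: pochhammer_Suc)
qed

lemma integral_dirichlet_prod:
  assumes "finite J"
  shows "(\<integral>q. (\<Prod>j\<in>J. q $ \<kappa> j) \<partial>dirichlet (\<alpha>bar *\<^sub>R a)) = dir_moment (\<lambda>k. card {j\<in>J. \<kappa> j = k})"
proof -
  have "(\<Prod>j\<in>J. q $ \<kappa> j) = (\<Prod>k\<in>UNIV. q $ k ^ card {j\<in>J. \<kappa> j = k})" for q :: "real^'k"
  proof -
    have "(\<Prod>j\<in>J. q $ \<kappa> j) = (\<Prod>k\<in>UNIV. \<Prod>j\<in>{j\<in>J. \<kappa> j = k}. q $ \<kappa> j)"
      by (rule prod.group[symmetric]) (use assms in auto)
    also have "\<dots> = (\<Prod>k\<in>UNIV. \<Prod>j\<in>{j\<in>J. \<kappa> j = k}. q $ k)"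
      by (intro prod.cong) auto
    finally show ?thesis by simp
  qed
  then show ?thesis by (simp add: integral_dirichlet_monomial)
qed

lemma integral_dirichlet_Suc:
  "(\<integral>q. (\<Prod>k\<in>UNIV. (q $ k) ^ n k) * q $ l \<partial>dirichlet (\<alpha>bar *\<^sub>R a)) =
     dir_moment n * (\<alpha>bar * a $ l + real (n l)) / (\<alpha>bar + real (sum n UNIV))"
proof -
  have "(\<Prod>k\<in>UNIV. (q $ k) ^ n k) * q $ l = (\<Prod>k\<in>UNIV. (q $ k) ^ (n(l := Suc (n l))) k)" for q :: "real^'k"
    by (subst (1 2) prod.remove[of _ l]) (auto cong: prod.cong_simp)
  then show ?thesis by (simp only: integral_dirichlet_monomial dir_moment_Suc)
qed

lemma integral_dirichlet_low_order:
  shows "(\<integral>q. q $ i \<partial>dirichlet (\<alpha>bar *\<^sub>R a)) = a $ i"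
    and "(\<integral>q. q $ i * q $ j \<partial>dirichlet (\<alpha>bar *\<^sub>R a)) =
      a $ i * (\<alpha>bar * a $ j + (if j = i then 1 else 0)) / (\<alpha>bar + 1)"
    and "(\<integral>q. q $ i * q $ j * q $ l \<partial>dirichlet (\<alpha>bar *\<^sub>R a)) =
      a $ i * (\<alpha>bar * a $ j + (if j = i then 1 else 0)) *
        (\<alpha>bar * a $ l + (if l = i then 1 else 0) + (if l = j then 1 else 0)) / ((\<alpha>bar + 1) * (\<alpha>bar + 2))"
proof -
  define n1 where "n1 = (\<lambda>k. if k = i then 1 else 0 :: nat)"
  define n2 where "n2 = n1(j := Suc (n1 j))"
  have n1: "n1 = (\<lambda>_. 0)(i := Suc 0)" and sum1: "sum n1 UNIV = 1" by (auto simp: n1_def)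
  have m1: "dir_moment n1 = a $ i"
    unfolding n1 using dir_moment_Suc[of "\<lambda>_. 0" i] \<alpha>bar by (simp add: dir_moment_def)
  have p1: "(\<Prod>k\<in>UNIV. (q $ k) ^ n1 k) = q $ i" for q :: "real^'k"
    by (subst prod.remove[of _ i]) (auto simp: n1_def)
  have sum2: "sum n2 UNIV = 2"
  proof -
    have "sum n2 UNIV = Suc (n1 j) + sum n1 (UNIV - {j})"
      unfolding n2_def by (subst sum.remove[of _ j]) auto
    also have "\<dots> = Suc (sum n1 UNIV)" by (subst (2) sum.remove[of _ j]) auto
    finally show ?thesis using sum1 by simp
  qed
  have m2: "dir_moment n2 = a $ i * (\<alpha>bar * a $ j + (if j = i then 1 else 0)) / (\<alpha>bar + 1)"
    unfolding n2_def dir_moment_Suc m1 sum1 by (simp add: n1_def)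
  have p2: "(\<Prod>k\<in>UNIV. (q $ k) ^ n2 k) = q $ i * q $ j" for q :: "real^'k"
  proof -
    have "(\<Prod>k\<in>UNIV. (q $ k) ^ n2 k) = q $ j * (q $ j ^ n1 j * (\<Prod>k\<in>UNIV-{j}. (q $ k) ^ n1 k))"
      unfolding n2_def by (subst prod.remove[of _ j]) (auto simp: mult_ac)
    also have "q $ j ^ n1 j * (\<Prod>k\<in>UNIV-{j}. (q $ k) ^ n1 k) = (\<Prod>k\<in>UNIV. (q $ k) ^ n1 k)"
      by (subst (2) prod.remove[of _ j]) auto
    finally show ?thesis by (simp add: p1)
  qed
  show "(\<integral>q. q $ i \<partial>dirichlet (\<alpha>bar *\<^sub>R a)) = a $ i"
    using integral_dirichlet_monomial[of n1] unfolding p1 m1 .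
  show "(\<integral>q. q $ i * q $ j \<partial>dirichlet (\<alpha>bar *\<^sub>R a)) =
      a $ i * (\<alpha>bar * a $ j + (if j = i then 1 else 0)) / (\<alpha>bar + 1)"
    using integral_dirichlet_monomial[of n2] unfolding p2 m2 .
  have "real (n2 l) = (if l = i then 1 else 0) + (if l = j then 1 else 0)"
    by (auto simp: n2_def n1_def)
  then show "(\<integral>q. q $ i * q $ j * q $ l \<partial>dirichlet (\<alpha>bar *\<^sub>R a)) =
      a $ i * (\<alpha>bar * a $ j + (if j = i then 1 else 0)) *
        (\<alpha>bar * a $ l + (if l = i then 1 else 0) + (if l = j then 1 else 0)) / ((\<alpha>bar + 1) * (\<alpha>bar + 2))"
    using integral_dirichlet_Suc[of n2 l] unfolding p2 m2 sum2 by simp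
qed

section \<open>The law of a document\<close>

text \<open>
  Expanding the product of mixtures writes the probability of a document as a sum over the topic
  assignments of its words, with nonnegative coefficients.
\<close>
lemma lda_prob_expansion:
  fixes \<Theta> :: "'k \<Rightarrow> real^'v"
  shows "lda_prob \<alpha>bar a \<Theta> x =
    (\<Sum>\<kappa>\<in>{..<length x} \<rightarrow>\<^sub>E UNIV. dir_moment (\<lambda>k. card {j\<in>{..<length x}. \<kappa> j = k}) *
        (\<Prod>j<length x. \<Theta> (\<kappa> j) $ (x ! j)))"
proof -
  have "lda_prob \<alpha>bar a \<Theta> x = (\<integral>q. (\<Sum>\<kappa>\<in>{..<length x} \<rightarrow>\<^sub>E UNIV.
      (\<Prod>j<length x. q $ \<kappa> j) * (\<Prod>j<length x. \<Theta> (\<kappa> j) $ (x ! j))) \<partial>dirichlet (\<alpha>bar *\<^sub>R a))"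
    unfolding lda_prob_def by (subst prod_sum_PiE) (auto simp: prod.distrib)
  also have "\<dots> = (\<Sum>\<kappa>\<in>{..<length x} \<rightarrow>\<^sub>E UNIV. (\<integral>q. (\<Prod>j<length x. q $ \<kappa> j) \<partial>dirichlet (\<alpha>bar *\<^sub>R a)) *
     (\<Prod>j<length x. \<Theta> (\<kappa> j) $ (x ! j)))"
  proof (subst Bochner_Integration.integral_sum)
    fix \<kappa> :: "nat \<Rightarrow> 'k"
    show "integrable (dirichlet (\<alpha>bar *\<^sub>R a)) (\<lambda>q. (\<Prod>j<length x. q $ \<kappa> j) * (\<Prod>j<length x. \<Theta> (\<kappa> j) $ (x ! j)))"
      by (intro integrable_mult_left integrable_dirichlet[of _ 1])
        (auto simp: abs_prod intro!: prod_le_1 abs_prob_simplex_le)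
  qed simp
  finally show ?thesis by (simp add: integral_dirichlet_prod)
qed

end

lemma pochhammer_shrink:
  fixes x y t :: real
  assumes "(1 - t) * y \<le> x" "0 \<le> t" "t \<le> 1" "0 \<le> y"
  shows "(1 - t) ^ n * pochhammer y n \<le> pochhammer x n"
proof -
  have "(1 - t) ^ n * pochhammer y n = (\<Prod>i<n. (1 - t) * (y + real i))"
    by (simp add: pochhammer_prod prod.distrib atLeast0LessThan)
  also have "\<dots> \<le> (\<Prod>i<n. x + real i)"
  proof (intro prod_mono conjI)
    fix i
    show "0 \<le> (1 - t) * (y + real i)" using assms by simp
    have "(1 - t) * real i \<le> 1 * real i" using assms by (intro mult_right_mono) auto
    then show "(1 - t) * (y + real i) \<le> x + real i" using assms(1) by (simp add: algebra_simps)
  qed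
  also have "\<dots> = pochhammer x n" by (simp add: pochhammer_prod atLeast0LessThan)
  finally show ?thesis .
qed

lemma sum_card_fibres:
  "finite J \<Longrightarrow> (\<Sum>k\<in>(UNIV::'k::finite set). card {j\<in>J. \<kappa> j = k}) = card J"
  using sum.group[of J UNIV \<kappa> "\<lambda>_. 1::nat"] by simp

text \<open>
  Up to a constant, every term of the expansion is a product of \<open>length x\<close> factors affine in the weights
  with nonnegative coefficients, and of \<open>length x\<close> entries of the topics. A one-sided relative perturbation of the parameters therefore
  costs only a factor, without any Lipschitz estimate.
\<close>
lemma lda_prob_shrink:
  fixes a a' :: "real^'k" and \<Theta> \<Theta>' :: "'k \<Rightarrow> real^'v"
  assumes \<alpha>bar: "0 < \<alpha>bar" and a: "a \<in> prob_simplex" and a': "a' \<in> prob_simplex"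
    and \<Theta>': "\<And>k v. 0 \<le> \<Theta>' k $ v"
    and t: "0 \<le> t" "t \<le> 1"
    and le: "\<And>k. (1 - t) * a' $ k \<le> a $ k" "\<And>k v. (1 - t) * \<Theta>' k $ v \<le> \<Theta> k $ v"
  shows "(1 - t) ^ (2 * length x) * lda_prob \<alpha>bar a' \<Theta>' x \<le> lda_prob \<alpha>bar a \<Theta> x"
proof -
  let ?c = "\<lambda>\<kappa> k. card {j\<in>{..<length x}. \<kappa> j = (k::'k)}"
  have c: "sum (?c \<kappa>) UNIV = length x" for \<kappa> using sum_card_fibres[of "{..<length x}" \<kappa>] by simp
  have poch: "0 < pochhammer \<alpha>bar (length x)" using \<alpha>bar by (rule pochhammer_pos)
  have nonneg: "0 \<le> \<alpha>bar * a' $ k" for k using \<alpha>bar prob_simplexD(1)[OF a'] by simp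
  have le': "(1 - t) * (\<alpha>bar * a' $ k) \<le> \<alpha>bar * a $ k" for k
    using mult_left_mono[OF le(1)[of k], of \<alpha>bar] \<alpha>bar by (simp add: algebra_simps)
  have 1: "(1 - t) ^ length x * dir_moment \<alpha>bar a' (?c \<kappa>) \<le> dir_moment \<alpha>bar a (?c \<kappa>)" for \<kappa>
  proof -
    have "(1 - t) ^ length x * (\<Prod>k\<in>UNIV. pochhammer (\<alpha>bar * a' $ k) (?c \<kappa> k)) =
       (\<Prod>k\<in>UNIV. (1 - t) ^ ?c \<kappa> k * pochhammer (\<alpha>bar * a' $ k) (?c \<kappa> k))"
    proof -
      have "(1 - t) ^ length x = (\<Prod>k\<in>UNIV. (1 - t) ^ ?c \<kappa> k)"
        by (simp only: power_sum[symmetric] c)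
      then show ?thesis by (simp only: prod.distrib)
    qed
    also have "\<dots> \<le> (\<Prod>k\<in>UNIV. pochhammer (\<alpha>bar * a $ k) (?c \<kappa> k))"
      using t by (intro prod_mono conjI pochhammer_shrink le' nonneg)
        (auto intro!: mult_nonneg_nonneg pochhammer_ge_0 nonneg)
    finally show ?thesis
      unfolding dir_moment_def[OF \<alpha>bar a] dir_moment_def[OF \<alpha>bar a'] c
      using poch by (simp add: divide_right_mono)
  qed
  have dm_nonneg: "0 \<le> dir_moment \<alpha>bar a' (?c \<kappa>)" for \<kappa>
    unfolding dir_moment_def[OF \<alpha>bar a'] c using poch nonneg
    by (intro divide_nonneg_pos prod_nonneg) (auto intro!: pochhammer_ge_0)
  have 2: "(1 - t) ^ length x * (\<Prod>j<length x. \<Theta>' (\<kappa> j) $ (x ! j)) \<le> (\<Prod>j<length x. \<Theta> (\<kappa> j) $ (x ! j))" for \<kappa>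
  proof -
    have "(1 - t) ^ length x * (\<Prod>j<length x. \<Theta>' (\<kappa> j) $ (x ! j)) = (\<Prod>j<length x. (1 - t) * \<Theta>' (\<kappa> j) $ (x ! j))"
      by (simp add: prod.distrib)
    also have "\<dots> \<le> (\<Prod>j<length x. \<Theta> (\<kappa> j) $ (x ! j))"
      using t \<Theta>' le(2) by (intro prod_mono) auto
    finally show ?thesis .
  qed
  have "(1 - t) ^ (2 * length x) * lda_prob \<alpha>bar a' \<Theta>' x =
    (\<Sum>\<kappa>\<in>{..<length x} \<rightarrow>\<^sub>E UNIV. ((1 - t) ^ length x * dir_moment \<alpha>bar a' (?c \<kappa>)) *
        ((1 - t) ^ length x * (\<Prod>j<length x. \<Theta>' (\<kappa> j) $ (x ! j))))"
    unfolding lda_prob_expansion[OF \<alpha>bar a'] sum_distrib_left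
    by (intro sum.cong) (simp_all add: mult_2 power_add)
  also have "\<dots> \<le> lda_prob \<alpha>bar a \<Theta> x"
    unfolding lda_prob_expansion[OF \<alpha>bar a]
    by (intro sum_mono mult_mono 1 2 order_trans[OF _ 1] mult_nonneg_nonneg prod_nonneg dm_nonneg)
      (use t \<Theta>' in auto)
  finally show ?thesis .
qed

definition atom_moment1 :: "real^'k \<Rightarrow> ('k \<Rightarrow> real^'v) \<Rightarrow> 'v \<Rightarrow> real" where
  "atom_moment1 a \<Theta> u = (\<Sum>k\<in>UNIV. a $ k * \<Theta> k $ u)"

definition atom_moment2 :: "real^'k \<Rightarrow> ('k \<Rightarrow> real^'v) \<Rightarrow> 'v \<Rightarrow> 'v \<Rightarrow> real" where
  "atom_moment2 a \<Theta> u v = (\<Sum>k\<in>UNIV. a $ k * \<Theta> k $ u * \<Theta> k $ v)"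

definition atom_moment3 :: "real^'k \<Rightarrow> ('k \<Rightarrow> real^'v) \<Rightarrow> 'v \<Rightarrow> 'v \<Rightarrow> 'v \<Rightarrow> real" where
  "atom_moment3 a \<Theta> u v w = (\<Sum>k\<in>UNIV. a $ k * \<Theta> k $ u * \<Theta> k $ v * \<Theta> k $ w)"

context
  fixes \<alpha>bar :: real and a :: "real^'k" and \<Theta> :: "'k \<Rightarrow> real^'v"
  assumes \<alpha>bar: "0 < \<alpha>bar" and a: "a \<in> prob_simplex" and \<Theta>: "\<And>k. \<Theta> k \<in> prob_simplex"
begin

lemma mixture_component_bounds:
  assumes "q \<in> prob_simplex"
  shows "0 \<le> (\<Sum>k\<in>UNIV. q $ k * \<Theta> k $ v)" "(\<Sum>k\<in>UNIV. q $ k * \<Theta> k $ v) \<le> 1"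
  using prob_simplexD(1,3)[OF convex_combination_prob_simplex[of q \<Theta>, OF assms \<Theta>], of v]
  by simp_all

lemma lda_prob_nonneg: "0 \<le> lda_prob \<alpha>bar a \<Theta> x"
  unfolding lda_prob_def
  by (rule integral_nonneg_AE, rule AE_I2)
    (auto simp: space_dirichlet_scaled[OF \<alpha>bar a] intro!: prod_nonneg mixture_component_bounds)

lemma lda_prob_Nil: "lda_prob \<alpha>bar a \<Theta> [] = 1"
  using prob_space.prob_space[OF prob_space_dirichlet_scaled[OF \<alpha>bar a]]
  by (simp add: lda_prob_def)

lemma lda_prob_snoc: "(\<Sum>v\<in>UNIV. lda_prob \<alpha>bar a \<Theta> (x @ [v])) = lda_prob \<alpha>bar a \<Theta> x"
proof -
  let ?f = "\<lambda>q. \<Prod>j<length x. \<Sum>k\<in>UNIV. q $ k * \<Theta> k $ (x ! j)"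
  have "(\<Sum>v\<in>UNIV. lda_prob \<alpha>bar a \<Theta> (x @ [v])) =
    (\<Sum>v\<in>UNIV. \<integral>q. ?f q * (\<Sum>k\<in>UNIV. q $ k * \<Theta> k $ v) \<partial>dirichlet (\<alpha>bar *\<^sub>R a))"
    unfolding lda_prob_def by (simp add: nth_append cong: prod.cong_simp)
  also have "\<dots> = (\<integral>q. (\<Sum>v\<in>UNIV. ?f q * (\<Sum>k\<in>UNIV. q $ k * \<Theta> k $ v)) \<partial>dirichlet (\<alpha>bar *\<^sub>R a))"
  proof (rule Bochner_Integration.integral_sum[symmetric])
    fix v
    show "integrable (dirichlet (\<alpha>bar *\<^sub>R a)) (\<lambda>q. ?f q * (\<Sum>k\<in>UNIV. q $ k * \<Theta> k $ v))"
      using mixture_component_bounds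
      by (intro integrable_dirichlet[OF \<alpha>bar a, of _ 1])
       (auto simp: abs_mult abs_prod intro!: mult_le_one prod_le_1)
  qed
  also have "\<dots> = lda_prob \<alpha>bar a \<Theta> x"
    unfolding lda_prob_def
  proof (rule Bochner_Integration.integral_cong[OF refl])
    fix q assume "q \<in> space (dirichlet (\<alpha>bar *\<^sub>R a))"
    then have "q \<in> prob_simplex" by (simp add: space_dirichlet_scaled[OF \<alpha>bar a])
    then have "(\<Sum>v\<in>UNIV. \<Sum>k\<in>UNIV. q $ k * \<Theta> k $ v) = 1"
      using prob_simplexD(2)[OF convex_combination_prob_simplex[of q \<Theta>, OF _ \<Theta>]] by simp
    then show "(\<Sum>v\<in>UNIV. ?f q * (\<Sum>k\<in>UNIV. q $ k * \<Theta> k $ v)) = ?f q"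
      by (simp flip: sum_distrib_left)
  qed
  finally show ?thesis .
qed

lemma finite_lists_length [simp]: "finite {y::'v list. length y = n}"
  using finite_lists_length_eq[of "UNIV::'v set" n] by simp

lemma sum_lists_Suc:
  fixes f :: "'v list \<Rightarrow> real"
  shows "(\<Sum>y\<in>{y. length y = Suc n}. f y) = (\<Sum>y\<in>{y. length y = n}. \<Sum>v\<in>UNIV. f (y @ [v]))"
proof -
  have "(\<Sum>y\<in>{y. length y = n}. \<Sum>v\<in>UNIV. f (y @ [v])) = (\<Sum>(y, v)\<in>{y. length y = n} \<times> UNIV. f (y @ [v]))"
    by (rule sum.cartesian_product)
  also have "\<dots> = (\<Sum>y\<in>{y. length y = Suc n}. f y)"
    by (rule sum.reindex_bij_witness[of _ "\<lambda>y. (butlast y, last y)" "\<lambda>(y, v). y @ [v]"])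
      (auto, metis append_butlast_last_id length_0_conv nat.distinct(1))
  finally show ?thesis by simp
qed

text \<open>
  The first words of a document form a document of the same model. In particular the law of \<open>N\<close>
  words determines that of three words.
\<close>
lemma lda_prob_marginal: "(\<Sum>y\<in>{y. length y = n}. lda_prob \<alpha>bar a \<Theta> (x @ y)) = lda_prob \<alpha>bar a \<Theta> x"
proof (induction n)
  case (Suc n)
  have "(\<Sum>v\<in>UNIV. lda_prob \<alpha>bar a \<Theta> (x @ y @ [v])) = lda_prob \<alpha>bar a \<Theta> (x @ y)" for y
    using lda_prob_snoc[of "x @ y"] by simp
  then show ?case by (simp add: sum_lists_Suc Suc)
qed simp

lemma pmf_lda_pmf: "pmf (lda_pmf \<alpha>bar N a \<Theta>) x = (if length x = N then lda_prob \<alpha>bar a \<Theta> x else 0)"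
  unfolding lda_pmf_def
proof (rule pmf_embed_pmf)
  show "0 \<le> (if length x = N then lda_prob \<alpha>bar a \<Theta> x else 0)" for x by (simp add: lda_prob_nonneg)
  have "(\<integral>\<^sup>+x. ennreal (if length x = N then lda_prob \<alpha>bar a \<Theta> x else 0) \<partial>count_space UNIV) =
    (\<Sum>x\<in>{x. length x = N}. ennreal (lda_prob \<alpha>bar a \<Theta> x))"
    by (subst nn_integral_count_space'[of "{x. length x = N}"]) (auto simp: lda_prob_nonneg)
  also have "\<dots> = 1"
    using lda_prob_marginal[where x="[]" and n=N] by (subst sum_ennreal) (auto simp: lda_prob_nonneg lda_prob_Nil)
  finally show "(\<integral>\<^sup>+x. ennreal (if length x = N then lda_prob \<alpha>bar a \<Theta> x else 0) \<partial>count_space UNIV) = 1" .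
qed

lemma lda_prob_1: "lda_prob \<alpha>bar a \<Theta> [u] = atom_moment1 a \<Theta> u"
proof -
  have "lda_prob \<alpha>bar a \<Theta> [u] = (\<integral>q. (\<Sum>i\<in>UNIV. q $ i * \<Theta> i $ u) \<partial>dirichlet (\<alpha>bar *\<^sub>R a))"
    by (simp add: lda_prob_def)
  also have "\<dots> = (\<Sum>i\<in>UNIV. (\<integral>q. q $ i \<partial>dirichlet (\<alpha>bar *\<^sub>R a)) * \<Theta> i $ u)"
    by (subst Bochner_Integration.integral_sum)
      (auto intro!: integrable_mult_left integrable_dirichlet[OF \<alpha>bar a, of _ 1] abs_prob_simplex_le)
  finally show ?thesis by (simp add: integral_dirichlet_low_order[OF \<alpha>bar a] atom_moment1_def)
qed

text \<open>
  The Dirichlet correlation mixes the second moment of the mixing measure with a product of first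
  moments. As \<open>\<alpha>bar\<close> is known, the equation can be solved for the second moment.
\<close>
lemma lda_prob_2:
  "(\<alpha>bar + 1) * lda_prob \<alpha>bar a \<Theta> [u, v] =
     \<alpha>bar * (atom_moment1 a \<Theta> u * atom_moment1 a \<Theta> v) + atom_moment2 a \<Theta> u v"
proof -
  have "lda_prob \<alpha>bar a \<Theta> [u, v] =
    (\<integral>q. (\<Sum>i\<in>UNIV. \<Sum>j\<in>UNIV. q $ i * q $ j * (\<Theta> i $ u * \<Theta> j $ v)) \<partial>dirichlet (\<alpha>bar *\<^sub>R a))"
    by (simp add: lda_prob_def sum_product lessThan_Suc mult_ac)
  also have "\<dots> = (\<Sum>i\<in>UNIV. \<Sum>j\<in>UNIV. (\<integral>q. q $ i * q $ j \<partial>dirichlet (\<alpha>bar *\<^sub>R a)) * (\<Theta> i $ u * \<Theta> j $ v))"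
  proof -
    have int: "integrable (dirichlet (\<alpha>bar *\<^sub>R a)) (\<lambda>q. q $ i * q $ j * c)" for i j c
      by (intro integrable_mult_left integrable_dirichlet[OF \<alpha>bar a, of _ 1])
        (auto simp: abs_mult intro!: abs_prob_simplex_le mult_le_one)
    show ?thesis
      by (subst Bochner_Integration.integral_sum, intro Bochner_Integration.integrable_sum int,
        intro sum.cong refl,
        subst Bochner_Integration.integral_sum, intro int, simp)
  qed
  also have "(\<alpha>bar + 1) * \<dots> = (\<Sum>i\<in>UNIV. a $ i * \<Theta> i $ u * (\<Sum>j\<in>UNIV. \<Theta> j $ v * (\<alpha>bar * a $ j + (if j = i then 1 else 0))))"
    unfolding integral_dirichlet_low_order[OF \<alpha>bar a] sum_distrib_left
    using \<alpha>bar by (intro sum.cong) (simp_all add: field_simps)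
  also have "\<dots> = (\<Sum>i\<in>UNIV. a $ i * \<Theta> i $ u * (\<alpha>bar * atom_moment1 a \<Theta> v + \<Theta> i $ v))"
    unfolding atom_moment1_def
    by (simp add: distrib_left sum.distrib sum_distrib_left mult_ac if_distrib[of "\<lambda>x. _ * x"] cong: if_cong)
  also have "\<dots> = \<alpha>bar * (atom_moment1 a \<Theta> u * atom_moment1 a \<Theta> v) + atom_moment2 a \<Theta> u v"
    by (simp add: distrib_left sum.distrib sum_distrib_right sum_distrib_left mult_ac
        atom_moment1_def[of a \<Theta> u] atom_moment2_def)
  finally show ?thesis .
qed

lemma lda_prob_3:
  "(\<alpha>bar + 1) * (\<alpha>bar + 2) * lda_prob \<alpha>bar a \<Theta> [u, v, w] =
     \<alpha>bar ^ 2 * (atom_moment1 a \<Theta> u * atom_moment1 a \<Theta> v * atom_moment1 a \<Theta> w) +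
     \<alpha>bar * (atom_moment2 a \<Theta> u v * atom_moment1 a \<Theta> w + atom_moment2 a \<Theta> u w * atom_moment1 a \<Theta> v +
       atom_moment2 a \<Theta> v w * atom_moment1 a \<Theta> u) +
     2 * atom_moment3 a \<Theta> u v w"
proof -
  let ?D = "dirichlet (\<alpha>bar *\<^sub>R a)"
  let ?I = "\<lambda>i j. if j = (i::'k) then 1 else 0 :: real"
  let ?m = "atom_moment1 a \<Theta>"
  have "lda_prob \<alpha>bar a \<Theta> [u, v, w] =
    (\<integral>q. (\<Sum>i\<in>UNIV. \<Sum>j\<in>UNIV. \<Sum>l\<in>UNIV. q $ i * q $ j * q $ l * (\<Theta> i $ u * \<Theta> j $ v * \<Theta> l $ w)) \<partial>?D)"
  proof -
    have "(\<Prod>j<length [u, v, w]. \<Sum>k\<in>UNIV. q $ k * \<Theta> k $ ([u, v, w] ! j)) =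
      (\<Sum>k\<in>UNIV. q $ k * \<Theta> k $ u) * ((\<Sum>k\<in>UNIV. q $ k * \<Theta> k $ v) * (\<Sum>k\<in>UNIV. q $ k * \<Theta> k $ w))" for q
      by (simp add: lessThan_Suc mult_ac)
    moreover have "(\<Sum>i\<in>UNIV. x i) * ((\<Sum>j\<in>UNIV. y j) * (\<Sum>l\<in>UNIV. z l)) =
      (\<Sum>i\<in>UNIV. \<Sum>j\<in>UNIV. \<Sum>l\<in>UNIV. x i * (y j * z l))" for x y z :: "'k \<Rightarrow> real"
      by (subst sum_product, subst sum_product) (simp only: sum_distrib_left)
    ultimately show ?thesis unfolding lda_prob_def
      by (simp add: mult_ac)
  qed
  also have "\<dots> = (\<Sum>i\<in>UNIV. \<Sum>j\<in>UNIV. \<Sum>l\<in>UNIV. (\<integral>q. q $ i * q $ j * q $ l \<partial>?D) * (\<Theta> i $ u * \<Theta> j $ v * \<Theta> l $ w))"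
  proof -
    have int: "integrable ?D (\<lambda>q. q $ i * q $ j * q $ l * c)" for i j l c
      by (intro integrable_mult_left integrable_dirichlet[OF \<alpha>bar a, of _ 1])
        (auto simp: abs_mult intro!: abs_prob_simplex_le mult_le_one)
    show ?thesis
      by (subst Bochner_Integration.integral_sum, intro Bochner_Integration.integrable_sum int,
        intro sum.cong refl,
        subst Bochner_Integration.integral_sum, intro Bochner_Integration.integrable_sum int,
        intro sum.cong refl,
        subst Bochner_Integration.integral_sum, intro int, simp)
  qed
  finally have "(\<alpha>bar + 1) * (\<alpha>bar + 2) * lda_prob \<alpha>bar a \<Theta> [u, v, w] = (\<alpha>bar + 1) * (\<alpha>bar + 2) *
    (\<Sum>i\<in>UNIV. \<Sum>j\<in>UNIV. \<Sum>l\<in>UNIV. (\<integral>q. q $ i * q $ j * q $ l \<partial>?D) * (\<Theta> i $ u * \<Theta> j $ v * \<Theta> l $ w))"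
    by (rule arg_cong)
  also have "\<dots> = (\<Sum>i\<in>UNIV. a $ i * \<Theta> i $ u *
      (\<Sum>j\<in>UNIV. \<Theta> j $ v * (\<alpha>bar * a $ j + ?I i j) * (\<Sum>l\<in>UNIV. \<Theta> l $ w * (\<alpha>bar * a $ l + ?I i l + ?I j l))))"
    unfolding integral_dirichlet_low_order[OF \<alpha>bar a] sum_distrib_left
  proof (intro sum.cong refl)
    fix i j l
    have "(\<alpha>bar + 1) * (\<alpha>bar + 2) * (x / ((\<alpha>bar + 1) * (\<alpha>bar + 2)) * y) = x * y" for x y
      using \<alpha>bar by simp
    then show "(\<alpha>bar + 1) * (\<alpha>bar + 2) * (a $ i * (\<alpha>bar * a $ j + ?I i j) * (\<alpha>bar * a $ l + ?I i l + ?I j l) /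
       ((\<alpha>bar + 1) * (\<alpha>bar + 2)) * (\<Theta> i $ u * \<Theta> j $ v * \<Theta> l $ w)) =
       a $ i * \<Theta> i $ u * (\<Theta> j $ v * (\<alpha>bar * a $ j + ?I i j) * (\<Theta> l $ w * (\<alpha>bar * a $ l + ?I i l + ?I j l)))"
      by (simp only:) (simp add: mult_ac)
  qed
  also have "\<dots> = (\<Sum>i\<in>UNIV. a $ i * \<Theta> i $ u *
      (\<Sum>j\<in>UNIV. \<Theta> j $ v * (\<alpha>bar * a $ j + ?I i j) * (\<alpha>bar * ?m w + \<Theta> i $ w + \<Theta> j $ w)))"
  proof -
    have "(\<Sum>l\<in>UNIV. \<Theta> l $ w * (\<alpha>bar * a $ l + ?I i l + ?I j l)) = \<alpha>bar * ?m w + \<Theta> i $ w + \<Theta> j $ w" for i j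
      unfolding atom_moment1_def
      by (simp add: distrib_left sum.distrib sum_distrib_left mult_ac if_distrib[of "\<lambda>x. _ * x"] cong: if_cong)
    then show ?thesis by simp
  qed
  also have "\<dots> = (\<Sum>i\<in>UNIV. a $ i * \<Theta> i $ u *
      (\<alpha>bar * ?m v * (\<alpha>bar * ?m w + \<Theta> i $ w) + \<alpha>bar * atom_moment2 a \<Theta> v w +
        \<Theta> i $ v * (\<alpha>bar * ?m w + 2 * \<Theta> i $ w)))"
  proof -
    have "(\<Sum>j\<in>UNIV. \<Theta> j $ v * (\<alpha>bar * a $ j + ?I i j) * (c + \<Theta> j $ w)) =
       \<alpha>bar * ?m v * c + \<alpha>bar * atom_moment2 a \<Theta> v w + \<Theta> i $ v * (c + \<Theta> i $ w)" for i c
    proof -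
      have "(\<Sum>j\<in>UNIV. \<Theta> j $ v * (\<alpha>bar * a $ j + ?I i j) * (c + \<Theta> j $ w)) =
        (\<Sum>j\<in>UNIV. \<alpha>bar * c * (a $ j * \<Theta> j $ v) + \<alpha>bar * (a $ j * \<Theta> j $ v * \<Theta> j $ w) +
           (if j = i then \<Theta> j $ v * (c + \<Theta> j $ w) else 0))"
        by (intro sum.cong) (simp_all add: algebra_simps)
      also have "\<dots> = \<alpha>bar * c * ?m v + \<alpha>bar * atom_moment2 a \<Theta> v w + \<Theta> i $ v * (c + \<Theta> i $ w)"
        unfolding atom_moment1_def atom_moment2_def sum.distrib by (simp add: sum_distrib_left)
      finally show ?thesis by (simp add: mult_ac)
    qed
    then show ?thesis by (intro sum.cong refl) (simp only:, simp add: algebra_simps)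
  qed
  also have "\<dots> = (\<Sum>i\<in>UNIV. \<alpha>bar^2 * ?m v * ?m w * (a $ i * \<Theta> i $ u) + \<alpha>bar * ?m v * (a $ i * \<Theta> i $ u * \<Theta> i $ w) +
      \<alpha>bar * atom_moment2 a \<Theta> v w * (a $ i * \<Theta> i $ u) + \<alpha>bar * ?m w * (a $ i * \<Theta> i $ u * \<Theta> i $ v) +
      2 * (a $ i * \<Theta> i $ u * \<Theta> i $ v * \<Theta> i $ w))"
    by (intro sum.cong) (simp_all add: algebra_simps power2_eq_square)
  also have "\<dots> = \<alpha>bar^2 * ?m v * ?m w * ?m u + \<alpha>bar * ?m v * atom_moment2 a \<Theta> u w +
      \<alpha>bar * atom_moment2 a \<Theta> v w * ?m u + \<alpha>bar * ?m w * atom_moment2 a \<Theta> u v + 2 * atom_moment3 a \<Theta> u v w"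
    unfolding sum.distrib by (simp only: atom_moment1_def[of a \<Theta> u] atom_moment2_def[of a \<Theta> u] atom_moment3_def sum_distrib_left)
  finally show ?thesis by (simp add: algebra_simps)
qed

end

lemma pmf_multi: "\<eta> \<in> prob_simplex \<Longrightarrow> pmf (multi \<eta>) v = \<eta> $ v"
  unfolding multi_def
proof (rule pmf_embed_pmf)
  assume \<eta>: "\<eta> \<in> prob_simplex"
  then show "0 \<le> \<eta> $ v" for v by (rule prob_simplexD)
  show "(\<integral>\<^sup>+v. ennreal (\<eta> $ v) \<partial>count_space UNIV) = 1"
    using prob_simplexD[OF \<eta>] by (subst nn_integral_count_space_finite) (auto simp: sum_ennreal)
qed

lemma pmf_replicate_pmf:
  "pmf (replicate_pmf n p) xs = (if length xs = n then prod_list (map (pmf p) xs) else 0)"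
proof (induction n arbitrary: xs)
  case 0
  then show ?case by (auto simp: indicator_def)
next
  case (Suc n)
  have eq: "replicate_pmf (Suc n) p = map_pmf (\<lambda>(x, xs). x # xs) (pair_pmf p (replicate_pmf n p))"
    by (simp add: pair_pmf_def map_bind_pmf bind_map_pmf map_pmf_def bind_assoc_pmf bind_return_pmf)
  show ?case
  proof (cases xs)
    case Nil
    have "[] \<notin> set_pmf (replicate_pmf (Suc n) p)" unfolding eq by auto
    then show ?thesis using Nil by (simp add: pmf_eq_0_set_pmf)
  next
    case (Cons y ys)
    have "pmf (replicate_pmf (Suc n) p) ((\<lambda>(x, xs). x # xs) (y, ys)) = pmf (pair_pmf p (replicate_pmf n p)) (y, ys)"
      unfolding eq by (rule pmf_map_inj') (auto simp: inj_on_def)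
    then show ?thesis using Cons Suc by (simp add: pmf_pair del: replicate_pmf.simps)
  qed
qed

section \<open>Recovering the mixing measure from the distribution of a document\<close>

text \<open>
  Both sides equal \<open>tr ((Y Y^T)^2) - 2 tr (Y Y^T) + K\<close>, and the traces of \<open>Y Y^T\<close> and \<open>Y^T Y\<close> and of
  their squares agree.
\<close>
lemma gram_defect_transpose:
  fixes y :: "'k::finite \<Rightarrow> 'k \<Rightarrow> real"
  shows "(\<Sum>p\<in>UNIV. \<Sum>r\<in>UNIV. ((\<Sum>l\<in>UNIV. y l p * y l r) - (if p = r then 1 else 0))\<^sup>2) =
     (\<Sum>i\<in>UNIV. \<Sum>j\<in>UNIV. ((\<Sum>k\<in>UNIV. y i k * y j k) - (if i = j then 1 else 0))\<^sup>2)"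
proof -
  have expand: "(\<Sum>p\<in>UNIV. \<Sum>r\<in>UNIV. ((\<Sum>l\<in>UNIV. x l p * x l r) - (if p = r then 1 else 0))\<^sup>2) =
    (\<Sum>p\<in>UNIV. \<Sum>r\<in>UNIV. (\<Sum>l\<in>UNIV. x l p * x l r)\<^sup>2) - 2 * (\<Sum>p\<in>UNIV. \<Sum>l\<in>UNIV. x l p * x l p) + real CARD('k)"
    for x :: "'k \<Rightarrow> 'k \<Rightarrow> real"
  proof -
    have "((\<Sum>l\<in>UNIV. x l p * x l r) - (if p = r then 1 else 0))\<^sup>2 =
      (\<Sum>l\<in>UNIV. x l p * x l r)\<^sup>2 - (if p = r then 2 * (\<Sum>l\<in>UNIV. x l p * x l p) - 1 else 0)" for p r
      by (simp add: power2_diff)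
    then have "(\<Sum>p\<in>UNIV. \<Sum>r\<in>UNIV. ((\<Sum>l\<in>UNIV. x l p * x l r) - (if p = r then 1 else 0))\<^sup>2) =
      (\<Sum>p\<in>UNIV. \<Sum>r\<in>UNIV. (\<Sum>l\<in>UNIV. x l p * x l r)\<^sup>2) - (\<Sum>p\<in>UNIV. 2 * (\<Sum>l\<in>UNIV. x l p * x l p) - 1)"
      by (simp add: sum_subtractf)
    then show ?thesis by (simp add: sum_subtractf sum_distrib_left)
  qed
  have "(\<Sum>p\<in>UNIV. \<Sum>r\<in>UNIV. (\<Sum>l\<in>UNIV. y l p * y l r)\<^sup>2) =
    (\<Sum>p\<in>UNIV. \<Sum>r\<in>UNIV. \<Sum>i\<in>UNIV. \<Sum>j\<in>UNIV. y i p * y i r * (y j p * y j r))"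
    by (simp only: power2_eq_square sum_product)
  also have "\<dots> = (\<Sum>i\<in>UNIV. \<Sum>j\<in>UNIV. \<Sum>p\<in>UNIV. \<Sum>r\<in>UNIV. y i p * y i r * (y j p * y j r))"
  proof -
    have "(\<Sum>p\<in>UNIV. \<Sum>r\<in>UNIV. \<Sum>i\<in>UNIV. \<Sum>j\<in>UNIV. f p r i j) = (\<Sum>i\<in>UNIV. \<Sum>j\<in>UNIV. \<Sum>p\<in>UNIV. \<Sum>r\<in>UNIV. f p r i j)"
      for f :: "'k \<Rightarrow> 'k \<Rightarrow> 'k \<Rightarrow> 'k \<Rightarrow> real"
    proof -
      have "(\<Sum>p\<in>UNIV. \<Sum>r\<in>UNIV. \<Sum>i\<in>UNIV. \<Sum>j\<in>UNIV. f p r i j) = (\<Sum>p\<in>UNIV. \<Sum>i\<in>UNIV. \<Sum>r\<in>UNIV. \<Sum>j\<in>UNIV. f p r i j)"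
        by (intro sum.cong refl sum.swap)
      also have "\<dots> = (\<Sum>i\<in>UNIV. \<Sum>p\<in>UNIV. \<Sum>r\<in>UNIV. \<Sum>j\<in>UNIV. f p r i j)"
        by (rule sum.swap)
      also have "\<dots> = (\<Sum>i\<in>UNIV. \<Sum>p\<in>UNIV. \<Sum>j\<in>UNIV. \<Sum>r\<in>UNIV. f p r i j)"
        by (intro sum.cong refl sum.swap)
      also have "\<dots> = (\<Sum>i\<in>UNIV. \<Sum>j\<in>UNIV. \<Sum>p\<in>UNIV. \<Sum>r\<in>UNIV. f p r i j)"
        by (intro sum.cong refl sum.swap)
      finally show ?thesis .
    qed
    then show ?thesis .
  qed
  also have "\<dots> = (\<Sum>i\<in>UNIV. \<Sum>j\<in>UNIV. (\<Sum>k\<in>UNIV. y i k * y j k)\<^sup>2)"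
    by (simp only: power2_eq_square sum_product mult_ac)
  finally have 1: "(\<Sum>p\<in>UNIV. \<Sum>r\<in>UNIV. (\<Sum>l\<in>UNIV. y l p * y l r)\<^sup>2) = \<dots>" .
  have 2: "(\<Sum>p\<in>UNIV. \<Sum>l\<in>UNIV. y l p * y l p) = (\<Sum>i\<in>UNIV. \<Sum>k\<in>UNIV. y i k * y i k)"
    by (rule sum.swap)
  show ?thesis
    unfolding expand[of y] expand[of "\<lambda>l p. y p l"] 1 2 ..
qed

lemma abs_sum_le_card:
  fixes f :: "'a::finite \<Rightarrow> real"
  assumes "\<And>i. \<bar>f i\<bar> \<le> c"
  shows "\<bar>\<Sum>i\<in>UNIV. f i\<bar> \<le> real CARD('a) * c"
  using order_trans[OF sum_abs sum_bounded_above[of UNIV "\<lambda>i. \<bar>f i\<bar>" c]] assms by auto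

text \<open>
  Near orthonormality passes from the rows to the columns only because the matrix is square: this is
  where equality of the fitted and the true number of topics enters. Each entry is bounded by the
  Frobenius norm, which is the same for both defects.
\<close>
lemma nearly_diagonal_gram:
  fixes y :: "'k::finite \<Rightarrow> 'k \<Rightarrow> real"
  assumes e: "\<And>i j. \<bar>(\<Sum>k\<in>UNIV. y i k * y j k) - (if i = j then 1 else 0)\<bar> \<le> e"
  shows "\<bar>(\<Sum>l\<in>UNIV. y l p * y l r) - (if p = r then 1 else 0)\<bar> \<le> real CARD('k) * e"
proof -
  let ?g = "\<lambda>p r. (\<Sum>l\<in>UNIV. y l p * y l r) - (if p = r then 1 else 0)"
  have e0: "0 \<le> e" using e[of undefined undefined] by linarith
  have "(?g p r)\<^sup>2 \<le> (\<Sum>r\<in>UNIV. (?g p r)\<^sup>2)"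
    by (rule member_le_sum) auto
  also have "\<dots> \<le> (\<Sum>p\<in>UNIV. \<Sum>r\<in>UNIV. (?g p r)\<^sup>2)"
    by (rule member_le_sum[of _ _ "\<lambda>p. \<Sum>r\<in>UNIV. (?g p r)\<^sup>2"]) (auto intro!: sum_nonneg)
  also have "\<dots> = (\<Sum>i\<in>UNIV. \<Sum>j\<in>UNIV. ((\<Sum>k\<in>UNIV. y i k * y j k) - (if i = j then 1 else 0))\<^sup>2)"
    by (rule gram_defect_transpose)
  also have "\<dots> \<le> (\<Sum>i\<in>(UNIV::'k set). \<Sum>j\<in>(UNIV::'k set). e\<^sup>2)"
    using e by (intro sum_mono) (metis abs_ge_zero power2_abs power_mono)
  also have "\<dots> = (real CARD('k) * e)\<^sup>2" by (simp add: power2_eq_square)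
  finally show ?thesis
    using e0 by (metis abs_le_square_iff abs_of_nonneg mult_nonneg_nonneg of_nat_0_le_iff)
qed

text \<open>
  Write \<open>Y\<close> for the matrix of the \<open>y l k\<close> and \<open>D_l\<close> for the diagonal matrix with entries \<open>b l k\<close>. The
  hypotheses say that \<open>Y Y^T\<close> is close to the identity and \<open>Y D_l Y^T\<close> to the projection onto the \<open>l\<close>-th
  coordinate. Multiplying the latter by \<open>Y^T\<close> and \<open>Y\<close> shows that \<open>D_l\<close> is close to the rank one matrix of
  the products \<open>y l p * y l r\<close>. So each row of \<open>Y\<close> has a single entry that is not small, which must be
  close to 1 in absolute value, and near orthogonality of the rows makes its position injective in \<open>l\<close>.
\<close>
lemma nearly_diagonal_decomposition:
  fixes y b :: "'k::finite \<Rightarrow> 'k \<Rightarrow> real" and R e :: real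
  defines "n \<equiv> real CARD('k)"
  defines "C1 \<equiv> n\<^sup>2 * R\<^sup>2 + (n + 2) * n * R"
  defines "C \<equiv> 1 + (2 * n\<^sup>2 + 2 * n + 1) * C1"
  assumes R: "1 \<le> R" and bounds: "\<And>l k. \<bar>y l k\<bar> \<le> R" "\<And>l k. \<bar>b l k\<bar> \<le> R"
    and e2: "\<And>i j. \<bar>(\<Sum>k\<in>UNIV. y i k * y j k) - (if i = j then 1 else 0)\<bar> \<le> e"
    and e3: "\<And>i j l. \<bar>(\<Sum>k\<in>UNIV. y i k * y j k * b l k) - (if i = l \<and> j = l then 1 else 0)\<bar> \<le> e"
    and small: "4 * n * C * e \<le> 1"
  shows "\<exists>\<sigma>. \<sigma> permutes UNIV \<and> (\<forall>l k. \<bar>b l k - (if k = \<sigma> l then 1 else 0)\<bar> \<le> C * e)"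
proof -
  have n: "1 \<le> n" unfolding n_def by (simp add: Suc_leI)
  have e: "0 \<le> e" using e2[of undefined undefined] by linarith
  have R2: "1 \<le> R\<^sup>2" using R by simp
  have n2: "n \<le> n\<^sup>2" using n by (simp add: self_le_power)
  have C1: "n \<le> C1"
  proof -
    have "n * 1 \<le> n\<^sup>2 * R\<^sup>2" using n2 R2 n by (intro mult_mono) auto
    moreover have "0 \<le> (n + 2) * n * R" using n R by simp
    ultimately show ?thesis unfolding C1_def by simp
  qed
  have C_ge: "1 + 2 * n\<^sup>2 * C1 + 2 * n * C1 + C1 \<le> C" unfolding C_def by (simp add: algebra_simps)
  have nn: "0 \<le> n\<^sup>2 * C1" "0 \<le> n * C1" "0 \<le> C1" using n C1 by auto
  have C0: "0 < C" using C_ge nn by linarith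
  have Ce: "C * e \<le> 1 / (4 * n)"
    using small n by (simp add: field_simps)
  have Ce4: "C * e \<le> 1 / 4"
  proof -
    have "1 / (4 * n) \<le> 1 / 4" using n by (simp add: field_simps)
    then show ?thesis using Ce by linarith
  qed
  have scale: "c * e \<le> C * e" if "c \<le> C" for c using that e by (rule mult_right_mono)
  have C1e: "C1 * e \<le> 1 / 4" using scale[of C1] C_ge nn Ce4 by linarith
  have ne: "n * e \<le> 1 / 4" using mult_right_mono[OF C1 e] C1e by linarith
  have e4: "e \<le> 1 / 4" using mult_right_mono[OF n e] ne by linarith
  define z where "z p r = (\<Sum>l\<in>UNIV. y l p * y l r)" for p r
  define w where "w p r = z p r - (if p = r then 1 else 0)" for p r
  have w: "\<bar>w p r\<bar> \<le> n * e" for p r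
    unfolding w_def z_def n_def using e2 by (rule nearly_diagonal_gram)
  (* \<open>D_l\<close> agrees with the products of the entries of the \<open>l\<close>-th row up to \<open>C1 * e\<close>; both are compared with
     the entry \<open>T\<close> of \<open>Y^T Y D_l Y^T Y\<close>. *)
  have key: "\<bar>(if p = r then b l p else 0) - y l p * y l r\<bar> \<le> C1 * e" for l p r
  proof -
    define T where "T = (\<Sum>i\<in>UNIV. \<Sum>j\<in>UNIV. y i p * y j r * (\<Sum>k\<in>UNIV. y i k * y j k * b l k))"
    have "T = (\<Sum>k\<in>UNIV. z p k * z k r * b l k)"
    proof -
      have "T = (\<Sum>i\<in>UNIV. \<Sum>j\<in>UNIV. \<Sum>k\<in>UNIV. y i p * y i k * (y j k * y j r) * b l k)"
        unfolding T_def sum_distrib_left by (intro sum.cong refl) (simp add: mult_ac)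
      also have "\<dots> = (\<Sum>i\<in>UNIV. \<Sum>k\<in>UNIV. \<Sum>j\<in>UNIV. y i p * y i k * (y j k * y j r) * b l k)"
        by (intro sum.cong refl sum.swap)
      also have "\<dots> = (\<Sum>k\<in>UNIV. \<Sum>i\<in>UNIV. \<Sum>j\<in>UNIV. y i p * y i k * (y j k * y j r) * b l k)"
        by (rule sum.swap)
      also have "\<dots> = (\<Sum>k\<in>UNIV. z p k * z k r * b l k)"
        unfolding z_def by (intro sum.cong refl, subst sum_product) (simp only: sum_distrib_right)
      finally show ?thesis .
    qed
    also have "\<dots> = (\<Sum>k\<in>UNIV. (if p = k then (if k = r then b l k else 0) else 0) + (if p = k then w k r * b l k else 0) +
       (if k = r then w p k * b l k else 0) + w p k * w k r * b l k)"
      unfolding w_def by (intro sum.cong refl) (auto simp: algebra_simps)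
    also have "\<dots> = (if p = r then b l p else 0) + w p r * b l p + w p r * b l r + (\<Sum>k\<in>UNIV. w p k * w k r * b l k)"
      unfolding sum.distrib by simp
    finally have T1: "T = \<dots>" .
    have wb: "\<bar>w p k * b l k'\<bar> \<le> n * e * R" for k k'
      unfolding abs_mult using w[of p k] bounds(2)[of l k'] n e by (intro mult_mono) auto
    have "\<bar>\<Sum>k\<in>UNIV. w p k * w k r * b l k\<bar> \<le> n * (n * e * R)"
      unfolding n_def
    proof (rule abs_sum_le_card, fold n_def)
      fix k
      have "\<bar>w k r\<bar> \<le> 1" using w[of k r] ne by linarith
      then have "\<bar>w k r\<bar> * \<bar>w p k * b l k\<bar> \<le> 1 * (n * e * R)"
        using wb[of k k] by (intro mult_mono) auto
      then show "\<bar>w p k * w k r * b l k\<bar> \<le> n * e * R" by (simp add: abs_mult mult_ac)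
    qed
    with wb[of r p] wb[of r r] T1 have A: "\<bar>T - (if p = r then b l p else 0)\<bar> \<le> (n + 2) * n * R * e"
      by (simp add: algebra_simps abs_le_iff)
    have "T - y l p * y l r = (\<Sum>i\<in>UNIV. \<Sum>j\<in>UNIV. y i p * y j r *
       ((\<Sum>k\<in>UNIV. y i k * y j k * b l k) - (if i = l \<and> j = l then 1 else 0)))"
    proof -
      have "(\<Sum>i\<in>UNIV. \<Sum>j\<in>UNIV. y i p * y j r * (if i = l \<and> j = l then 1 else 0)) =
        (\<Sum>i\<in>UNIV. if i = l then y i p * y l r else 0)"
      proof (intro sum.cong refl)
        fix i
        show "(\<Sum>j\<in>UNIV. y i p * y j r * (if i = l \<and> j = l then 1 else 0)) = (if i = l then y i p * y l r else 0)"
          by (cases "i = l") (auto simp: if_distrib[of "\<lambda>x. _ * x"] cong: if_cong)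
      qed
      also have "\<dots> = y l p * y l r" by simp
      finally show ?thesis unfolding T_def right_diff_distrib sum_subtractf by simp
    qed
    also have "\<bar>\<dots>\<bar> \<le> n * (n * (R\<^sup>2 * e))"
    proof -
      have *: "\<bar>y i p * y j r * ((\<Sum>k\<in>UNIV. y i k * y j k * b l k) - (if i = l \<and> j = l then 1 else 0))\<bar> \<le> R\<^sup>2 * e" for i j
        unfolding abs_mult power2_eq_square using R
        by (intro mult_mono bounds e3) auto
      show ?thesis unfolding n_def
        by (intro abs_sum_le_card) (rule *)
    qed
    finally have B: "\<bar>T - y l p * y l r\<bar> \<le> n\<^sup>2 * R\<^sup>2 * e" by (simp add: power2_eq_square mult_ac)
    have "C1 * e = n\<^sup>2 * R\<^sup>2 * e + (n + 2) * n * R * e" unfolding C1_def by (simp add: algebra_simps)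
    with A B show ?thesis by linarith
  qed
  have row: "\<bar>(\<Sum>k\<in>UNIV. (y l k)\<^sup>2) - 1\<bar> \<le> e" for l
    using e2[of l l] by (simp add: power2_eq_square)
  have "\<exists>s. 1 / (2 * n) \<le> (y l s)\<^sup>2" for l
  proof (rule ccontr)
    assume "\<nexists>s. 1 / (2 * n) \<le> (y l s)\<^sup>2"
    then have "(\<Sum>k\<in>UNIV. (y l k)\<^sup>2) \<le> real CARD('k) * (1 / (2 * n))"
      by (intro sum_bounded_above[where K="1 / (2 * n)"]) (auto simp: not_le intro: less_imp_le)
    also have "\<dots> = 1 / 2" using n by (simp add: n_def[symmetric])
    finally show False using row[of l] e4 by linarith
  qed
  then obtain \<sigma> where \<sigma>: "\<And>l. 1 / (2 * n) \<le> (y l (\<sigma> l))\<^sup>2" by metis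
  (* For \<open>k \<noteq> \<sigma> l\<close> the product \<open>y l k * y l (\<sigma> l)\<close> is small while its second factor is not. *)
  have off: "(y l k)\<^sup>2 \<le> 2 * n * C1 * e" if "k \<noteq> \<sigma> l" for l k
  proof -
    have "\<bar>y l k * y l (\<sigma> l)\<bar> \<le> C1 * e" using key[of k "\<sigma> l" l] that by simp
    then have "(y l k * y l (\<sigma> l))\<^sup>2 \<le> (C1 * e)\<^sup>2" by (metis abs_ge_zero power2_abs power_mono)
    also have "\<dots> \<le> 1 * (C1 * e)" unfolding power2_eq_square using C1e nn e by (intro mult_right_mono) auto
    finally have "(y l k)\<^sup>2 * (y l (\<sigma> l))\<^sup>2 \<le> C1 * e" by (simp add: power_mult_distrib)
    moreover have "(y l k)\<^sup>2 * (1 / (2 * n)) \<le> (y l k)\<^sup>2 * (y l (\<sigma> l))\<^sup>2"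
      by (intro mult_left_mono \<sigma>) auto
    ultimately have "(y l k)\<^sup>2 * (1 / (2 * n)) \<le> C1 * e" by linarith
    then show ?thesis using n by (simp add: field_simps)
  qed
  have inj: "inj \<sigma>"
  proof (rule injI, rule ccontr)
    fix l l' assume eq: "\<sigma> l = \<sigma> l'" and neq: "l \<noteq> l'"
    let ?s = "\<sigma> l"
    have "(\<Sum>k\<in>UNIV. y l k * y l' k) = y l ?s * y l' ?s + (\<Sum>k\<in>UNIV-{?s}. y l k * y l' k)"
      by (rule sum.remove) auto
    moreover have "\<bar>\<Sum>k\<in>UNIV. y l k * y l' k\<bar> \<le> e" using e2[of l l'] neq by simp
    moreover have "\<bar>\<Sum>k\<in>UNIV-{?s}. y l k * y l' k\<bar> \<le> real (card (UNIV-{?s})) * (2 * n * C1 * e)"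
    proof (rule order_trans[OF sum_abs], rule sum_bounded_above)
      fix k assume "k \<in> UNIV - {?s}"
      then have "(y l k)\<^sup>2 \<le> 2 * n * C1 * e" "(y l' k)\<^sup>2 \<le> 2 * n * C1 * e" using off eq by auto
      moreover have "2 * \<bar>y l k * y l' k\<bar> \<le> (y l k)\<^sup>2 + (y l' k)\<^sup>2"
        using sum_squares_bound[of "\<bar>y l k\<bar>" "\<bar>y l' k\<bar>"] by (simp add: abs_mult)
      ultimately show "\<bar>y l k * y l' k\<bar> \<le> 2 * n * C1 * e" by linarith
    qed
    moreover have "real (card (UNIV-{?s})) * (2 * n * C1 * e) \<le> n * (2 * n * C1 * e)"
      using n nn e by (intro mult_right_mono) (auto simp: n_def intro: card_mono)
    moreover have "1 / (2 * n) \<le> \<bar>y l ?s * y l' ?s\<bar>"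
    proof -
      have "(1 / (2 * n)) * (1 / (2 * n)) \<le> (y l ?s)\<^sup>2 * (y l' ?s)\<^sup>2"
        using \<sigma>[of l] \<sigma>[of l'] eq n by (intro mult_mono) auto
      then have "(1 / (2 * n))\<^sup>2 \<le> \<bar>y l ?s * y l' ?s\<bar>\<^sup>2" by (simp add: power2_eq_square mult_ac)
      then show ?thesis by (rule power2_le_imp_le) simp
    qed
    moreover have "e + n * (2 * n * C1 * e) \<le> C * e"
    proof -
      have "e + n * (2 * n * C1 * e) = (1 + 2 * n\<^sup>2 * C1) * e" by (simp add: algebra_simps power2_eq_square)
      then show ?thesis using scale[of "1 + 2 * n\<^sup>2 * C1"] C_ge nn by linarith
    qed
    moreover have "1 / (4 * n) < 1 / (2 * n)" using n by (simp add: field_simps)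
    ultimately show False using Ce by linarith
  qed
  then have "bij \<sigma>" by (simp add: bij_def finite_UNIV_inj_surj)
  then have "\<sigma> permutes UNIV" by (rule bij_imp_permutes) simp
  moreover have "\<bar>b l k - (if k = \<sigma> l then 1 else 0)\<bar> \<le> C * e" for l k
  proof (cases "k = \<sigma> l")
    case False
    have "\<bar>b l k - (y l k)\<^sup>2\<bar> \<le> C1 * e" using key[of k k l] by (simp add: power2_eq_square)
    then have "\<bar>b l k\<bar> \<le> (C1 + 2 * n * C1) * e" using off[OF False] zero_le_power2[of "y l k"]
      by (simp only: distrib_right)
    also have "\<dots> \<le> C * e" using C_ge nn by (intro scale) linarith
    finally show ?thesis using False by simp
  next
    case True
    let ?s = "\<sigma> l"
    have "\<bar>b l ?s - (y l ?s)\<^sup>2\<bar> \<le> C1 * e" using key[of ?s ?s l] by (simp add: power2_eq_square)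
    moreover have "(\<Sum>k\<in>UNIV. (y l k)\<^sup>2) = (y l ?s)\<^sup>2 + (\<Sum>k\<in>UNIV-{?s}. (y l k)\<^sup>2)"
      by (rule sum.remove) auto
    moreover have "0 \<le> (\<Sum>k\<in>UNIV-{?s}. (y l k)\<^sup>2)" by (intro sum_nonneg) auto
    moreover have "(\<Sum>k\<in>UNIV-{?s}. (y l k)\<^sup>2) \<le> real (card (UNIV-{?s})) * (2 * n * C1 * e)"
      using off by (intro sum_bounded_above) auto
    moreover have "real (card (UNIV-{?s})) * (2 * n * C1 * e) \<le> n * (2 * n * C1 * e)"
      using n nn e by (intro mult_right_mono) (auto simp: n_def intro: card_mono)
    ultimately have "\<bar>b l ?s - 1\<bar> \<le> C1 * e + e + n * (2 * n * C1 * e)"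
      using row[of l] by linarith
    also have "\<dots> = (1 + 2 * n\<^sup>2 * C1 + C1) * e" by (simp add: algebra_simps power2_eq_square)
    also have "\<dots> \<le> C * e" using C_ge nn by (intro scale) linarith
    finally show ?thesis using True by simp
  qed
  ultimately show ?thesis by blast
qed

text \<open>
  A linear functional is given by its values on the coordinate vectors; independence of the topics
  allows prescribing the values on them.
\<close>
lemma dual_family:
  fixes \<theta>0 :: "'k::finite \<Rightarrow> real^'v"
  assumes "independent (range \<theta>0)" "inj \<theta>0"
  obtains d :: "'k \<Rightarrow> 'v \<Rightarrow> real" where "\<And>l k. (\<Sum>v\<in>UNIV. d l v * \<theta>0 k $ v) = (if l = k then 1 else 0)"
proof -
  have "\<exists>f. \<forall>k. (\<Sum>v\<in>UNIV. f v * \<theta>0 k $ v) = (if l = k then 1 else 0)" for l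
  proof -
    obtain g :: "real^'v \<Rightarrow> real" where g: "linear g"
      "\<forall>x\<in>range \<theta>0. g x = (if x = \<theta>0 l then 1 else 0)"
      using linear_independent_extend[OF assms(1), of "\<lambda>x. if x = \<theta>0 l then 1 else 0"] by blast
    have "(\<Sum>v\<in>UNIV. g (axis v 1) * x $ v) = g x" for x
    proof -
      have "g x = g (\<Sum>v\<in>UNIV. x $ v *s axis v 1)" by (simp add: basis_expansion)
      also have "\<dots> = (\<Sum>v\<in>UNIV. x $ v * g (axis v 1))"
        using g(1) by (simp add: linear_sum linear_cmul scalar_mult_eq_scaleR)
      finally show ?thesis by (simp add: mult_ac)
    qed
    then show ?thesis using g(2) assms(2) by (intro exI[of _ "\<lambda>v. g (axis v 1)"]) (auto simp: inj_eq)
  qed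
  then show thesis using that by metis
qed

text \<open>
  Contracting the moments with the dual family of the true topics turns the true atoms into the
  coordinate vectors. After dividing by the square roots of the true weights, the second and third
  moments satisfy the hypotheses of \<open>nearly_diagonal_decomposition\<close>, which gives the permutation. The
  weights and topics themselves are then read off from the second moments contracted once.
\<close>
lemma atom_moments_determine_atoms:
  fixes a0 :: "real^'k" and \<theta>0 :: "'k \<Rightarrow> real^'v"
  assumes atoms: "exact_atoms a0 \<theta>0" and indep: "independent (range \<theta>0)"
  obtains C \<delta> where "0 < C" "0 < \<delta>"
    "\<And>a \<Theta> \<eta>. a \<in> prob_simplex \<Longrightarrow> (\<And>k. \<Theta> k \<in> prob_simplex) \<Longrightarrow> \<eta> \<le> \<delta> \<Longrightarrow>
       (\<And>u v. \<bar>atom_moment2 a \<Theta> u v - atom_moment2 a0 \<theta>0 u v\<bar> \<le> \<eta>) \<Longrightarrow>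
       (\<And>u v w. \<bar>atom_moment3 a \<Theta> u v w - atom_moment3 a0 \<theta>0 u v w\<bar> \<le> \<eta>) \<Longrightarrow>
       \<exists>\<sigma>. \<sigma> permutes UNIV \<and> (\<forall>l. \<bar>a $ \<sigma> l - a0 $ l\<bar> \<le> C * \<eta> \<and> (\<forall>v. \<bar>\<Theta> (\<sigma> l) $ v - \<theta>0 l $ v\<bar> \<le> C * \<eta>))"
proof -
  have a0: "a0 \<in> prob_simplex" "\<And>k. 0 < a0 $ k" and \<theta>0: "\<And>k. \<theta>0 k \<in> prob_simplex" and "inj \<theta>0"
    using atoms by (auto simp: exact_atoms_def)
  obtain d :: "'k \<Rightarrow> 'v \<Rightarrow> real" where d: "\<And>l k. (\<Sum>v\<in>UNIV. d l v * \<theta>0 k $ v) = (if l = k then 1 else 0)"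
    using dual_family[OF indep \<open>inj \<theta>0\<close>] by blast
  define D where "D = 1 + (\<Sum>l\<in>UNIV. \<Sum>v\<in>UNIV. \<bar>d l v\<bar>)"
  have D_row: "(\<Sum>v\<in>UNIV. \<bar>d l v\<bar>) \<le> D" for l
  proof -
    have "(\<Sum>v\<in>UNIV. \<bar>d l v\<bar>) \<le> (\<Sum>l\<in>UNIV. \<Sum>v\<in>UNIV. \<bar>d l v\<bar>)"
      by (rule member_le_sum[of _ _ "\<lambda>l. \<Sum>v\<in>UNIV. \<bar>d l v\<bar>"]) (auto intro!: sum_nonneg)
    then show ?thesis by (simp add: D_def)
  qed
  have D: "1 \<le> D" by (simp add: D_def sum_nonneg)
  define m where "m = Min (range (($) a0))"
  have m: "0 < m" "\<And>k. m \<le> a0 $ k"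
    unfolding m_def using a0(2) by (auto simp: Min_gr_iff)
  have m1: "m \<le> 1" using m(2)[of undefined] prob_simplexD(3)[OF a0(1), of undefined] by linarith
  define n where "n = real CARD('k)"
  define R where "R = D / m"
  define Cc where "Cc = 1 + (2 * n\<^sup>2 + 2 * n + 1) * (n\<^sup>2 * R\<^sup>2 + (n + 2) * n * R)"
  define E where "E = D ^ 3 / m"
  define C2 where "C2 = D + n * (Cc * E)"
  define V where "V = real CARD('v)"
  have n: "1 \<le> n" unfolding n_def by (simp add: Suc_leI)
  have V: "1 \<le> V" unfolding V_def by (simp add: Suc_leI)
  have R: "1 \<le> R" unfolding R_def using D m m1 by (simp add: field_simps)
  have DR: "D \<le> R" unfolding R_def using D m m1 by (simp add: field_simps mult_le_cancel_left2)
  have Cc: "0 < Cc" unfolding Cc_def using n R by (intro add_pos_nonneg mult_nonneg_nonneg add_nonneg_nonneg) auto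
  have E: "0 < E" unfolding E_def using D m by simp
  have C2: "0 < C2" unfolding C2_def using D n Cc E by (intro add_pos_nonneg mult_nonneg_nonneg) auto
  show thesis
  proof (rule that[of "(1 + V) * C2 / m" "1 / (4 * n * Cc * E)"])
    show "0 < (1 + V) * C2 / m" using V C2 m by simp
    show "0 < 1 / (4 * n * Cc * E)" using n Cc E by simp
    fix a :: "real^'k" and \<Theta> :: "'k \<Rightarrow> real^'v" and \<eta> :: real
    assume a: "a \<in> prob_simplex" and \<Theta>: "\<And>k. \<Theta> k \<in> prob_simplex" and \<eta>: "\<eta> \<le> 1 / (4 * n * Cc * E)"
      and M2: "\<And>u v. \<bar>atom_moment2 a \<Theta> u v - atom_moment2 a0 \<theta>0 u v\<bar> \<le> \<eta>"
      and M3: "\<And>u v w. \<bar>atom_moment3 a \<Theta> u v w - atom_moment3 a0 \<theta>0 u v w\<bar> \<le> \<eta>"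
    have \<eta>0: "0 \<le> \<eta>" using M2[of undefined undefined] by linarith
    define b where "b l k = (\<Sum>v\<in>UNIV. d l v * \<Theta> k $ v)" for l k
    define y where "y l k = sqrt (a $ k) * b l k / sqrt (a0 $ l)" for l k
    have a_bd: "0 \<le> a $ k" "a $ k \<le> 1" for k using prob_simplexD[OF a] by auto
    have \<Theta>_bd: "0 \<le> \<Theta> k $ v" "\<Theta> k $ v \<le> 1" for k v using prob_simplexD[OF \<Theta>] by auto
    have b_bd: "\<bar>b l k\<bar> \<le> D" for l k
    proof -
      have "\<bar>b l k\<bar> \<le> (\<Sum>v\<in>UNIV. \<bar>d l v * \<Theta> k $ v\<bar>)" unfolding b_def by (rule sum_abs)
      also have "\<dots> \<le> (\<Sum>v\<in>UNIV. \<bar>d l v\<bar>)"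
        using \<Theta>_bd[of k] by (intro sum_mono) (simp add: abs_mult mult_left_le)
      finally show ?thesis using D_row[of l] by simp
    qed
    have contract: "\<bar>\<Sum>v\<in>UNIV. d l v * f v\<bar> \<le> D * c" if f: "\<And>v. \<bar>f v\<bar> \<le> c" for l c f
    proof -
      have c: "0 \<le> c" using f[of undefined] by linarith
      have "\<bar>\<Sum>v\<in>UNIV. d l v * f v\<bar> \<le> (\<Sum>v\<in>UNIV. \<bar>d l v * f v\<bar>)" by (rule sum_abs)
      also have "\<dots> \<le> (\<Sum>v\<in>UNIV. \<bar>d l v\<bar> * c)"
        using f by (intro sum_mono) (simp add: abs_mult mult_left_mono)
      also have "\<dots> = (\<Sum>v\<in>UNIV. \<bar>d l v\<bar>) * c" by (simp add: sum_distrib_right)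
      also have "\<dots> \<le> D * c" using D_row c by (rule mult_right_mono)
      finally show ?thesis .
    qed
    have pair2: "(\<Sum>u\<in>UNIV. d i u * atom_moment2 a' \<Theta>' u v) = (\<Sum>k\<in>UNIV. a' $ k * (\<Sum>u\<in>UNIV. d i u * \<Theta>' k $ u) * \<Theta>' k $ v)"
      for i v and a' :: "real^'k" and \<Theta>' :: "'k \<Rightarrow> real^'v"
      unfolding atom_moment2_def sum_distrib_left sum_distrib_right
      by (subst sum.swap) (simp add: mult_ac)
    have pair3: "(\<Sum>u\<in>UNIV. d i u * atom_moment3 a' \<Theta>' u v w) = (\<Sum>k\<in>UNIV. a' $ k * (\<Sum>u\<in>UNIV. d i u * \<Theta>' k $ u) * \<Theta>' k $ v * \<Theta>' k $ w)"
      for i v w and a' :: "real^'k" and \<Theta>' :: "'k \<Rightarrow> real^'v"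
      unfolding atom_moment3_def sum_distrib_left sum_distrib_right
      by (subst sum.swap) (simp add: mult_ac)
    have pull: "(\<Sum>v\<in>UNIV. d j v * (\<Sum>k\<in>UNIV. g k * \<Theta>' k $ v)) = (\<Sum>k\<in>UNIV. g k * (\<Sum>v\<in>UNIV. d j v * \<Theta>' k $ v))"
      for j and g :: "'k \<Rightarrow> real" and \<Theta>' :: "'k \<Rightarrow> real^'v"
      unfolding sum_distrib_left by (subst sum.swap) (simp add: mult_ac)
    have one: "\<bar>(\<Sum>k\<in>UNIV. a $ k * b l k * \<Theta> k $ v) - a0 $ l * \<theta>0 l $ v\<bar> \<le> D * \<eta>" for l v
    proof -
      have "(\<Sum>u\<in>UNIV. d l u * (atom_moment2 a \<Theta> u v - atom_moment2 a0 \<theta>0 u v)) =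
        (\<Sum>k\<in>UNIV. a $ k * b l k * \<Theta> k $ v) - (\<Sum>k\<in>UNIV. a0 $ k * (if l = k then 1 else 0) * \<theta>0 k $ v)"
        unfolding right_diff_distrib sum_subtractf pair2 d b_def ..
      also have "(\<Sum>k\<in>UNIV. a0 $ k * (if l = k then 1 else 0) * \<theta>0 k $ v) = a0 $ l * \<theta>0 l $ v"
        by (simp add: if_distrib[of "\<lambda>x. _ * x"] if_distrib[of "\<lambda>x. x * _"] cong: if_cong)
      finally show ?thesis using contract[of "\<lambda>u. atom_moment2 a \<Theta> u v - atom_moment2 a0 \<theta>0 u v" \<eta> l, OF M2] by simp
    qed
    have two: "\<bar>(\<Sum>k\<in>UNIV. a $ k * b i k * b j k) - (if i = j then a0 $ i else 0)\<bar> \<le> D * (D * \<eta>)" for i j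
    proof -
      have "(\<Sum>v\<in>UNIV. d j v * ((\<Sum>k\<in>UNIV. a $ k * b i k * \<Theta> k $ v) - a0 $ i * \<theta>0 i $ v)) =
        (\<Sum>k\<in>UNIV. a $ k * b i k * b j k) - a0 $ i * (\<Sum>v\<in>UNIV. d j v * \<theta>0 i $ v)"
        unfolding right_diff_distrib sum_subtractf pull b_def[of j]
        by (simp add: sum_distrib_left mult_ac)
      also have "a0 $ i * (\<Sum>v\<in>UNIV. d j v * \<theta>0 i $ v) = (if i = j then a0 $ i else 0)"
        unfolding d by simp
      finally show ?thesis
        using contract[of "\<lambda>v. (\<Sum>k\<in>UNIV. a $ k * b i k * \<Theta> k $ v) - a0 $ i * \<theta>0 i $ v" "D * \<eta>" j, OF one] by simp
    qed
    have three0: "\<bar>(\<Sum>k\<in>UNIV. a $ k * b i k * \<Theta> k $ v * \<Theta> k $ w) - a0 $ i * \<theta>0 i $ v * \<theta>0 i $ w\<bar> \<le> D * \<eta>" for i v w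
    proof -
      have "(\<Sum>u\<in>UNIV. d i u * (atom_moment3 a \<Theta> u v w - atom_moment3 a0 \<theta>0 u v w)) =
        (\<Sum>k\<in>UNIV. a $ k * b i k * \<Theta> k $ v * \<Theta> k $ w) - (\<Sum>k\<in>UNIV. a0 $ k * (if i = k then 1 else 0) * \<theta>0 k $ v * \<theta>0 k $ w)"
        unfolding right_diff_distrib sum_subtractf pair3 d b_def ..
      also have "(\<Sum>k\<in>UNIV. a0 $ k * (if i = k then 1 else 0) * \<theta>0 k $ v * \<theta>0 k $ w) = a0 $ i * \<theta>0 i $ v * \<theta>0 i $ w"
        by (simp add: if_distrib[of "\<lambda>x. _ * x"] if_distrib[of "\<lambda>x. x * _"] cong: if_cong)
      finally show ?thesis using contract[of "\<lambda>u. atom_moment3 a \<Theta> u v w - atom_moment3 a0 \<theta>0 u v w" \<eta> i, OF M3] by simp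
    qed
    have three1: "\<bar>(\<Sum>k\<in>UNIV. a $ k * b i k * b j k * \<Theta> k $ w) - (if i = j then a0 $ i * \<theta>0 i $ w else 0)\<bar> \<le> D * (D * \<eta>)" for i j w
    proof -
      have "(\<Sum>v\<in>UNIV. d j v * ((\<Sum>k\<in>UNIV. a $ k * b i k * \<Theta> k $ w * \<Theta> k $ v) - a0 $ i * \<theta>0 i $ w * \<theta>0 i $ v)) =
        (\<Sum>k\<in>UNIV. a $ k * b i k * \<Theta> k $ w * b j k) - a0 $ i * \<theta>0 i $ w * (\<Sum>v\<in>UNIV. d j v * \<theta>0 i $ v)"
        unfolding right_diff_distrib sum_subtractf pull b_def[of j]
        by (simp add: sum_distrib_left mult_ac)
      also have "a0 $ i * \<theta>0 i $ w * (\<Sum>v\<in>UNIV. d j v * \<theta>0 i $ v) = (if i = j then a0 $ i * \<theta>0 i $ w else 0)"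
        unfolding d by simp
      finally show ?thesis
        using contract[of "\<lambda>v. (\<Sum>k\<in>UNIV. a $ k * b i k * \<Theta> k $ w * \<Theta> k $ v) - a0 $ i * \<theta>0 i $ w * \<theta>0 i $ v" "D * \<eta>" j]
          three0[of i w] by (simp add: mult_ac)
    qed
    have three: "\<bar>(\<Sum>k\<in>UNIV. a $ k * b i k * b j k * b l k) - (if i = l \<and> j = l then a0 $ l else 0)\<bar> \<le> D * (D * (D * \<eta>))" for i j l
    proof -
      have "(\<Sum>w\<in>UNIV. d l w * ((\<Sum>k\<in>UNIV. a $ k * b i k * b j k * \<Theta> k $ w) - (if i = j then a0 $ i else 0) * \<theta>0 i $ w)) =
        (\<Sum>k\<in>UNIV. a $ k * b i k * b j k * b l k) - (if i = j then a0 $ i else 0) * (\<Sum>w\<in>UNIV. d l w * \<theta>0 i $ w)"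
        unfolding right_diff_distrib sum_subtractf pull b_def[of l]
        by (simp add: sum_distrib_left mult_ac)
      also have "(if i = j then a0 $ i else 0) * (\<Sum>w\<in>UNIV. d l w * \<theta>0 i $ w) = (if i = l \<and> j = l then a0 $ l else 0)"
        unfolding d by auto
      finally show ?thesis
        using contract[of "\<lambda>w. (\<Sum>k\<in>UNIV. a $ k * b i k * b j k * \<Theta> k $ w) - (if i = j then a0 $ i else 0) * \<theta>0 i $ w" "D * (D * \<eta>)" l]
          three1[of i j] by (simp add: if_distrib[of "\<lambda>x. x * _"] cong: if_cong)
    qed
    have sq: "sqrt m * sqrt m = m" "0 < sqrt m" "sqrt m \<le> sqrt (a0 $ l)" for l
      using m by auto
    have div: "\<bar>x / (sqrt (a0 $ i) * sqrt (a0 $ j))\<bar> \<le> c / m" if "\<bar>x\<bar> \<le> c" for x c i j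
    proof -
      have "m \<le> sqrt (a0 $ i) * sqrt (a0 $ j)"
        using mult_mono[OF sq(3)[of i] sq(3)[of j]] sq(1,2) a0(2) by (simp add: less_imp_le)
      moreover from this m have "\<bar>x / (sqrt (a0 $ i) * sqrt (a0 $ j))\<bar> = \<bar>x\<bar> / (sqrt (a0 $ i) * sqrt (a0 $ j))"
        by (subst abs_divide, subst (2) abs_of_pos) auto
      ultimately show ?thesis
        using that m by (simp only:) (intro frac_le, auto)
    qed
    have D3: "D * (D * (D * \<eta>)) / m = E * \<eta>" unfolding E_def by (simp add: power3_eq_cube mult_ac)
    have D2: "D * (D * \<eta>) / m \<le> E * \<eta>"
    proof -
      have "1 * (D * (D * \<eta>)) \<le> D * (D * (D * \<eta>))" using D \<eta>0 by (intro mult_right_mono) auto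
      then show ?thesis unfolding D3[symmetric] using m by (intro divide_right_mono) auto
    qed
    have norm: "y i k * y j k * c = (a $ k * b i k * b j k * c) / (sqrt (a0 $ i) * sqrt (a0 $ j))" for i j k c
      unfolding y_def using a_bd[of k] by (simp add: mult_ac flip: real_sqrt_mult)
    have "\<exists>\<sigma>. \<sigma> permutes UNIV \<and> (\<forall>l k. \<bar>b l k - (if k = \<sigma> l then 1 else 0)\<bar> \<le> Cc * (E * \<eta>))"
      unfolding Cc_def n_def
    proof (rule nearly_diagonal_decomposition[where y=y])
      show "1 \<le> R" by (rule R)
      show "\<bar>y l k\<bar> \<le> R" for l k
      proof -
        have "\<bar>sqrt (a $ k) * b l k\<bar> \<le> 1 * D"
          unfolding abs_mult using a_bd[of k] b_bd by (intro mult_mono) auto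
        moreover have "m \<le> sqrt (a0 $ l)"
          using sq(3)[of l] sq(1,2) m m1 by (smt (verit) real_sqrt_le_1_iff mult_left_le)
        ultimately show ?thesis
          unfolding y_def R_def using m D by (simp add: abs_mult) (intro frac_le, auto)
      qed
      show "\<bar>b l k\<bar> \<le> R" for l k using b_bd[of l k] DR by linarith
      show "\<bar>(\<Sum>k\<in>UNIV. y i k * y j k) - (if i = j then 1 else 0)\<bar> \<le> E * \<eta>" for i j
      proof -
        have "(\<Sum>k\<in>UNIV. y i k * y j k) - (if i = j then 1 else 0) =
          ((\<Sum>k\<in>UNIV. a $ k * b i k * b j k) - (if i = j then a0 $ i else 0)) / (sqrt (a0 $ i) * sqrt (a0 $ j))"
          using norm[of i _ j 1] a0(2)[of i] a0(2)[of j] by (simp add: diff_divide_distrib sum_divide_distrib)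
        then show ?thesis using div[OF two[of i j], of i j] D2 by simp
      qed
      show "\<bar>(\<Sum>k\<in>UNIV. y i k * y j k * b l k) - (if i = l \<and> j = l then 1 else 0)\<bar> \<le> E * \<eta>" for i j l
      proof -
        have "(\<Sum>k\<in>UNIV. y i k * y j k * b l k) - (if i = l \<and> j = l then 1 else 0) =
          ((\<Sum>k\<in>UNIV. a $ k * b i k * b j k * b l k) - (if i = l \<and> j = l then a0 $ l else 0)) / (sqrt (a0 $ i) * sqrt (a0 $ j))"
          unfolding norm using a0(2)[of l] a0(2)[of i] a0(2)[of j] by (simp add: diff_divide_distrib sum_divide_distrib)
        then show ?thesis using div[OF three[of i j l], of i j] D3 by simp
      qed
      have "4 * n * Cc * (E * \<eta>) \<le> 1"
        using mult_left_mono[OF \<eta>, of "4 * n * Cc * E"] n Cc E by (simp add: mult_ac)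
      then show "4 * real CARD('k) * (1 + (2 * (real CARD('k))\<^sup>2 + 2 * real CARD('k) + 1) *
          ((real CARD('k))\<^sup>2 * R\<^sup>2 + (real CARD('k) + 2) * real CARD('k) * R)) * (E * \<eta>) \<le> 1"
        unfolding Cc_def n_def .
    qed
    then obtain \<sigma> where \<sigma>: "\<sigma> permutes UNIV" "\<And>l k. \<bar>b l k - (if k = \<sigma> l then 1 else 0)\<bar> \<le> Cc * (E * \<eta>)"
      by blast
    have prod: "\<bar>a $ \<sigma> l * \<Theta> (\<sigma> l) $ v - a0 $ l * \<theta>0 l $ v\<bar> \<le> C2 * \<eta>" for l v
    proof -
      have "(\<Sum>k\<in>UNIV. a $ k * b l k * \<Theta> k $ v) - a $ \<sigma> l * \<Theta> (\<sigma> l) $ v =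
        (\<Sum>k\<in>UNIV. a $ k * b l k * \<Theta> k $ v - (if k = \<sigma> l then a $ k * \<Theta> k $ v else 0))"
        by (simp add: sum_subtractf)
      also have "\<dots> = (\<Sum>k\<in>UNIV. (a $ k * \<Theta> k $ v) * (b l k - (if k = \<sigma> l then 1 else 0)))"
        by (intro sum.cong) (auto simp: algebra_simps)
      also have "\<bar>\<dots>\<bar> \<le> n * (1 * (Cc * (E * \<eta>)))"
        unfolding n_def
      proof (rule abs_sum_le_card)
        fix k
        have "\<bar>a $ k * \<Theta> k $ v\<bar> \<le> 1" using a_bd \<Theta>_bd by (simp add: abs_mult mult_le_one)
        then show "\<bar>(a $ k * \<Theta> k $ v) * (b l k - (if k = \<sigma> l then 1 else 0))\<bar> \<le> 1 * (Cc * (E * \<eta>))"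
          unfolding abs_mult[of "a $ k * \<Theta> k $ v" "b l k - (if k = \<sigma> l then 1 else 0)"]
          by (intro mult_mono \<sigma>(2)) auto
      qed
      finally show ?thesis using one[of l v] unfolding C2_def by (simp add: algebra_simps abs_le_iff)
    qed
    (* Summing over the alphabet removes the topics from the products, as they are probability vectors. *)
    have wt: "\<bar>a $ \<sigma> l - a0 $ l\<bar> \<le> V * (C2 * \<eta>)" for l
    proof -
      have "a $ \<sigma> l - a0 $ l = (\<Sum>v\<in>UNIV. a $ \<sigma> l * \<Theta> (\<sigma> l) $ v - a0 $ l * \<theta>0 l $ v)"
        unfolding sum_subtractf sum_distrib_left[symmetric] prob_simplexD(2)[OF \<Theta>] prob_simplexD(2)[OF \<theta>0] by simp
      then show ?thesis unfolding V_def using abs_sum_le_card[OF prod[of l]] by simp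
    qed
    have C2\<eta>: "0 \<le> C2 * \<eta>" using C2 \<eta>0 by simp
    have m_inv: "x \<le> x / m" if "0 \<le> x" for x
      using m m1 that mult_right_mono[OF m1 that] by (simp add: field_simps)
    show "\<exists>\<sigma>. \<sigma> permutes UNIV \<and> (\<forall>l. \<bar>a $ \<sigma> l - a0 $ l\<bar> \<le> (1 + V) * C2 / m * \<eta> \<and> (\<forall>v. \<bar>\<Theta> (\<sigma> l) $ v - \<theta>0 l $ v\<bar> \<le> (1 + V) * C2 / m * \<eta>))"
    proof (intro exI[of _ \<sigma>] conjI allI \<sigma>)
      fix l v
      have "V * (C2 * \<eta>) \<le> (1 + V) * (C2 * \<eta>)" using C2\<eta> by (simp add: algebra_simps)
      also have "\<dots> \<le> (1 + V) * (C2 * \<eta>) / m" using C2\<eta> V by (intro m_inv) simp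
      finally show "\<bar>a $ \<sigma> l - a0 $ l\<bar> \<le> (1 + V) * C2 / m * \<eta>" using wt[of l] by (simp add: mult_ac)
      have "a0 $ l * (\<Theta> (\<sigma> l) $ v - \<theta>0 l $ v) = (a $ \<sigma> l * \<Theta> (\<sigma> l) $ v - a0 $ l * \<theta>0 l $ v) - (a $ \<sigma> l - a0 $ l) * \<Theta> (\<sigma> l) $ v"
        by (simp add: algebra_simps)
      moreover have "\<bar>(a $ \<sigma> l - a0 $ l) * \<Theta> (\<sigma> l) $ v\<bar> \<le> V * (C2 * \<eta>) * 1"
        unfolding abs_mult using wt[of l] \<Theta>_bd C2\<eta> V by (intro mult_mono) auto
      ultimately have "\<bar>a0 $ l * (\<Theta> (\<sigma> l) $ v - \<theta>0 l $ v)\<bar> \<le> C2 * \<eta> + V * (C2 * \<eta>)"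
        using prod[of l v] by linarith
      then have "a0 $ l * \<bar>\<Theta> (\<sigma> l) $ v - \<theta>0 l $ v\<bar> \<le> (1 + V) * C2 * \<eta>"
        unfolding abs_mult abs_of_pos[OF a0(2)] by (simp only: distrib_right mult_1 mult.assoc)
      moreover have "m * \<bar>\<Theta> (\<sigma> l) $ v - \<theta>0 l $ v\<bar> \<le> a0 $ l * \<bar>\<Theta> (\<sigma> l) $ v - \<theta>0 l $ v\<bar>"
        using m(2)[of l] by (rule mult_right_mono) simp
      ultimately have "m * \<bar>\<Theta> (\<sigma> l) $ v - \<theta>0 l $ v\<bar> \<le> (1 + V) * C2 * \<eta>" by linarith
      then show "\<bar>\<Theta> (\<sigma> l) $ v - \<theta>0 l $ v\<bar> \<le> (1 + V) * C2 / m * \<eta>"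
        using m by (simp add: field_simps)
    qed
  qed
qed

lemma abs_mult_diff_le:
  fixes x y x' y' :: real
  assumes "\<bar>x\<bar> \<le> 1" "\<bar>y'\<bar> \<le> 1"
  shows "\<bar>x * y - x' * y'\<bar> \<le> \<bar>x - x'\<bar> + \<bar>y - y'\<bar>"
proof -
  have "x * y - x' * y' = x * (y - y') + (x - x') * y'" by (simp add: algebra_simps)
  then have "\<bar>x * y - x' * y'\<bar> \<le> \<bar>x\<bar> * \<bar>y - y'\<bar> + \<bar>x - x'\<bar> * \<bar>y'\<bar>"
    by (metis abs_mult abs_triangle_ineq)
  also have "\<dots> \<le> 1 * \<bar>y - y'\<bar> + \<bar>x - x'\<bar> * 1"
    using assms by (intro add_mono mult_mono) auto
  finally show ?thesis by simp
qed

lemma atom_moments_abs_le: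
  assumes a: "a \<in> prob_simplex" and \<Theta>: "\<And>k. \<Theta> k \<in> prob_simplex"
  shows "\<bar>atom_moment1 a \<Theta> u\<bar> \<le> 1" "\<bar>atom_moment2 a \<Theta> u v\<bar> \<le> 1"
proof -
  have *: "\<bar>\<Sum>k\<in>UNIV. a $ k * f k\<bar> \<le> 1" if "\<And>k. \<bar>f k\<bar> \<le> 1" for f
  proof -
    have "\<bar>\<Sum>k\<in>UNIV. a $ k * f k\<bar> \<le> (\<Sum>k\<in>UNIV. \<bar>a $ k * f k\<bar>)" by (rule sum_abs)
    also have "\<dots> \<le> (\<Sum>k\<in>UNIV. a $ k)"
      using that prob_simplexD(1)[OF a] by (intro sum_mono) (simp add: abs_mult mult_left_le)
    finally show ?thesis using prob_simplexD(2)[OF a] by simp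
  qed
  show "\<bar>atom_moment1 a \<Theta> u\<bar> \<le> 1"
    unfolding atom_moment1_def by (intro * abs_prob_simplex_le \<Theta>)
  show "\<bar>atom_moment2 a \<Theta> u v\<bar> \<le> 1"
    unfolding atom_moment2_def mult.assoc abs_mult
    by (intro *) (simp add: abs_mult mult_le_one abs_prob_simplex_le[OF \<Theta>])
qed

text \<open>
  The first three atom moments are Lipschitz functions of the laws of at most three words, and these
  are marginals of the law of \<open>N\<close> words.
\<close>
lemma lda_identifiable:
  fixes a0 :: "real^'k" and \<theta>0 :: "'k \<Rightarrow> real^'v"
  assumes \<alpha>bar: "0 < \<alpha>bar" and atoms: "exact_atoms a0 \<theta>0" and indep: "independent (range \<theta>0)" and N: "3 \<le> N"
  obtains C \<delta> where "0 < C" "0 < \<delta>"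
    "\<And>a \<Theta> \<eta>. a \<in> prob_simplex \<Longrightarrow> (\<And>k. \<Theta> k \<in> prob_simplex) \<Longrightarrow> \<eta> \<le> \<delta> \<Longrightarrow>
       (\<And>x. length x = N \<Longrightarrow> \<bar>lda_prob \<alpha>bar a \<Theta> x - lda_prob \<alpha>bar a0 \<theta>0 x\<bar> \<le> \<eta>) \<Longrightarrow>
       \<exists>\<sigma>. \<sigma> permutes UNIV \<and> (\<forall>l. \<bar>a $ \<sigma> l - a0 $ l\<bar> \<le> C * \<eta> \<and> (\<forall>v. \<bar>\<Theta> (\<sigma> l) $ v - \<theta>0 l $ v\<bar> \<le> C * \<eta>))"
proof -
  have a0: "a0 \<in> prob_simplex" and \<theta>0: "\<And>k. \<theta>0 k \<in> prob_simplex"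
    using atoms by (auto simp: exact_atoms_def)
  obtain C0 \<delta>0 where C0: "0 < C0" "0 < \<delta>0" and ident: "\<And>a \<Theta> \<eta>. a \<in> prob_simplex \<Longrightarrow> (\<And>k. \<Theta> k \<in> prob_simplex) \<Longrightarrow> \<eta> \<le> \<delta>0 \<Longrightarrow>
       (\<And>u v. \<bar>atom_moment2 a \<Theta> u v - atom_moment2 a0 \<theta>0 u v\<bar> \<le> \<eta>) \<Longrightarrow>
       (\<And>u v w. \<bar>atom_moment3 a \<Theta> u v w - atom_moment3 a0 \<theta>0 u v w\<bar> \<le> \<eta>) \<Longrightarrow>
       \<exists>\<sigma>. \<sigma> permutes UNIV \<and> (\<forall>l. \<bar>a $ \<sigma> l - a0 $ l\<bar> \<le> C0 * \<eta> \<and> (\<forall>v. \<bar>\<Theta> (\<sigma> l) $ v - \<theta>0 l $ v\<bar> \<le> C0 * \<eta>))"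
    using atom_moments_determine_atoms[OF atoms indep] by blast
  define B where "B = 1 + (\<Sum>j\<le>N. real (card {y::'v list. length y = j}))"
  define A where "A = \<alpha>bar"
  define c where "c = (A + 1) * (A + 2) + 3 * A\<^sup>2 + 3 * A * (3 * A + 2) + (3 * A + 1)"
  have A: "0 < A" using \<alpha>bar by (simp add: A_def)
  have c: "0 < c" "3 * A + 1 \<le> c" unfolding c_def using A by (auto intro!: add_pos_pos)
  have B: "0 < B" unfolding B_def by (intro add_pos_nonneg sum_nonneg) auto
  show thesis
  proof (rule that[of "C0 * (c * B)" "\<delta>0 / (c * B)"])
    show "0 < C0 * (c * B)" "0 < \<delta>0 / (c * B)" using C0 c B by auto
    fix a :: "real^'k" and \<Theta> :: "'k \<Rightarrow> real^'v" and \<eta> :: real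
    assume a: "a \<in> prob_simplex" and \<Theta>: "\<And>k. \<Theta> k \<in> prob_simplex" and \<eta>: "\<eta> \<le> \<delta>0 / (c * B)"
      and diff: "\<And>x. length x = N \<Longrightarrow> \<bar>lda_prob \<alpha>bar a \<Theta> x - lda_prob \<alpha>bar a0 \<theta>0 x\<bar> \<le> \<eta>"
    have \<eta>0: "0 \<le> \<eta>" using diff[of "replicate N undefined"] by simp
    have marg: "\<bar>lda_prob \<alpha>bar a \<Theta> x - lda_prob \<alpha>bar a0 \<theta>0 x\<bar> \<le> B * \<eta>" if x: "length x \<le> N" for x
    proof -
      let ?Y = "{y::'v list. length y = N - length x}"
      have "lda_prob \<alpha>bar a \<Theta> x - lda_prob \<alpha>bar a0 \<theta>0 x =
        (\<Sum>y\<in>?Y. lda_prob \<alpha>bar a \<Theta> (x @ y) - lda_prob \<alpha>bar a0 \<theta>0 (x @ y))"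
        unfolding sum_subtractf
        using lda_prob_marginal[OF \<alpha>bar a \<Theta>, where x=x and n="N - length x"]
          lda_prob_marginal[OF \<alpha>bar a0 \<theta>0, where x=x and n="N - length x"] by simp
      also have "\<bar>\<dots>\<bar> \<le> real (card ?Y) * \<eta>"
        by (rule order_trans[OF sum_abs], rule sum_bounded_above) (use x in \<open>auto intro!: diff\<close>)
      also have "\<dots> \<le> B * \<eta>"
      proof (rule mult_right_mono[OF _ \<eta>0])
        have "real (card ?Y) \<le> (\<Sum>j\<le>N. real (card {y::'v list. length y = j}))"
          by (rule member_le_sum[of "N - length x" _ "\<lambda>j. real (card {y::'v list. length y = j})"]) auto
        then show "real (card ?Y) \<le> B" by (simp add: B_def)
      qed
      finally show ?thesis .
    qed
    define h where "h = B * \<eta>"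
    have h: "0 \<le> h" using B \<eta>0 by (simp add: h_def)
    have bd: "\<bar>atom_moment1 a \<Theta> u\<bar> \<le> 1" "\<bar>atom_moment2 a \<Theta> u v\<bar> \<le> 1" for u v
      using atom_moments_abs_le[OF a \<Theta>] by auto
    have bd0: "\<bar>atom_moment1 a0 \<theta>0 u\<bar> \<le> 1" "\<bar>atom_moment2 a0 \<theta>0 u v\<bar> \<le> 1" for u v
      using atom_moments_abs_le[OF a0 \<theta>0] by auto
    have m1: "\<bar>atom_moment1 a \<Theta> u - atom_moment1 a0 \<theta>0 u\<bar> \<le> h" for u
      using marg[of "[u]"] N unfolding lda_prob_1[OF \<alpha>bar a \<Theta>] lda_prob_1[OF \<alpha>bar a0 \<theta>0] h_def by simp
    have m11: "\<bar>atom_moment1 a \<Theta> u * atom_moment1 a \<Theta> v - atom_moment1 a0 \<theta>0 u * atom_moment1 a0 \<theta>0 v\<bar> \<le> 2 * h" for u v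
      using abs_mult_diff_le[OF bd(1)[of u] bd0(1)[of v], of "atom_moment1 a \<Theta> v" "atom_moment1 a0 \<theta>0 u"] m1[of u] m1[of v] by linarith
    have m2: "\<bar>atom_moment2 a \<Theta> u v - atom_moment2 a0 \<theta>0 u v\<bar> \<le> (3 * A + 1) * h" for u v
    proof -
      let ?p = "lda_prob \<alpha>bar a \<Theta> [u, v]" and ?pz = "lda_prob \<alpha>bar a0 \<theta>0 [u, v]"
      let ?m = "atom_moment1 a \<Theta> u * atom_moment1 a \<Theta> v" and ?mz = "atom_moment1 a0 \<theta>0 u * atom_moment1 a0 \<theta>0 v"
      have "atom_moment2 a \<Theta> u v = (A + 1) * ?p - A * ?m"
        using lda_prob_2[OF \<alpha>bar a, where \<Theta>=\<Theta> and u=u and v=v, OF \<Theta>] unfolding A_def by linarith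
      moreover have "atom_moment2 a0 \<theta>0 u v = (A + 1) * ?pz - A * ?mz"
        using lda_prob_2[OF \<alpha>bar a0, where \<Theta>=\<theta>0 and u=u and v=v, OF \<theta>0] unfolding A_def by linarith
      ultimately have "atom_moment2 a \<Theta> u v - atom_moment2 a0 \<theta>0 u v = (A + 1) * (?p - ?pz) - A * (?m - ?mz)"
        by (simp only:) (simp add: algebra_simps)
      moreover have "\<bar>(A + 1) * (?p - ?pz)\<bar> \<le> (A + 1) * h"
        using marg[of "[u, v]"] N A by (simp add: abs_mult h_def)
      moreover have "\<bar>A * (?m - ?mz)\<bar> \<le> A * (2 * h)"
        unfolding abs_mult using m11[of u v] A by (intro mult_mono) auto
      ultimately have "\<bar>atom_moment2 a \<Theta> u v - atom_moment2 a0 \<theta>0 u v\<bar> \<le> (A + 1) * h + A * (2 * h)" by linarith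
      then show ?thesis by (simp add: algebra_simps)
    qed
    have m3: "\<bar>atom_moment3 a \<Theta> u v w - atom_moment3 a0 \<theta>0 u v w\<bar> \<le> c * h" for u v w
    proof -
      let ?p = "lda_prob \<alpha>bar a \<Theta> [u, v, w]" and ?pz = "lda_prob \<alpha>bar a0 \<theta>0 [u, v, w]"
      let ?m = "\<lambda>u. atom_moment1 a \<Theta> u" and ?mz = "\<lambda>u. atom_moment1 a0 \<theta>0 u"
      let ?s = "\<lambda>u v. atom_moment2 a \<Theta> u v" and ?sz = "\<lambda>u v. atom_moment2 a0 \<theta>0 u v"
      have eq: "2 * (atom_moment3 a \<Theta> u v w - atom_moment3 a0 \<theta>0 u v w) = (A + 1) * (A + 2) * (?p - ?pz) -
        A\<^sup>2 * (?m u * ?m v * ?m w - ?mz u * ?mz v * ?mz w) -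
        A * ((?s u v * ?m w - ?sz u v * ?mz w) + (?s u w * ?m v - ?sz u w * ?mz v) + (?s v w * ?m u - ?sz v w * ?mz u))"
      proof -
        have "2 * atom_moment3 a \<Theta> u v w = (A + 1) * (A + 2) * ?p - A\<^sup>2 * (?m u * ?m v * ?m w) -
            A * (?s u v * ?m w + ?s u w * ?m v + ?s v w * ?m u)"
          using lda_prob_3[OF \<alpha>bar a, where \<Theta>=\<Theta> and u=u and v=v and w=w, OF \<Theta>] unfolding A_def by linarith
        moreover have "2 * atom_moment3 a0 \<theta>0 u v w = (A + 1) * (A + 2) * ?pz - A\<^sup>2 * (?mz u * ?mz v * ?mz w) -
            A * (?sz u v * ?mz w + ?sz u w * ?mz v + ?sz v w * ?mz u)"
          using lda_prob_3[OF \<alpha>bar a0, where \<Theta>=\<theta>0 and u=u and v=v and w=w, OF \<theta>0] unfolding A_def by linarith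
        ultimately show ?thesis
          unfolding right_diff_distrib[of 2] by (simp only:) (simp add: algebra_simps)
      qed
      have 1: "\<bar>(A + 1) * (A + 2) * (?p - ?pz)\<bar> \<le> (A + 1) * (A + 2) * h"
        unfolding abs_mult using marg[of "[u, v, w]"] N A unfolding h_def by (intro mult_mono) auto
      have "\<bar>?m u * ?m v * ?m w - ?mz u * ?mz v * ?mz w\<bar> \<le> 3 * h"
        using abs_mult_diff_le[of "?m u * ?m v" "?mz w" "?m w" "?mz u * ?mz v"] bd(1)[of u] bd(1)[of v] bd0(1)[of w] m11[of u v] m1[of w]
        by (simp add: abs_mult mult_le_one)
      then have 2: "\<bar>A\<^sup>2 * (?m u * ?m v * ?m w - ?mz u * ?mz v * ?mz w)\<bar> \<le> A\<^sup>2 * (3 * h)"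
        unfolding abs_mult by (intro mult_mono) auto
      have sm: "\<bar>?s u v * ?m w - ?sz u v * ?mz w\<bar> \<le> (3 * A + 2) * h" for u v w
        using abs_mult_diff_le[OF bd(2)[of u v] bd0(1)[of w], of "?m w" "?sz u v"] m2[of u v] m1[of w] by (simp add: algebra_simps)
      have "\<bar>(?s u v * ?m w - ?sz u v * ?mz w) + (?s u w * ?m v - ?sz u w * ?mz v) + (?s v w * ?m u - ?sz v w * ?mz u)\<bar> \<le> 3 * ((3 * A + 2) * h)"
        using sm[of u v w] sm[of u w v] sm[of v w u] by linarith
      then have 3: "\<bar>A * ((?s u v * ?m w - ?sz u v * ?mz w) + (?s u w * ?m v - ?sz u w * ?mz v) + (?s v w * ?m u - ?sz v w * ?mz u))\<bar> \<le> A * (3 * ((3 * A + 2) * h))"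
        unfolding abs_mult using A by (intro mult_mono) auto
      have "0 \<le> (3 * A + 1) * h" using A h by simp
      moreover have "c * h = (A + 1) * (A + 2) * h + A\<^sup>2 * (3 * h) + A * (3 * ((3 * A + 2) * h)) + (3 * A + 1) * h"
        unfolding c_def by (simp add: algebra_simps)
      ultimately have "\<bar>2 * (atom_moment3 a \<Theta> u v w - atom_moment3 a0 \<theta>0 u v w)\<bar> \<le> c * h"
        using 1 2 3 unfolding eq by linarith
      then show ?thesis by simp
    qed
    have "(3 * A + 1) * h \<le> c * h" using c h by (intro mult_right_mono)
    then have m2': "\<bar>atom_moment2 a \<Theta> u v - atom_moment2 a0 \<theta>0 u v\<bar> \<le> c * h" for u v
      using m2[of u v] by linarith
    have "c * h \<le> \<delta>0" using \<eta> c B by (simp add: h_def field_simps)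
    from ident[OF a \<Theta> this m2' m3]
    show "\<exists>\<sigma>. \<sigma> permutes UNIV \<and> (\<forall>l. \<bar>a $ \<sigma> l - a0 $ l\<bar> \<le> C0 * (c * B) * \<eta> \<and> (\<forall>v. \<bar>\<Theta> (\<sigma> l) $ v - \<theta>0 l $ v\<bar> \<le> C0 * (c * B) * \<eta>))"
      by (simp add: h_def mult.assoc)
  qed
qed

section \<open>Likelihood ratios on a finite sample space\<close>

text \<open>
  Pearson's chi-square statistic. The sum is over the outcomes of positive probability, so for a
  nonempty sample no denominator is 0.
\<close>
definition pearson :: "'a pmf \<Rightarrow> 'a list \<Rightarrow> real" where
  "pearson p xs = (\<Sum>x\<in>set_pmf p. (real (count_list xs x) - real (length xs) * pmf p x)\<^sup>2 / (real (length xs) * pmf p x))"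

lemma pearson_nonneg: "0 \<le> pearson p xs"
  unfolding pearson_def by (intro sum_nonneg) auto

lemma finite_set_replicate_pmf: "finite (set_pmf p) \<Longrightarrow> finite (set_pmf (replicate_pmf n p))"
  by (rule finite_subset[OF _ finite_lists_length_eq[of "set_pmf p" n]]) (auto simp: set_replicate_pmf lists_eq_set)

lemma expectation_count_list:
  assumes fin: "finite (set_pmf p)" and x: "x \<in> set_pmf p"
  shows "measure_pmf.expectation (replicate_pmf m p) (\<lambda>xs. real (count_list xs x) - real m * pmf p x) = 0"
    and "measure_pmf.expectation (replicate_pmf m p) (\<lambda>xs. (real (count_list xs x) - real m * pmf p x)\<^sup>2) =
           real m * (pmf p x * (1 - pmf p x))"
proof (induction m)
  case 0
  show "measure_pmf.expectation (replicate_pmf 0 p) (\<lambda>xs. real (count_list xs x) - real 0 * pmf p x) = 0"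
    and "measure_pmf.expectation (replicate_pmf 0 p) (\<lambda>xs. (real (count_list xs x) - real 0 * pmf p x)\<^sup>2) =
       real 0 * (pmf p x * (1 - pmf p x))" by simp_all
next
  case (Suc m)
  let ?q = "pmf p x" and ?S = "set_pmf p"
  let ?R = "replicate_pmf m p"
  let ?u = "\<lambda>xs. real (count_list xs x) - real m * ?q"
  let ?i = "\<lambda>a. (if a = x then 1 else 0) - ?q"
  have int: "integrable ?R f" for f :: "'a list \<Rightarrow> real"
    by (intro integrable_measure_pmf_finite finite_set_replicate_pmf fin)
  have step: "measure_pmf.expectation (replicate_pmf (Suc m) p) h =
    (\<Sum>a\<in>?S. pmf p a * measure_pmf.expectation ?R (\<lambda>xs. h (a # xs)))" for h :: "'a list \<Rightarrow> real"
  proof -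
    have "replicate_pmf (Suc m) p = bind_pmf p (\<lambda>a. map_pmf ((#) a) ?R)"
      by (simp add: map_pmf_def)
    then show ?thesis
      by (simp only:, subst pmf_expectation_bind[where A="?S"])
        (auto simp: fin finite_set_replicate_pmf)
  qed
  have u: "real (count_list (a # xs) x) - real (Suc m) * ?q = ?u xs + ?i a" for a xs
    by (simp add: algebra_simps)
  have sum_p: "(\<Sum>a\<in>?S. pmf p a) = 1" using fin by (rule sum_pmf_eq_1) simp
  have sum_px: "(\<Sum>a\<in>?S. pmf p a * (if a = x then 1 else 0)) = ?q"
    using x fin by (simp add: if_distrib[of "\<lambda>x. _ * x"] cong: if_cong)
  have sum_i: "(\<Sum>a\<in>?S. pmf p a * ?i a) = 0"
    unfolding right_diff_distrib sum_subtractf sum_px by (simp flip: sum_distrib_right add: sum_p)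
  have "measure_pmf.expectation (replicate_pmf (Suc m) p) (\<lambda>xs. real (count_list xs x) - real (Suc m) * ?q) =
    (\<Sum>a\<in>?S. pmf p a * (measure_pmf.expectation ?R ?u + ?i a))"
    unfolding step u using int by (subst Bochner_Integration.integral_add) auto
  then show "measure_pmf.expectation (replicate_pmf (Suc m) p) (\<lambda>xs. real (count_list xs x) - real (Suc m) * ?q) = 0"
    unfolding Suc(1) using sum_i by simp
  have "measure_pmf.expectation (replicate_pmf (Suc m) p) (\<lambda>xs. (real (count_list xs x) - real (Suc m) * ?q)\<^sup>2) =
    (\<Sum>a\<in>?S. pmf p a * (measure_pmf.expectation ?R (\<lambda>xs. (?u xs)\<^sup>2) + 2 * ?i a * measure_pmf.expectation ?R ?u + (?i a)\<^sup>2))"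
  proof -
    have "measure_pmf.expectation ?R (\<lambda>xs. (?u xs + ?i a)\<^sup>2) =
      measure_pmf.expectation ?R (\<lambda>xs. (?u xs)\<^sup>2) + 2 * ?i a * measure_pmf.expectation ?R ?u + (?i a)\<^sup>2" for a
    proof -
      have "(\<lambda>xs. (?u xs + ?i a)\<^sup>2) = (\<lambda>xs. (?u xs)\<^sup>2 + 2 * ?i a * ?u xs + (?i a)\<^sup>2)"
        by (auto simp: power2_eq_square algebra_simps)
      then show ?thesis using int
        by (simp only:) (subst Bochner_Integration.integral_add, (simp_all only: int integrable_const measure_pmf.finite_measure_axioms),
          subst Bochner_Integration.integral_add, simp_all only: int integral_mult_right_zero, simp)
    qed
    then show ?thesis unfolding step u by simp
  qed
  also have "\<dots> = (\<Sum>a\<in>?S. pmf p a * (real m * (?q * (1 - ?q)))) + (\<Sum>a\<in>?S. pmf p a * (?i a)\<^sup>2)"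
    unfolding Suc by (simp add: distrib_left sum.distrib)
  also have "(\<Sum>a\<in>?S. pmf p a * (?i a)\<^sup>2) = (\<Sum>a\<in>?S. (1 - 2 * ?q) * (pmf p a * (if a = x then 1 else 0)) + ?q\<^sup>2 * pmf p a)"
    by (intro sum.cong refl) (auto simp: power2_eq_square algebra_simps)
  also have "\<dots> = (1 - 2 * ?q) * ?q + ?q\<^sup>2"
    unfolding sum.distrib sum_distrib_left[symmetric] sum_px sum_p by simp
  also have "(\<Sum>a\<in>?S. pmf p a * (real m * (?q * (1 - ?q)))) = real m * (?q * (1 - ?q))"
    unfolding sum_distrib_right[symmetric] sum_p by simp
  finally show "measure_pmf.expectation (replicate_pmf (Suc m) p) (\<lambda>xs. (real (count_list xs x) - real (Suc m) * ?q)\<^sup>2) =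
      real (Suc m) * (?q * (1 - ?q))"
    by (simp add: algebra_simps power2_eq_square)
qed

text \<open>
  Each count is binomial with variance \<open>m p (1 - p)\<close>, so each summand of the statistic has mean at
  most 1.
\<close>
lemma expectation_pearson_le:
  assumes fin: "finite (set_pmf p)" and m: "0 < m"
  shows "measure_pmf.expectation (replicate_pmf m p) (pearson p) \<le> real (card (set_pmf p))"
proof -
  have int: "integrable (replicate_pmf m p) f" for f :: "'a list \<Rightarrow> real"
    by (intro integrable_measure_pmf_finite finite_set_replicate_pmf fin)
  have "measure_pmf.expectation (replicate_pmf m p) (pearson p) =
    measure_pmf.expectation (replicate_pmf m p) (\<lambda>xs. \<Sum>x\<in>set_pmf p. (real (count_list xs x) - real m * pmf p x)\<^sup>2 / (real m * pmf p x))"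
    by (intro integral_cong_AE) (auto simp: AE_measure_pmf_iff set_replicate_pmf pearson_def)
  also have "\<dots> = (\<Sum>x\<in>set_pmf p. real m * (pmf p x * (1 - pmf p x)) / (real m * pmf p x))"
    using int by (subst Bochner_Integration.integral_sum) (simp_all add: expectation_count_list[OF fin])
  also have "\<dots> \<le> (\<Sum>x\<in>set_pmf p. 1)"
    using m by (intro sum_mono) (auto simp: set_pmf_iff)
  finally show ?thesis by simp
qed

lemma prob_pearson_ge:
  assumes fin: "finite (set_pmf p)" and m: "0 < m" and L: "0 < L"
  shows "measure_pmf.prob (replicate_pmf m p) {xs. L \<le> pearson p xs} \<le> real (card (set_pmf p)) / L"
proof -
  have "measure_pmf.prob (replicate_pmf m p) {xs \<in> space (replicate_pmf m p). L \<le> pearson p xs} \<le>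
      measure_pmf.expectation (replicate_pmf m p) (pearson p) / L"
    using L by (intro integral_Markov_inequality_measure[where A="{}"] integrable_measure_pmf_finite finite_set_replicate_pmf fin)
      (auto intro: pearson_nonneg)
  also have "\<dots> \<le> real (card (set_pmf p)) / L"
    using expectation_pearson_le[OF fin m] L by (intro divide_right_mono) auto
  finally show ?thesis by simp
qed

lemma prod_list_pmf_nonneg: "0 \<le> prod_list (map (pmf p) xs)"
  by (induction xs) auto

lemma prod_list_exp_le:
  fixes f g :: "'a \<Rightarrow> real"
  assumes "\<And>x. x \<in> set xs \<Longrightarrow> 0 \<le> f x \<and> f x \<le> g x * exp (h x)"
  shows "prod_list (map f xs) \<le> prod_list (map g xs) * exp (sum_list (map h xs))"
  using assms
proof (induction xs)
  case (Cons x xs)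
  have "prod_list (map f (x # xs)) \<le> (g x * exp (h x)) * (prod_list (map g xs) * exp (sum_list (map h xs)))"
  proof -
    have "0 \<le> prod_list (map f xs)" using Cons.prems by (intro prod_list_nonneg) auto
    moreover have "0 \<le> g x * exp (h x)" using Cons.prems[of x] by auto
    ultimately show ?thesis using Cons by (simp add: mult_mono')
  qed
  then show ?case by (simp add: exp_add mult_ac)
qed simp

lemma sum_list_count:
  fixes h :: "'a \<Rightarrow> real"
  assumes "finite X" "set xs \<subseteq> X"
  shows "sum_list (map h xs) = (\<Sum>x\<in>X. real (count_list xs x) * h x)"
  using assms(2)
proof (induction xs)
  case (Cons y ys)
  have "(\<Sum>x\<in>X. real (count_list (y # ys) x) * h x) = (\<Sum>x\<in>X. real (count_list ys x) * h x + (if x = y then h x else 0))"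
    by (intro sum.cong) (auto simp: algebra_simps)
  also have "\<dots> = sum_list (map h ys) + h y"
    using Cons assms(1) by (simp add: sum.distrib)
  finally show ?case by simp
qed simp

text \<open>
  From \<open>ln y \<le> 2 (sqrt y - 1)\<close> the log-likelihood ratio is at most the sum of the counts times
  \<open>2 (sqrt (p / p0) - 1)\<close>. Replacing counts by their means gives minus \<open>m\<close> times the squared Hellinger
  distance; the fluctuation is absorbed by Young's inequality into Pearson's statistic and half of
  that term. The squared Hellinger distance is at least a quarter of the squared Euclidean distance.
\<close>
lemma likelihood_ratio_le:
  assumes fin: "finite (set_pmf p0)" and xs: "set xs \<subseteq> set_pmf p0" and ne: "xs \<noteq> []"
  shows "prod_list (map (pmf p) xs) \<le> prod_list (map (pmf p0) xs) *
     exp (2 * pearson p0 xs - real (length xs) / 8 * (\<Sum>x\<in>set_pmf p0. (pmf p x - pmf p0 x)\<^sup>2))"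
proof -
  let ?X = "set_pmf p0" and ?m = "real (length xs)"
  let ?c = "\<lambda>x. real (count_list xs x)"
  define h where "h x = 2 * (sqrt (pmf p x / pmf p0 x) - 1)" for x
  have m: "0 < ?m" using ne by simp
  have pos: "0 < pmf p0 x" if "x \<in> ?X" for x using that by (simp add: pmf_positive_iff)
  have main: "prod_list (map (pmf p) xs) \<le> prod_list (map (pmf p0) xs) * exp (sum_list (map h xs))"
  proof (rule prod_list_exp_le, intro conjI)
    fix x assume "x \<in> set xs"
    then have p0: "0 < pmf p0 x" using xs pos by auto
    let ?s = "sqrt (pmf p x / pmf p0 x)"
    have "?s \<le> exp (?s - 1)" using exp_ge_add_one_self[of "?s - 1"] by simp
    then have "?s\<^sup>2 \<le> (exp (?s - 1))\<^sup>2" by (intro power_mono) auto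
    also have "\<dots> = exp (h x)" by (simp only: h_def exp_double)
    finally show "pmf p x \<le> pmf p0 x * exp (h x)" using p0 by (simp add: field_simps)
  qed simp
  have "sum_list (map h xs) = (\<Sum>x\<in>?X. ?c x * h x)" by (rule sum_list_count[OF fin xs])
  also have "\<dots> \<le> (\<Sum>x\<in>?X. ?m * (pmf p x - pmf p0 x) - ?m / 8 * (pmf p x - pmf p0 x)\<^sup>2 +
      2 * ((?c x - ?m * pmf p0 x)\<^sup>2 / (?m * pmf p0 x)))"
  proof (rule sum_mono)
    fix x assume "x \<in> ?X"
    then have p0: "0 < pmf p0 x" by (rule pos)
    define s t where "s = sqrt (pmf p x)" and "t = sqrt (pmf p0 x)"
    have st: "0 \<le> s" "0 < t" "s \<le> 1" "t \<le> 1" "pmf p x = s\<^sup>2" "pmf p0 x = t\<^sup>2"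
      using p0 by (auto simp: s_def t_def pmf_le_1)
    have h: "h x = 2 * (s - t) / t" unfolding h_def using st by (simp add: real_sqrt_divide field_simps)
    define g where "g = ?c x - ?m * t\<^sup>2"
    have "?c x * h x = ?m * (2 * t * (s - t)) + 2 * (g / t) * (s - t)"
      unfolding h g_def using st(2) by (simp add: field_simps power2_eq_square)
    also have "2 * (g / t) * (s - t) \<le> 2 * (g\<^sup>2 / (?m * t\<^sup>2)) + ?m * (s - t)\<^sup>2 / 2"
    proof -
      have "0 \<le> (2 * g / t - ?m * (s - t))\<^sup>2 / (2 * ?m)" using m by simp
      also have "\<dots> = 2 * (g\<^sup>2 / (?m * t\<^sup>2)) + ?m * (s - t)\<^sup>2 / 2 - 2 * (g / t) * (s - t)"
        using m st(2) by (simp add: field_simps power2_eq_square)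
      finally show ?thesis by simp
    qed
    also have "?m * (2 * t * (s - t)) = ?m * (s\<^sup>2 - t\<^sup>2) - ?m * (s - t)\<^sup>2"
      by (simp add: power2_eq_square algebra_simps)
    finally have "?c x * h x \<le> ?m * (s\<^sup>2 - t\<^sup>2) - ?m * (s - t)\<^sup>2 / 2 + 2 * (g\<^sup>2 / (?m * t\<^sup>2))" by simp
    moreover have "?m / 8 * (s\<^sup>2 - t\<^sup>2)\<^sup>2 \<le> ?m * (s - t)\<^sup>2 / 2"
    proof -
      have "(s\<^sup>2 - t\<^sup>2)\<^sup>2 = (s - t)\<^sup>2 * (s + t)\<^sup>2" by (simp add: power2_eq_square algebra_simps)
      also have "\<dots> \<le> (s - t)\<^sup>2 * 2\<^sup>2" using st by (intro mult_left_mono power_mono) auto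
      finally have "?m / 8 * (s\<^sup>2 - t\<^sup>2)\<^sup>2 \<le> ?m / 8 * ((s - t)\<^sup>2 * 2\<^sup>2)" using m by (intro mult_left_mono) auto
      then show ?thesis by simp
    qed
    ultimately show "?c x * h x \<le> ?m * (pmf p x - pmf p0 x) - ?m / 8 * (pmf p x - pmf p0 x)\<^sup>2 +
      2 * ((?c x - ?m * pmf p0 x)\<^sup>2 / (?m * pmf p0 x))"
      unfolding st(5,6) g_def by linarith
  qed
  also have "\<dots> = ?m * ((\<Sum>x\<in>?X. pmf p x) - (\<Sum>x\<in>?X. pmf p0 x)) - ?m / 8 * (\<Sum>x\<in>?X. (pmf p x - pmf p0 x)\<^sup>2) + 2 * pearson p0 xs"
    unfolding pearson_def by (simp add: sum.distrib sum_subtractf sum_distrib_left right_diff_distrib)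
  also have "\<dots> \<le> 2 * pearson p0 xs - ?m / 8 * (\<Sum>x\<in>?X. (pmf p x - pmf p0 x)\<^sup>2)"
  proof -
    have "(\<Sum>x\<in>?X. pmf p x) \<le> 1" using fin by (metis measure_measure_pmf_finite measure_pmf.prob_le_1)
    moreover have "(\<Sum>x\<in>?X. pmf p0 x) = 1" using fin by (rule sum_pmf_eq_1) simp
    ultimately have "?m * ((\<Sum>x\<in>?X. pmf p x) - (\<Sum>x\<in>?X. pmf p0 x)) \<le> 0" by (intro mult_nonneg_nonpos) auto
    then show ?thesis by simp
  qed
  finally show ?thesis
    by (intro order_trans[OF main] mult_left_mono) (auto intro: prod_list_pmf_nonneg)
qed

lemma ln_ge_quadratic:
  fixes w :: real
  assumes "\<bar>w\<bar> \<le> 1 / 2"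
  shows "exp (w - 2 * w\<^sup>2) \<le> 1 + w"
proof -
  have "w - 2 * w\<^sup>2 \<le> ln (1 + w)"
  proof (cases "0 \<le> w")
    case True
    then have "w - w\<^sup>2 \<le> ln (1 + w)" using assms by (intro ln_one_plus_pos_lower_bound) auto
    then show ?thesis using zero_le_power2[of w] by linarith
  next
    case False
    then have "- (-w) - 2 * (-w)\<^sup>2 \<le> ln (1 - (-w))" using assms by (intro ln_one_minus_pos_lower_bound) auto
    then show ?thesis by simp
  qed
  then have "exp (w - 2 * w\<^sup>2) \<le> exp (ln (1 + w))" by simp
  then show ?thesis using assms by simp
qed

text \<open>
  With \<open>w = (p - p0) / p0\<close> and \<open>ln (1 + w) \<ge> w - 2 w^2\<close> for \<open>w\<close> at most 1/2 in absolute value, the linear term has mean 0 under \<open>p0\<close>, so only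
  its fluctuation matters; Young's inequality bounds it by Pearson's statistic and a quadratic term.
\<close>
lemma likelihood_ratio_ge:
  assumes fin: "finite (set_pmf p0)" and xs: "set xs \<subseteq> set_pmf p0" and ne: "xs \<noteq> []" and sub: "set_pmf p \<subseteq> set_pmf p0"
    and \<kappa>: "0 < \<kappa>" "\<And>x. x \<in> set_pmf p0 \<Longrightarrow> \<kappa> \<le> pmf p0 x"
    and \<rho>: "\<And>x. x \<in> set_pmf p0 \<Longrightarrow> \<bar>pmf p x - pmf p0 x\<bar> \<le> \<rho>" "2 * \<rho> \<le> \<kappa>"
  shows "prod_list (map (pmf p0) xs) * exp (- (pearson p0 xs + real (length xs) * (\<rho> / \<kappa>)\<^sup>2 * (real (card (set_pmf p0)) + 2)))
     \<le> prod_list (map (pmf p) xs)"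
proof -
  let ?X = "set_pmf p0" and ?m = "real (length xs)"
  let ?c = "\<lambda>x. real (count_list xs x)"
  define w where "w x = (pmf p x - pmf p0 x) / pmf p0 x" for x
  have m: "0 < ?m" using ne by simp
  have pos: "0 < pmf p0 x" if "x \<in> ?X" for x using that by (simp add: pmf_positive_iff)
  have w: "\<bar>w x\<bar> \<le> \<rho> / \<kappa>" if "x \<in> ?X" for x
    unfolding w_def abs_divide using pos[OF that] \<kappa>(1) \<kappa>(2)[OF that] \<rho>(1)[OF that]
    by (intro frac_le) auto
  have \<rho>\<kappa>: "\<rho> / \<kappa> \<le> 1 / 2" using \<rho>(2) \<kappa>(1) by (simp add: field_simps)
  have w2: "(w x)\<^sup>2 \<le> (\<rho> / \<kappa>)\<^sup>2" if "x \<in> ?X" for x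
    using w[OF that] by (metis abs_ge_zero power2_abs power_mono)
  have main: "prod_list (map (pmf p0) xs) \<le> prod_list (map (pmf p) xs) * exp (sum_list (map (\<lambda>x. - (w x - 2 * (w x)\<^sup>2)) xs))"
  proof (rule prod_list_exp_le, intro conjI)
    fix x assume "x \<in> set xs"
    then have x: "x \<in> ?X" using xs by auto
    have "exp (w x - 2 * (w x)\<^sup>2) \<le> 1 + w x" using w[OF x] \<rho>\<kappa> by (intro ln_ge_quadratic) linarith
    then have "pmf p0 x * exp (w x - 2 * (w x)\<^sup>2) \<le> pmf p0 x * (1 + w x)" by (rule mult_left_mono) simp
    also have "\<dots> = pmf p x" using pos[OF x] by (simp add: w_def field_simps)
    finally show "pmf p0 x \<le> pmf p x * exp (- (w x - 2 * (w x)\<^sup>2))"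
      by (simp only: exp_minus) (simp add: field_simps)
  qed simp
  have "sum_list (map (\<lambda>x. - (w x - 2 * (w x)\<^sup>2)) xs) = (\<Sum>x\<in>?X. ?c x * - (w x - 2 * (w x)\<^sup>2))"
    by (rule sum_list_count[OF fin xs])
  also have "\<dots> \<le> (\<Sum>x\<in>?X. - ?m * (pmf p x - pmf p0 x) + (?c x - ?m * pmf p0 x)\<^sup>2 / (?m * pmf p0 x) + ?m * (\<rho> / \<kappa>)\<^sup>2 + ?c x * (2 * (\<rho> / \<kappa>)\<^sup>2))"
  proof (rule sum_mono)
    fix x assume x: "x \<in> ?X"
    define g r where "g = ?c x - ?m * pmf p0 x" and "r = pmf p0 x"
    have r: "0 < r" "r \<le> 1" using pos[OF x] by (auto simp: r_def pmf_le_1)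
    have eq: "?c x * - (w x - 2 * (w x)\<^sup>2) = - ?m * (r * w x) - g * w x + ?c x * (2 * (w x)\<^sup>2)"
      unfolding g_def r_def by (simp add: algebra_simps)
    have rw: "r * w x = pmf p x - pmf p0 x" using r by (simp add: w_def r_def)
    have gw: "- (g * w x) \<le> g\<^sup>2 / (?m * r) + ?m * (\<rho> / \<kappa>)\<^sup>2"
    proof -
      have mr: "0 < ?m * r" using m r by simp
      define X Z where "X = g\<^sup>2 / (?m * r)" and "Z = ?m * r * (w x)\<^sup>2"
      have "(g + D * y)\<^sup>2 / D = g\<^sup>2 / D + 2 * (g * y) + D * y\<^sup>2" if "0 < D" for D y :: real
        using that by (simp add: field_simps power2_eq_square)
      from this[OF mr, of "w x"] have "(g + ?m * r * w x)\<^sup>2 / (?m * r) = X + 2 * (g * w x) + Z"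
        by (simp only: X_def Z_def)
      moreover have "0 \<le> (g + ?m * r * w x)\<^sup>2 / (?m * r)" using mr by simp
      ultimately have "0 \<le> X + 2 * (g * w x) + Z" by simp
      moreover have "0 \<le> X" "0 \<le> Z" using mr by (auto simp: X_def Z_def)
      moreover have "Z \<le> ?m * 1 * (\<rho> / \<kappa>)\<^sup>2"
        unfolding Z_def using m r w2[OF x] by (intro mult_mono) auto
      ultimately have "- (g * w x) \<le> X + ?m * (\<rho> / \<kappa>)\<^sup>2" by linarith
      then show ?thesis by (simp add: X_def)
    qed
    have cw: "?c x * (2 * (w x)\<^sup>2) \<le> ?c x * (2 * (\<rho> / \<kappa>)\<^sup>2)" using w2[OF x] by (intro mult_left_mono) auto
    from gw cw show "?c x * - (w x - 2 * (w x)\<^sup>2) \<le> - ?m * (pmf p x - pmf p0 x) + (?c x - ?m * pmf p0 x)\<^sup>2 / (?m * pmf p0 x) + ?m * (\<rho> / \<kappa>)\<^sup>2 + ?c x * (2 * (\<rho> / \<kappa>)\<^sup>2)"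
      unfolding eq rw unfolding g_def r_def by linarith
  qed
  also have "\<dots> = pearson p0 xs + ?m * (\<rho> / \<kappa>)\<^sup>2 * (real (card ?X) + 2)"
  proof -
    have "(\<Sum>x\<in>?X. pmf p x) = 1" using fin sub by (rule sum_pmf_eq_1)
    moreover have "(\<Sum>x\<in>?X. pmf p0 x) = 1" using fin by (rule sum_pmf_eq_1) simp
    ultimately have "(\<Sum>x\<in>?X. - ?m * (pmf p x - pmf p0 x)) = 0"
      unfolding sum_distrib_left[symmetric] sum_subtractf by simp
    moreover have "(\<Sum>x\<in>?X. ?c x * (2 * (\<rho> / \<kappa>)\<^sup>2)) = ?m * (2 * (\<rho> / \<kappa>)\<^sup>2)"
      using sum_list_count[OF fin xs, of "\<lambda>_. 2 * (\<rho> / \<kappa>)\<^sup>2"] by (simp add: sum_list_triv)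
    ultimately show ?thesis
      unfolding sum.distrib pearson_def by (simp add: algebra_simps)
  qed
  finally have "prod_list (map (pmf p0) xs) \<le> prod_list (map (pmf p) xs) *
      exp (pearson p0 xs + ?m * (\<rho> / \<kappa>)\<^sup>2 * (real (card ?X) + 2))"
    by (intro order_trans[OF main] mult_left_mono) (auto intro: prod_list_pmf_nonneg)
  then show ?thesis by (simp only: exp_minus) (simp add: field_simps)
qed

section \<open>The posterior as a ratio of integrals\<close>

lemma borel_measurable_Gamma_real [measurable]: "(Gamma :: real \<Rightarrow> real) \<in> borel_measurable borel"
proof -
  have "(rGamma :: real \<Rightarrow> real) \<in> borel_measurable borel"
    by (intro borel_measurable_continuous_onI continuous_on_rGamma)
  then have "(\<lambda>x::real. inverse (rGamma x)) \<in> borel_measurable borel" by measurable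
  then show ?thesis by (simp add: rGamma_inverse_Gamma)
qed

lemma simplex_borel_imp_borel [measurable_dest]:
  fixes f :: "'a \<Rightarrow> real^'k"
  assumes "f \<in> M \<rightarrow>\<^sub>M simplex_borel"
  shows "f \<in> borel_measurable M"
  using assms by (auto simp: measurable_restrict_space2_iff)

text \<open>
  The reference measure of the density depends on the support of \<open>a\<close>. There are finitely many supports,
  and on the weights with a given support the density is jointly measurable.
\<close>
lemma measurable_dirichlet:
  assumes \<alpha>bar: "0 < \<alpha>bar"
  shows "(\<lambda>a::real^'k. dirichlet (\<alpha>bar *\<^sub>R a)) \<in> simplex_borel \<rightarrow>\<^sub>M prob_algebra simplex_borel"
proof (rule measurable_prob_algebraI)
  fix a :: "real^'k" assume "a \<in> space simplex_borel"
  then show "prob_space (dirichlet (\<alpha>bar *\<^sub>R a))" by (intro prob_space_dirichlet_scaled \<alpha>bar) simp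
next
  show "(\<lambda>a::real^'k. dirichlet (\<alpha>bar *\<^sub>R a)) \<in> simplex_borel \<rightarrow>\<^sub>M subprob_algebra simplex_borel"
  proof (rule measurable_subprob_algebra)
    fix a :: "real^'k" assume "a \<in> space simplex_borel"
    then show "subprob_space (dirichlet (\<alpha>bar *\<^sub>R a))" "sets (dirichlet (\<alpha>bar *\<^sub>R a)) = sets simplex_borel"
      by (auto intro!: prob_space_imp_subprob_space prob_space_dirichlet_scaled \<alpha>bar simp: sets_dirichlet_scaled[OF \<alpha>bar])
  next
    fix A :: "(real^'k) set" assume A: "A \<in> sets simplex_borel"
    then have [measurable]: "A \<in> sets borel" by (auto simp: sets_restrict_space_iff)
    define l where "l S = (SOME l. l \<in> S)" for S :: "'k set"
    define I where "I S a = (\<integral>\<^sup>+ x. ennreal (dir_density (S - {l S}) (l S) (\<alpha>bar *\<^sub>R a) x) *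
      indicator A (dir_embed (S - {l S}) (l S) x) \<partial>(\<Pi>\<^sub>M k\<in>S - {l S}. lborel))" for S a
    have "I S \<in> borel_measurable borel" for S
      unfolding I_def
    proof (rule sigma_finite_measure.borel_measurable_nn_integral)
      interpret finite_product_sigma_finite "\<lambda>_::'k. lborel :: real measure" "S - {l S}" by standard simp
      show "sigma_finite_measure (\<Pi>\<^sub>M k\<in>S - {l S}. (lborel :: real measure))" by (rule sigma_finite_measure_axioms)
      have [measurable]: "(\<lambda>z. dir_embed (S - {l S}) (l S) (snd z)) \<in> borel_measurable ((borel :: (real^'k) measure) \<Otimes>\<^sub>M (\<Pi>\<^sub>M k\<in>S - {l S}. lborel))"
        by (rule measurable_compose[OF measurable_snd measurable_dir_embed])
      have [measurable]: "(\<lambda>z. dir_density (S - {l S}) (l S) (\<alpha>bar *\<^sub>R fst z) (snd z)) \<in> borel_measurable ((borel :: (real^'k) measure) \<Otimes>\<^sub>M (\<Pi>\<^sub>M k\<in>S - {l S}. lborel))"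
        unfolding dir_density_def
        by measurable
      show "(\<lambda>(a, x). ennreal (dir_density (S - {l S}) (l S) (\<alpha>bar *\<^sub>R a) x) * indicator A (dir_embed (S - {l S}) (l S) x))
         \<in> borel_measurable (borel \<Otimes>\<^sub>M (\<Pi>\<^sub>M k\<in>S - {l S}. lborel))"
        unfolding case_prod_beta' by measurable
    qed
    then have [measurable]: "I S \<in> borel_measurable simplex_borel" for S by (rule measurable_restrict_space1)
    have "(\<lambda>a. \<Sum>S\<in>UNIV. if (\<forall>k. (0 < a $ k) = (k \<in> S)) then I S a else 0) \<in> borel_measurable (borel :: (real^'k) measure)"
      using \<open>\<And>S. I S \<in> borel_measurable borel\<close> by measurable
    then have meas: "(\<lambda>a. \<Sum>S\<in>UNIV. if (\<forall>k. (0 < a $ k) = (k \<in> S)) then I S a else 0) \<in> borel_measurable (simplex_borel :: (real^'k) measure)"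
      by (rule measurable_restrict_space1)
    have eq: "emeasure (dirichlet (\<alpha>bar *\<^sub>R a)) A = (\<Sum>S\<in>UNIV. if (\<forall>k. (0 < a $ k) = (k \<in> S)) then I S a else 0)"
      if "a \<in> space simplex_borel" for a
    proof -
      have a: "a \<in> prob_simplex" using that by simp
      obtain j where j: "0 < a $ j" using a by (rule prob_simplex_obtain_pos)
      let ?S = "{k. 0 < a $ k}"
      have S: "(\<forall>k. (0 < a $ k) = (k \<in> S)) \<longleftrightarrow> S = ?S" for S by auto
      have last: "dir_last (\<alpha>bar *\<^sub>R a) = l ?S" and free: "dir_free (\<alpha>bar *\<^sub>R a) = ?S - {l ?S}"
        unfolding dir_free_def dir_last_def l_def using \<alpha>bar by (simp_all add: zero_less_mult_iff)
      have "emeasure (dirichlet (\<alpha>bar *\<^sub>R a)) A = (\<integral>\<^sup>+ q. indicator A q \<partial>dirichlet (\<alpha>bar *\<^sub>R a))"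
        using A by (simp add: sets_dirichlet_scaled[OF \<alpha>bar a])
      also have "\<dots> = I ?S a"
        unfolding I_def using nn_integral_dirichlet[of "\<alpha>bar *\<^sub>R a" j "indicator A"] j \<alpha>bar
        by (simp add: last free)
      finally show ?thesis unfolding S by simp
    qed
    show "(\<lambda>a. emeasure (dirichlet (\<alpha>bar *\<^sub>R a)) A) \<in> borel_measurable simplex_borel"
      using meas by (subst measurable_cong[OF eq]) auto
  qed
qed

text \<open>
  On a countable space a kernel is measurable as soon as its point masses are.
\<close>
lemma measurable_kernel_pmf:
  fixes p :: "'b \<Rightarrow> 'a::countable pmf"
  assumes [measurable]: "\<And>x. (\<lambda>z. pmf (p z) x) \<in> borel_measurable M"
  shows "(\<lambda>z. measure_pmf (p z)) \<in> M \<rightarrow>\<^sub>M prob_algebra (count_space UNIV)"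
proof (rule measurable_prob_algebraI)
  show "prob_space (measure_pmf (p z))" for z by (rule prob_space_measure_pmf)
  show "(\<lambda>z. measure_pmf (p z)) \<in> M \<rightarrow>\<^sub>M subprob_algebra (count_space UNIV)"
  proof (rule measurable_subprob_algebra)
    show "subprob_space (measure_pmf (p z))" for z by (rule measure_pmf.subprob_space_axioms)
    show "sets (measure_pmf (p z)) = sets (count_space UNIV)" for z by simp
    fix A :: "'a set"
    interpret sigma_finite_measure "count_space (UNIV :: 'a set)"
      by (rule sigma_finite_measure_count_space_countable) auto
    have "(\<lambda>z. \<integral>\<^sup>+ x. ennreal (pmf (p z) x) * indicator A x \<partial>count_space UNIV) \<in> borel_measurable M"
    proof (rule borel_measurable_nn_integral)
      show "(\<lambda>(z, x). ennreal (pmf (p z) x) * indicator A x) \<in> borel_measurable (M \<Otimes>\<^sub>M count_space UNIV)"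
        by (subst measurable_pair_swap_iff, rule measurable_pair_measure_countable1) auto
    qed
    moreover have "emeasure (measure_pmf (p z)) A = (\<integral>\<^sup>+ x. ennreal (pmf (p z) x) * indicator A x \<partial>count_space UNIV)" for z
      using nn_integral_measure_pmf[of "p z" "indicator A"] by simp
    ultimately show "(\<lambda>z. emeasure (measure_pmf (p z)) A) \<in> borel_measurable M" by simp
  qed
qed

lemma measurable_lda_prob:
  fixes a :: "'z \<Rightarrow> real^'k" and \<Theta> :: "'z \<Rightarrow> 'k \<Rightarrow> real^'v"
  assumes \<alpha>bar: "0 < \<alpha>bar" and [measurable]: "a \<in> M \<rightarrow>\<^sub>M simplex_borel" "\<And>k. (\<lambda>z. \<Theta> z k) \<in> M \<rightarrow>\<^sub>M simplex_borel"
  shows "(\<lambda>z. lda_prob \<alpha>bar (a z) (\<Theta> z) x) \<in> borel_measurable M"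
proof -
  have a: "a z \<in> prob_simplex" if "z \<in> space M" for z
    using measurable_space[OF assms(2) that] by simp
  have [measurable]: "(\<lambda>z. pochhammer (\<alpha>bar * a z $ k) n) \<in> borel_measurable M" for k n
    unfolding pochhammer_prod by measurable
  have meas: "(\<lambda>z. \<Sum>\<kappa>\<in>{..<length x} \<rightarrow>\<^sub>E UNIV. (\<Prod>k\<in>UNIV. pochhammer (\<alpha>bar * a z $ k) (card {j \<in> {..<length x}. \<kappa> j = k})) /
         pochhammer \<alpha>bar (\<Sum>k\<in>(UNIV::'k set). card {j \<in> {..<length x}. \<kappa> j = k}) * (\<Prod>j<length x. \<Theta> z (\<kappa> j) $ (x ! j))) \<in> borel_measurable M"
    by measurable
  have eq: "lda_prob \<alpha>bar (a z) (\<Theta> z) x =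
    (\<Sum>\<kappa>\<in>{..<length x} \<rightarrow>\<^sub>E UNIV. (\<Prod>k\<in>UNIV. pochhammer (\<alpha>bar * a z $ k) (card {j \<in> {..<length x}. \<kappa> j = k})) /
         pochhammer \<alpha>bar (\<Sum>k\<in>(UNIV::'k set). card {j \<in> {..<length x}. \<kappa> j = k}) * (\<Prod>j<length x. \<Theta> z (\<kappa> j) $ (x ! j)))"
    if "z \<in> space M" for z
    unfolding lda_prob_expansion[OF \<alpha>bar a[OF that]] dir_moment_def[OF \<alpha>bar a[OF that]] ..
  show ?thesis by (subst measurable_cong[OF eq]) (auto intro: meas)
qed

lemma pmf_documents:
  fixes \<Theta> :: "'k::finite \<Rightarrow> real^'v"
  assumes "0 < \<alpha>bar" "a \<in> prob_simplex" "\<And>k. \<Theta> k \<in> prob_simplex" "q \<in> prob_simplex"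
  shows "pmf (documents_pmf \<alpha>bar N m n a \<Theta> q) (ws, ds) =
    (if length ws = n then prod_list (map (\<lambda>v. \<Sum>k\<in>UNIV. q $ k * \<Theta> k $ v) ws) else 0) *
    (if length ds = m then prod_list (map (\<lambda>x. if length x = N then lda_prob \<alpha>bar a \<Theta> x else 0) ds) else 0)"
proof -
  have "pmf (multi (\<Sum>k\<in>UNIV. q $ k *\<^sub>R \<Theta> k)) = (\<lambda>v. \<Sum>k\<in>UNIV. q $ k * \<Theta> k $ v)"
    by (rule ext, subst pmf_multi) (auto intro!: convex_combination_prob_simplex assms)
  moreover have "pmf (lda_pmf \<alpha>bar N a \<Theta>) = (\<lambda>x. if length x = N then lda_prob \<alpha>bar a \<Theta> x else 0)"
    by (rule ext, rule pmf_lda_pmf) (auto intro: assms)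
  ultimately show ?thesis
    by (simp add: documents_pmf_def pmf_pair pmf_replicate_pmf)
qed

lemma measurable_documents_pmf:
  fixes a :: "'z \<Rightarrow> real^'k" and \<Theta> :: "'z \<Rightarrow> 'k \<Rightarrow> real^'v"
  assumes \<alpha>bar: "0 < \<alpha>bar" and [measurable]: "a \<in> M \<rightarrow>\<^sub>M simplex_borel" "\<And>k. (\<lambda>z. \<Theta> z k) \<in> M \<rightarrow>\<^sub>M simplex_borel"
    "q \<in> M \<rightarrow>\<^sub>M simplex_borel"
  shows "(\<lambda>z. measure_pmf (documents_pmf \<alpha>bar N m n (a z) (\<Theta> z) (q z))) \<in> M \<rightarrow>\<^sub>M prob_algebra (count_space UNIV)"
proof (rule measurable_kernel_pmf)
  fix d :: "'v list \<times> 'v list list"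
  obtain ws ds where d: "d = (ws, ds)" by (cases d)
  have in_simplex: "a z \<in> prob_simplex" "\<Theta> z k \<in> prob_simplex" "q z \<in> prob_simplex" if "z \<in> space M" for z k
    using measurable_space[OF assms(2) that] measurable_space[OF assms(3) that] measurable_space[OF assms(4) that] by auto
  have [measurable]: "(\<lambda>z. prod_list (map (\<lambda>v. f v z) ws)) \<in> borel_measurable M"
    if "\<And>v. f v \<in> borel_measurable M" for f :: "'u \<Rightarrow> 'z \<Rightarrow> real" and ws
    using that by (induction ws) auto
  have *: "(\<lambda>z. if length x = N then lda_prob \<alpha>bar (a z) (\<Theta> z) x else 0) \<in> borel_measurable M" for x
    using measurable_lda_prob[OF \<alpha>bar assms(2), where \<Theta>=\<Theta> and x=x, OF assms(3)] by simp
  have "(\<lambda>z. (if length ws = n then prod_list (map (\<lambda>v. \<Sum>k\<in>UNIV. q z $ k * \<Theta> z k $ v) ws) else 0) *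
    (if length ds = m then prod_list (map (\<lambda>x. if length x = N then lda_prob \<alpha>bar (a z) (\<Theta> z) x else 0) ds) else 0)) \<in> borel_measurable M"
    using * by measurable
  then show "(\<lambda>z. pmf (documents_pmf \<alpha>bar N m n (a z) (\<Theta> z) (q z)) d) \<in> borel_measurable M"
    unfolding d by (subst measurable_cong[OF pmf_documents[OF \<alpha>bar in_simplex]])
qed

context
  fixes \<alpha>bar :: real and \<Pi>\<^sub>\<alpha> :: "(real^'k) measure" and \<Pi>\<^sub>\<theta> :: "(real^'v) measure" and N m n :: nat
  assumes \<alpha>bar: "0 < \<alpha>bar"
    and \<Pi>\<^sub>\<alpha>: "\<Pi>\<^sub>\<alpha> \<in> space (prob_algebra simplex_borel)" and \<Pi>\<^sub>\<theta>: "\<Pi>\<^sub>\<theta> \<in> space (prob_algebra simplex_borel)"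
begin

lemma sets_priors [measurable_cong]: "sets \<Pi>\<^sub>\<alpha> = sets simplex_borel" "sets \<Pi>\<^sub>\<theta> = sets simplex_borel"
  using \<Pi>\<^sub>\<alpha> \<Pi>\<^sub>\<theta> by (auto simp: space_prob_algebra)

lemma space_priors: "space \<Pi>\<^sub>\<alpha> = prob_simplex" "space \<Pi>\<^sub>\<theta> = prob_simplex"
  using sets_priors[THEN sets_eq_imp_space_eq] by auto

lemma prob_space_priors: "prob_space \<Pi>\<^sub>\<alpha>" "prob_space \<Pi>\<^sub>\<theta>"
  using \<Pi>\<^sub>\<alpha> \<Pi>\<^sub>\<theta> by (auto simp: space_prob_algebra)

abbreviation topics_prior :: "('k \<Rightarrow> real^'v) measure" where
  "topics_prior \<equiv> \<Pi>\<^sub>M k\<in>UNIV. \<Pi>\<^sub>\<theta>"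

lemma prob_space_topics_prior: "prob_space topics_prior"
  by (intro prob_space_PiM prob_space_priors)

lemma space_topics_prior: "\<Theta> \<in> space topics_prior \<longleftrightarrow> (\<forall>k. \<Theta> k \<in> prob_simplex)"
  by (auto simp: space_PiM space_priors)

abbreviation likelihood :: "real^'k \<Rightarrow> ('k \<Rightarrow> real^'v) \<Rightarrow> real^'k \<Rightarrow> 'v list \<times> 'v list list \<Rightarrow> real" where
  "likelihood a \<Theta> q d \<equiv> pmf (documents_pmf \<alpha>bar N m n a \<Theta> q) d"

text \<open>
  Once all kernels are measurable, the nested binds unfold into iterated integrals. The data space is
  discrete, so the event that the data are \<open>d\<close> contributes the probability of \<open>d\<close>.
\<close>
lemma
  assumes A[measurable]: "A \<in> sets borel"
  shows emeasure_lda_model: "emeasure (lda_model \<alpha>bar \<Pi>\<^sub>\<alpha> \<Pi>\<^sub>\<theta> N m n) {\<omega> \<in> space (lda_model \<alpha>bar \<Pi>\<^sub>\<alpha> \<Pi>\<^sub>\<theta> N m n). fst \<omega> \<in> A \<and> snd \<omega> = d} =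
      (\<integral>\<^sup>+ a. \<integral>\<^sup>+ \<Theta>. \<integral>\<^sup>+ q. indicator A q * ennreal (likelihood a \<Theta> q d) \<partial>dirichlet (\<alpha>bar *\<^sub>R a) \<partial>topics_prior \<partial>\<Pi>\<^sub>\<alpha>)" (is ?em)
    and prob_space_lda_model: "prob_space (lda_model \<alpha>bar \<Pi>\<^sub>\<alpha> \<Pi>\<^sub>\<theta> N m n)" (is ?ps)
    and sets_lda_model: "sets (lda_model \<alpha>bar \<Pi>\<^sub>\<alpha> \<Pi>\<^sub>\<theta> N m n) = sets ((simplex_borel :: (real^'k) measure) \<Otimes>\<^sub>M count_space (UNIV :: ('v list \<times> 'v list list) set))" (is ?se)
    and measurable_inner_integral: "(\<lambda>(a, \<Theta>). \<integral>\<^sup>+ q. indicator A q * ennreal (likelihood a \<Theta> q d) \<partial>dirichlet (\<alpha>bar *\<^sub>R a))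
      \<in> borel_measurable (\<Pi>\<^sub>\<alpha> \<Otimes>\<^sub>M topics_prior)" (is ?me)
proof -
  let ?R = "(simplex_borel :: (real^'k) measure) \<Otimes>\<^sub>M count_space (UNIV :: ('v list \<times> 'v list list) set)"
  let ?P = "\<lambda>a \<Theta> q. measure_pmf (documents_pmf \<alpha>bar N m n a \<Theta> q)"
  define K4 where "K4 = (\<lambda>a \<Theta> q. ?P a \<Theta> q \<bind> (\<lambda>d. return ?R (q, d)))"
  define K3 where "K3 = (\<lambda>a \<Theta>. dirichlet (\<alpha>bar *\<^sub>R a) \<bind> (\<lambda>q. K4 a \<Theta> q))"
  define K2 where "K2 = (\<lambda>a. topics_prior \<bind> (\<lambda>\<Theta>. K3 a \<Theta>))"
  define X where "X = {\<omega> \<in> space ?R. fst \<omega> \<in> A \<and> snd \<omega> = d}"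
  have model: "lda_model \<alpha>bar \<Pi>\<^sub>\<alpha> \<Pi>\<^sub>\<theta> N m n = \<Pi>\<^sub>\<alpha> \<bind> K2"
    unfolding lda_model_def K2_def K3_def K4_def ..
  have X[measurable]: "X \<in> sets ?R" unfolding X_def by measurable
  have comp[measurable]: "(\<lambda>\<Theta>. \<Theta> k) \<in> topics_prior \<rightarrow>\<^sub>M simplex_borel" for k
    by measurable
  have P4: "(\<lambda>((a, \<Theta>), q). ?P a \<Theta> q) \<in> (\<Pi>\<^sub>\<alpha> \<Otimes>\<^sub>M topics_prior) \<Otimes>\<^sub>M simplex_borel \<rightarrow>\<^sub>M prob_algebra (count_space UNIV)"
    unfolding case_prod_beta' by (intro measurable_documents_pmf \<alpha>bar) measurable
  have K4m: "(\<lambda>((a, \<Theta>), q). K4 a \<Theta> q) \<in> (\<Pi>\<^sub>\<alpha> \<Otimes>\<^sub>M topics_prior) \<Otimes>\<^sub>M simplex_borel \<rightarrow>\<^sub>M prob_algebra ?R"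
    unfolding K4_def case_prod_beta'
    by (rule measurable_bind_prob_space2[OF P4[unfolded case_prod_beta']]) measurable
  have D: "(\<lambda>(a, \<Theta>). dirichlet (\<alpha>bar *\<^sub>R a)) \<in> \<Pi>\<^sub>\<alpha> \<Otimes>\<^sub>M topics_prior \<rightarrow>\<^sub>M prob_algebra simplex_borel"
    unfolding case_prod_beta' by (rule measurable_compose[OF _ measurable_dirichlet[OF \<alpha>bar]]) measurable
  have K3m: "(\<lambda>(a, \<Theta>). K3 a \<Theta>) \<in> \<Pi>\<^sub>\<alpha> \<Otimes>\<^sub>M topics_prior \<rightarrow>\<^sub>M prob_algebra ?R"
    unfolding K3_def case_prod_beta'
    by (rule measurable_bind_prob_space2[OF D[unfolded case_prod_beta']]) (use K4m in \<open>simp only: case_prod_beta'\<close>)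
  have T: "topics_prior \<in> space (prob_algebra topics_prior)"
    by (simp add: space_prob_algebra prob_space_topics_prior)
  have K2m: "K2 \<in> \<Pi>\<^sub>\<alpha> \<rightarrow>\<^sub>M prob_algebra ?R"
    unfolding K2_def
    by (rule measurable_bind_prob_space2[OF measurable_const[OF T] K3m])
  have \<Pi>\<alpha>: "\<Pi>\<^sub>\<alpha> \<in> space (prob_algebra \<Pi>\<^sub>\<alpha>)" by (simp add: space_prob_algebra prob_space_priors)
  have "lda_model \<alpha>bar \<Pi>\<^sub>\<alpha> \<Pi>\<^sub>\<theta> N m n \<in> space (prob_algebra ?R)"
    using measurable_space[OF measurable_bind_prob_space[OF measurable_const[OF \<Pi>\<alpha>] K2m], of undefined "count_space UNIV"]
    unfolding model by simp
  then show ?ps and sets_model: ?se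
    by (auto simp: space_prob_algebra)
  have space_model: "space (lda_model \<alpha>bar \<Pi>\<^sub>\<alpha> \<Pi>\<^sub>\<theta> N m n) = space ?R"
    using sets_eq_imp_space_eq[OF sets_model] .
  have em4: "emeasure (K4 a \<Theta> q) X = indicator A q * ennreal (likelihood a \<Theta> q d)" if q: "q \<in> prob_simplex" for a \<Theta> q
  proof -
    have ret: "(\<lambda>d. return ?R (q, d)) \<in> count_space UNIV \<rightarrow>\<^sub>M prob_algebra ?R"
      by (rule measurable_compose[OF _ measurable_return_prob_space]) (use q in \<open>auto simp: space_pair_measure\<close>)
    have "emeasure (K4 a \<Theta> q) X = (\<integral>\<^sup>+ d'. emeasure (return ?R (q, d')) X \<partial>?P a \<Theta> q)"
      unfolding K4_def by (rule emeasure_bind_prob_algebra[OF _ ret X]) (simp add: space_prob_algebra prob_space_measure_pmf)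
    also have "\<dots> = (\<integral>\<^sup>+ d'. indicator A q * indicator {d} d' \<partial>?P a \<Theta> q)"
      unfolding emeasure_return[OF X]
      using q by (intro nn_integral_cong) (auto simp: X_def indicator_def space_pair_measure)
    also have "\<dots> = indicator A q * ennreal (likelihood a \<Theta> q d)"
      by (subst nn_integral_cmult) (auto simp: emeasure_pmf_single)
    finally show ?thesis .
  qed
  have em3: "emeasure (K3 a \<Theta>) X = (\<integral>\<^sup>+ q. indicator A q * ennreal (likelihood a \<Theta> q d) \<partial>dirichlet (\<alpha>bar *\<^sub>R a))"
    if z: "(a, \<Theta>) \<in> space (\<Pi>\<^sub>\<alpha> \<Otimes>\<^sub>M topics_prior)" for a \<Theta>
  proof -
    have a: "a \<in> prob_simplex" using z by (simp add: space_pair_measure space_priors)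
    have "K4 a \<Theta> \<in> simplex_borel \<rightarrow>\<^sub>M prob_algebra ?R"
      using measurable_compose[OF measurable_Pair1'[OF z] K4m] by simp
    moreover have "dirichlet (\<alpha>bar *\<^sub>R a) \<in> space (prob_algebra simplex_borel)"
      by (simp add: space_prob_algebra prob_space_dirichlet_scaled[OF \<alpha>bar a] sets_dirichlet_scaled[OF \<alpha>bar a])
    ultimately have "emeasure (K3 a \<Theta>) X = (\<integral>\<^sup>+ q. emeasure (K4 a \<Theta> q) X \<partial>dirichlet (\<alpha>bar *\<^sub>R a))"
      unfolding K3_def using X by (intro emeasure_bind_prob_algebra)
    also have "\<dots> = (\<integral>\<^sup>+ q. indicator A q * ennreal (likelihood a \<Theta> q d) \<partial>dirichlet (\<alpha>bar *\<^sub>R a))"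
      by (intro nn_integral_cong em4) (simp add: space_dirichlet_scaled[OF \<alpha>bar a])
    finally show ?thesis .
  qed
  have "(\<lambda>z. emeasure (case z of (a, \<Theta>) \<Rightarrow> K3 a \<Theta>) X) \<in> borel_measurable (\<Pi>\<^sub>\<alpha> \<Otimes>\<^sub>M topics_prior)"
    using measurable_compose[OF measurable_prob_algebraD[OF K3m] measurable_emeasure_subprob_algebra[OF X]] .
  then show ?me
    by (rule measurable_cong[THEN iffD1, rotated]) (auto simp: em3)
  have em2: "emeasure (K2 a) X = (\<integral>\<^sup>+ \<Theta>. \<integral>\<^sup>+ q. indicator A q * ennreal (likelihood a \<Theta> q d) \<partial>dirichlet (\<alpha>bar *\<^sub>R a) \<partial>topics_prior)"
    if a: "a \<in> space \<Pi>\<^sub>\<alpha>" for a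
  proof -
    have "K3 a \<in> topics_prior \<rightarrow>\<^sub>M prob_algebra ?R"
      using measurable_compose[OF measurable_Pair1'[OF a] K3m] by simp
    then have "emeasure (K2 a) X = (\<integral>\<^sup>+ \<Theta>. emeasure (K3 a \<Theta>) X \<partial>topics_prior)"
      unfolding K2_def using X T by (intro emeasure_bind_prob_algebra)
    also have "\<dots> = (\<integral>\<^sup>+ \<Theta>. \<integral>\<^sup>+ q. indicator A q * ennreal (likelihood a \<Theta> q d) \<partial>dirichlet (\<alpha>bar *\<^sub>R a) \<partial>topics_prior)"
      using a by (intro nn_integral_cong em3) (simp add: space_pair_measure)
    finally show ?thesis .
  qed
  have "emeasure (lda_model \<alpha>bar \<Pi>\<^sub>\<alpha> \<Pi>\<^sub>\<theta> N m n) X = (\<integral>\<^sup>+ a. emeasure (K2 a) X \<partial>\<Pi>\<^sub>\<alpha>)"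
    unfolding model by (rule emeasure_bind_prob_algebra[OF \<Pi>\<alpha> K2m X])
  also have "\<dots> = (\<integral>\<^sup>+ a. \<integral>\<^sup>+ \<Theta>. \<integral>\<^sup>+ q. indicator A q * ennreal (likelihood a \<Theta> q d) \<partial>dirichlet (\<alpha>bar *\<^sub>R a) \<partial>topics_prior \<partial>\<Pi>\<^sub>\<alpha>)"
    by (intro nn_integral_cong em2)
  finally show ?em unfolding space_model X_def .
qed

abbreviation evidence :: "'v list \<times> 'v list list \<Rightarrow> ennreal" where
  "evidence d \<equiv> (\<integral>\<^sup>+ a. \<integral>\<^sup>+ \<Theta>. \<integral>\<^sup>+ q. ennreal (likelihood a \<Theta> q d) \<partial>dirichlet (\<alpha>bar *\<^sub>R a) \<partial>topics_prior \<partial>\<Pi>\<^sub>\<alpha>)"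

lemma posterior_bounds: "0 \<le> posterior \<alpha>bar \<Pi>\<^sub>\<alpha> \<Pi>\<^sub>\<theta> N m n d A" "posterior \<alpha>bar \<Pi>\<^sub>\<alpha> \<Pi>\<^sub>\<theta> N m n d A \<le> 1"
proof -
  interpret prob_space "lda_model \<alpha>bar \<Pi>\<^sub>\<alpha> \<Pi>\<^sub>\<theta> N m n" using prob_space_lda_model[of "{}"] by simp
  let ?M = "lda_model \<alpha>bar \<Pi>\<^sub>\<alpha> \<Pi>\<^sub>\<theta> N m n"
  have [measurable_cong]: "sets ?M = sets ((simplex_borel :: (real^'k) measure) \<Otimes>\<^sub>M count_space (UNIV :: ('v list \<times> 'v list list) set))"
    by (rule sets_lda_model[of "{}"]) simp
  have "{\<omega> \<in> space ?M. snd \<omega> = d} \<in> events" by measurable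
  then have "prob {\<omega> \<in> space ?M. fst \<omega> \<in> A \<and> snd \<omega> = d} \<le> prob {\<omega> \<in> space ?M. snd \<omega> = d}"
    by (intro finite_measure_mono) auto
  then show "posterior \<alpha>bar \<Pi>\<^sub>\<alpha> \<Pi>\<^sub>\<theta> N m n d A \<le> 1"
    unfolding posterior_def cond_prob_def by (simp add: divide_le_eq_1 measure_nonneg less_le)
  show "0 \<le> posterior \<alpha>bar \<Pi>\<^sub>\<alpha> \<Pi>\<^sub>\<theta> N m n d A"
    unfolding posterior_def cond_prob_def by simp
qed

text \<open>
  The bound may be checked separately for each mixing measure: integrating \<open>num\<close> against the priors
  compares the posterior numerator with the evidence.
\<close>
lemma posterior_le:
  assumes A: "A \<in> sets borel" and "0 < D" "0 \<le> B" "0 \<le> \<eta>"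
    and num: "\<And>a \<Theta>. a \<in> prob_simplex \<Longrightarrow> (\<And>k. \<Theta> k \<in> prob_simplex) \<Longrightarrow>
      (\<integral>\<^sup>+ q. indicator A q * ennreal (likelihood a \<Theta> q d) \<partial>dirichlet (\<alpha>bar *\<^sub>R a)) \<le>
        ennreal B + ennreal \<eta> * (\<integral>\<^sup>+ q. ennreal (likelihood a \<Theta> q d) \<partial>dirichlet (\<alpha>bar *\<^sub>R a))"
    and den: "ennreal D \<le> evidence d"
  shows "posterior \<alpha>bar \<Pi>\<^sub>\<alpha> \<Pi>\<^sub>\<theta> N m n d A \<le> B / D + \<eta>"
proof -
  let ?M = "lda_model \<alpha>bar \<Pi>\<^sub>\<alpha> \<Pi>\<^sub>\<theta> N m n"
  let ?J = "\<lambda>a \<Theta>. \<integral>\<^sup>+ q. ennreal (likelihood a \<Theta> q d) \<partial>dirichlet (\<alpha>bar *\<^sub>R a)"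
  interpret M: prob_space ?M using prob_space_lda_model[of "{}"] by simp
  interpret a: prob_space \<Pi>\<^sub>\<alpha> by (rule prob_space_priors)
  interpret \<Theta>: prob_space topics_prior by (rule prob_space_topics_prior)
  have meas: "(\<lambda>(a, \<Theta>). ?J a \<Theta>) \<in> borel_measurable (\<Pi>\<^sub>\<alpha> \<Otimes>\<^sub>M topics_prior)"
    using measurable_inner_integral[of UNIV d] by simp
  have J1[measurable]: "?J a \<in> borel_measurable topics_prior" if "a \<in> space \<Pi>\<^sub>\<alpha>" for a
    using measurable_compose[OF measurable_Pair1'[OF that] meas] by simp
  have J2[measurable]: "(\<lambda>a. \<integral>\<^sup>+ \<Theta>. ?J a \<Theta> \<partial>topics_prior) \<in> borel_measurable \<Pi>\<^sub>\<alpha>"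
    using \<Theta>.borel_measurable_nn_integral[OF meas] .
  have evidence: "evidence d = ennreal (M.prob {\<omega> \<in> space ?M. snd \<omega> = d})"
    using emeasure_lda_model[of UNIV d] by (simp add: M.emeasure_eq_measure)
  have "ennreal (M.prob {\<omega> \<in> space ?M. fst \<omega> \<in> A \<and> snd \<omega> = d}) =
    (\<integral>\<^sup>+ a. \<integral>\<^sup>+ \<Theta>. \<integral>\<^sup>+ q. indicator A q * ennreal (likelihood a \<Theta> q d) \<partial>dirichlet (\<alpha>bar *\<^sub>R a) \<partial>topics_prior \<partial>\<Pi>\<^sub>\<alpha>)"
    using emeasure_lda_model[OF A, of d] by (simp add: M.emeasure_eq_measure)
  also have "\<dots> \<le> (\<integral>\<^sup>+ a. \<integral>\<^sup>+ \<Theta>. ennreal B + ennreal \<eta> * ?J a \<Theta> \<partial>topics_prior \<partial>\<Pi>\<^sub>\<alpha>)"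
    by (intro nn_integral_mono num) (auto simp: space_priors space_topics_prior)
  also have "\<dots> = (\<integral>\<^sup>+ a. ennreal B + ennreal \<eta> * (\<integral>\<^sup>+ \<Theta>. ?J a \<Theta> \<partial>topics_prior) \<partial>\<Pi>\<^sub>\<alpha>)"
    by (intro nn_integral_cong) (simp add: nn_integral_add nn_integral_cmult \<Theta>.emeasure_space_1)
  also have "\<dots> = ennreal B + ennreal \<eta> * evidence d"
    by (simp add: nn_integral_add nn_integral_cmult a.emeasure_space_1)
  finally have "M.prob {\<omega> \<in> space ?M. fst \<omega> \<in> A \<and> snd \<omega> = d} \<le> B + \<eta> * M.prob {\<omega> \<in> space ?M. snd \<omega> = d}"
    unfolding evidence using assms by (simp flip: ennreal_mult' ennreal_plus)
  moreover have D: "D \<le> M.prob {\<omega> \<in> space ?M. snd \<omega> = d}"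
    using den unfolding evidence by simp
  moreover have "B / M.prob {\<omega> \<in> space ?M. snd \<omega> = d} \<le> B / D"
    using D assms by (intro divide_left_mono) auto
  ultimately show ?thesis
    unfolding posterior_def cond_prob_def using assms(2)
    by (smt (verit) divide_right_mono add_divide_distrib nonzero_mult_div_cancel_right)
qed

end

section \<open>Prior mass of small neighbourhoods\<close>

lemma Gamma_bounded_above:
  fixes u v :: real
  assumes "0 < u"
  obtains B where "1 \<le> B" "\<And>x. u \<le> x \<Longrightarrow> x \<le> v \<Longrightarrow> Gamma x \<le> B"
proof -
  have "continuous_on {u..v} (Gamma :: real \<Rightarrow> real)"
    using assms by (intro continuous_on_Gamma continuous_on_id) (auto elim!: nonpos_Ints_cases)
  then have "bounded (Gamma ` {u..v})"
    by (intro compact_imp_bounded compact_continuous_image) auto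
  then obtain B where "\<forall>y\<in>Gamma ` {u..v}. norm y \<le> B"
    unfolding bounded_iff by blast
  then have "Gamma x \<le> max 1 B" if "u \<le> x" "x \<le> v" for x
  proof -
    have "norm (Gamma x) \<le> B" using that \<open>\<forall>y\<in>Gamma ` {u..v}. norm y \<le> B\<close> by simp
    then show ?thesis by (simp add: abs_le_iff max.coboundedI2)
  qed
  then show thesis by (intro that[of "max 1 B"]) auto
qed

lemma emeasure_box_PiM:
  fixes z :: "'k::finite \<Rightarrow> real"
  assumes "0 \<le> h"
  shows "emeasure (\<Pi>\<^sub>M k\<in>T. (lborel :: real measure)) (\<Pi>\<^sub>E k\<in>T. {z k - h..z k}) = ennreal (h ^ card T)"
proof -
  interpret finite_product_sigma_finite "\<lambda>_::'k. lborel :: real measure" T by standard simp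
  have "emeasure (\<Pi>\<^sub>M k\<in>T. (lborel :: real measure)) (\<Pi>\<^sub>E k\<in>T. {z k - h..z k}) = (\<Prod>k\<in>T. ennreal h)"
    using assms by (subst measure_times) auto
  then show ?thesis using assms by (simp add: ennreal_power)
qed

text \<open>
  The centre may lie on the boundary of the simplex, where the density may vanish. It is moved towards
  the barycentre by an amount of order \<open>\<rho>\<close>; on a cube around the new centre all coordinates are at least
  a multiple of \<open>\<rho>\<close>, so the density is at least a power of \<open>\<rho>\<close>. The lower bound on the weights keeps
  the normalising constant away from 0.
\<close>
lemma dirichlet_ball_mass:
  assumes \<alpha>bar: "0 < \<alpha>bar" and \<kappa>: "0 < \<kappa>"
  obtains c \<beta> where "0 < c" "0 < \<beta>"
    "\<And>(a::real^'k) q1 \<rho>. a \<in> prob_simplex \<Longrightarrow> (\<And>k. \<kappa> \<le> a $ k) \<Longrightarrow> q1 \<in> prob_simplex \<Longrightarrow> 0 < \<rho> \<Longrightarrow> \<rho> \<le> 1 \<Longrightarrow>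
      ennreal (c * \<rho> powr \<beta>) \<le> emeasure (dirichlet (\<alpha>bar *\<^sub>R a)) {q \<in> prob_simplex. norm (q - q1) \<le> \<rho>}"
proof -
  define K where "K = real CARD('k)"
  have K: "1 \<le> K" unfolding K_def by (simp add: Suc_leI)
  obtain B where B: "1 \<le> B" "\<And>x. \<alpha>bar * \<kappa> \<le> x \<Longrightarrow> x \<le> \<alpha>bar \<Longrightarrow> Gamma x \<le> B"
    using Gamma_bounded_above[of "\<alpha>bar * \<kappa>" \<alpha>bar] \<alpha>bar \<kappa> by auto
  define g where "g = Gamma \<alpha>bar / B ^ CARD('k)"
  have g: "0 < g" unfolding g_def using B(1) \<alpha>bar by simp
  define \<beta> where "\<beta> = \<alpha>bar * K + (K - 1)"
  have \<beta>: "0 < \<beta>" unfolding \<beta>_def using \<alpha>bar K by (intro add_pos_nonneg) auto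
  define u where "u = 1 / (8 * K * K)"
  have u: "0 < u" "u \<le> 1" unfolding u_def using K mult_mono[of 1 K 1 K] by (auto simp: field_simps)
  show thesis
  proof (rule that[of "g * u powr \<beta>" \<beta>])
    show "0 < g * u powr \<beta>" using g u by simp
    show "0 < \<beta>" by (rule \<beta>)
    fix a q1 :: "real^'k" and \<rho> :: real
    assume a: "a \<in> prob_simplex" and ak: "\<And>k. \<kappa> \<le> a $ k" and q1: "q1 \<in> prob_simplex" and \<rho>: "0 < \<rho>" "\<rho> \<le> 1"
    define T l where "T = dir_free (\<alpha>bar *\<^sub>R a)" and "l = dir_last (\<alpha>bar *\<^sub>R a)"
    have a_pos: "0 < a $ k" for k using ak[of k] \<kappa> by linarith
    have ins: "insert l T = UNIV" and l: "l \<notin> T"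
      unfolding T_def l_def using insert_dir_free[of "\<alpha>bar *\<^sub>R a" undefined] a_pos \<alpha>bar by auto
    have T: "T = UNIV - {l}" using ins l by auto
    have cardT: "real (card T) = K - 1" unfolding T K_def by (simp add: card_Diff_singleton of_nat_diff Suc_leI)
    (* \<open>z\<close> is the shifted centre and \<open>h\<close> the side of the cube; every coordinate moves by at most \<open>2 * s\<close>. *)
    define s where "s = \<rho> / (4 * K)"
    define h where "h = s / (2 * K)"
    define z where "z k = (1 - s) * q1 $ k + s / K" for k
    have s: "0 < s" "s \<le> 1" unfolding s_def using \<rho> K by (auto simp: field_simps)
    have h_eq: "h = u * \<rho>" unfolding h_def s_def u_def by (simp add: field_simps)
    have h: "0 < h" "h \<le> 1" unfolding h_eq using u \<rho> by (auto intro: mult_le_one)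
    have hK: "s / K = 2 * h" "K * h = s / 2" unfolding h_def using K by auto
    have z_ge: "2 * h \<le> z k" for k
      unfolding z_def hK using s prob_simplexD(1)[OF q1, of k] by simp
    have z_sum: "(\<Sum>k\<in>UNIV. z k) = 1"
      unfolding z_def sum.distrib sum_distrib_left[symmetric] prob_simplexD(2)[OF q1] using K by (simp add: K_def[symmetric])
    have z_dist: "\<bar>z k - q1 $ k\<bar> \<le> s" for k
    proof -
      have "z k - q1 $ k = s * (1 / K - q1 $ k)" unfolding z_def by (simp add: algebra_simps)
      moreover have "\<bar>1 / K - q1 $ k\<bar> \<le> 1"
      proof -
        have "0 \<le> 1 / K" "1 / K \<le> 1" using K by auto
        then show ?thesis using prob_simplexD(1,3)[OF q1, of k] by linarith
      qed
      ultimately show ?thesis using s by (simp add: abs_mult mult_left_le)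
    qed
    have z_sumT: "(\<Sum>k\<in>T. z k) = 1 - z l"
      using z_sum l unfolding ins[symmetric] by simp
    let ?E = "\<Pi>\<^sub>E k\<in>T. {z k - h..z k}"
    let ?Q = "{q \<in> prob_simplex. norm (q - q1) \<le> \<rho>}"
    define D where "D = g * (h powr \<alpha>bar) ^ CARD('k)"
    have D: "0 \<le> D" unfolding D_def using g by simp
    have box: "ennreal D * indicator ?E x \<le> ennreal (dir_density T l (\<alpha>bar *\<^sub>R a) x) * indicator ?Q (dir_embed T l x)" for x
    proof (cases "x \<in> ?E")
      case True
      then have x: "z k - h \<le> x k" "x k \<le> z k" if "k \<in> T" for k using that by (auto dest: PiE_mem)
      have x_ge: "h \<le> x k" if "k \<in> T" for k using x(1)[OF that] z_ge[of k] by linarith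
      let ?r = "1 - (\<Sum>k\<in>T. x k)"
      have "(\<Sum>k\<in>T. x k) \<le> 1 - z l" using sum_mono[of T x z] x(2) z_sumT by auto
      then have r: "z l \<le> ?r" by linarith
      have "(\<Sum>k\<in>T. z k - h) \<le> (\<Sum>k\<in>T. x k)" by (intro sum_mono x)
      then have r': "?r \<le> z l + (K - 1) * h" by (simp add: sum_subtractf z_sumT cardT)
      have x_nonneg: "0 \<le> (\<Sum>k\<in>T. x k)" using x_ge h by (intro sum_nonneg) (meson less_imp_le order_trans)
      have r_bounds: "h \<le> ?r" "?r \<le> 1" using r z_ge[of l] h x_nonneg by auto
      have x_le: "x k \<le> 1" if "k \<in> T" for k
      proof -
        have "x k \<le> (\<Sum>k\<in>T. x k)" using that x_ge h by (intro member_le_sum) (auto intro: order_trans[of 0 h])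
        then show ?thesis using r_bounds h by linarith
      qed
      have in_Q: "dir_embed T l x \<in> ?Q"
      proof -
        have "(\<Sum>k\<in>UNIV. dir_embed T l x $ k) = 1"
          unfolding ins[symmetric] using l by (simp add: dir_embed_def cong: sum.cong)
        then have "dir_embed T l x \<in> prob_simplex"
          using x_ge h r_bounds by (auto simp: prob_simplex_def dir_embed_def intro: order_trans[of 0 h])
        moreover have "\<bar>dir_embed T l x $ k - q1 $ k\<bar> \<le> 2 * s" for k
        proof (cases "k \<in> T")
          case True
          have "h \<le> s" using mult_right_mono[OF K, of h] hK(2) h s by linarith
          then have "\<bar>x k - q1 $ k\<bar> \<le> 2 * s" using x[OF True] z_dist[of k] by linarith
          then show ?thesis using True by (simp add: dir_embed_def)
        next
          case False
          then have "k = l" using T by simp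
          moreover have "(K - 1) * h \<le> s / 2" using hK h by (simp add: algebra_simps)
          ultimately show ?thesis
            using r r' z_dist[of l] s l by (simp add: dir_embed_def abs_le_iff)
        qed
        then have "norm (dir_embed T l x - q1) \<le> K * (2 * s)"
          unfolding K_def by (intro order_trans[OF norm_le_l1_cart] sum_bounded_above) auto
        moreover have "K * (2 * s) \<le> \<rho>" unfolding s_def using K \<rho> by simp
        ultimately show ?thesis by simp
      qed
      have powr_ge: "h powr \<alpha>bar \<le> y powr ((\<alpha>bar *\<^sub>R a) $ k - 1)" if "h \<le> y" "y \<le> 1" for y k
      proof -
        have "h powr \<alpha>bar \<le> y powr \<alpha>bar" using that h \<alpha>bar by (intro powr_mono2) auto
        also have "\<dots> \<le> y powr ((\<alpha>bar *\<^sub>R a) $ k - 1)"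
        proof (rule powr_mono')
          have "\<alpha>bar * a $ k \<le> \<alpha>bar" using prob_simplexD(3)[OF a, of k] \<alpha>bar by simp
          then show "(\<alpha>bar *\<^sub>R a) $ k - 1 \<le> \<alpha>bar" by simp
        qed (use that h in auto)
        finally show ?thesis .
      qed
      have "D \<le> dir_density T l (\<alpha>bar *\<^sub>R a) x"
      proof -
        have "(\<Prod>k\<in>UNIV. Gamma ((\<alpha>bar *\<^sub>R a) $ k)) \<le> (\<Prod>k\<in>(UNIV::'k set). B)"
          using \<alpha>bar a_pos ak prob_simplexD(3)[OF a] by (intro prod_mono conjI less_imp_le[OF Gamma_real_pos] B(2)) auto
        then have G: "g \<le> Gamma (\<Sum>k\<in>insert l T. (\<alpha>bar *\<^sub>R a) $ k) / (\<Prod>k\<in>insert l T. Gamma ((\<alpha>bar *\<^sub>R a) $ k))"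
          unfolding g_def ins sum_dirichlet_parameter[OF a] using \<alpha>bar a_pos B(1)
          by (intro frac_le) (auto intro!: prod_pos)
        have "(h powr \<alpha>bar) ^ CARD('k) = (\<Prod>k\<in>insert l T. h powr \<alpha>bar)" unfolding ins by simp
        also have "\<dots> = (\<Prod>k\<in>T. h powr \<alpha>bar) * h powr \<alpha>bar" using l by simp
        also have "\<dots> \<le> (\<Prod>k\<in>T. x k powr ((\<alpha>bar *\<^sub>R a) $ k - 1)) * ?r powr ((\<alpha>bar *\<^sub>R a) $ l - 1)"
          using x_ge x_le r_bounds by (intro mult_mono prod_mono conjI powr_ge) (auto intro!: prod_nonneg)
        also have "\<dots> = simplex_kernel T (\<lambda>k. (\<alpha>bar *\<^sub>R a) $ k) ((\<alpha>bar *\<^sub>R a) $ l) 1 x"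
        proof -
          have "(\<forall>k\<in>T. 0 < x k) \<and> (\<Sum>k\<in>T. x k) < 1"
            using x_ge h r_bounds by (auto intro: less_le_trans)
          then show ?thesis unfolding simplex_kernel_def by simp
        qed
        finally have ker: "(h powr \<alpha>bar) ^ CARD('k) \<le> simplex_kernel T (\<lambda>k. (\<alpha>bar *\<^sub>R a) $ k) ((\<alpha>bar *\<^sub>R a) $ l) 1 x" .
        show ?thesis
          unfolding D_def dir_density_def
          by (rule mult_mono[OF G ker order_trans[OF less_imp_le[OF g] G]]) simp
      qed
      then show ?thesis using True in_Q by (simp add: ennreal_leI)
    qed simp
    have [measurable]: "?Q \<in> sets borel" by measurable
    have "ennreal (D * h ^ card T) = ennreal D * emeasure (\<Pi>\<^sub>M k\<in>T. (lborel :: real measure)) ?E"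
      using emeasure_box_PiM[of h T z] h D by (simp add: ennreal_mult')
    also have "\<dots> = (\<integral>\<^sup>+ x. ennreal D * indicator ?E x \<partial>(\<Pi>\<^sub>M k\<in>T. lborel))"
      by (subst nn_integral_cmult_indicator) (auto intro!: sets_PiM_I_finite)
    also have "\<dots> \<le> (\<integral>\<^sup>+ x. ennreal (dir_density T l (\<alpha>bar *\<^sub>R a) x) * indicator ?Q (dir_embed T l x) \<partial>(\<Pi>\<^sub>M k\<in>T. lborel))"
      by (intro nn_integral_mono box)
    also have "\<dots> = (\<integral>\<^sup>+ q. indicator ?Q q \<partial>dirichlet (\<alpha>bar *\<^sub>R a))"
      using nn_integral_dirichlet[of "\<alpha>bar *\<^sub>R a" l "indicator ?Q"] a_pos[of l] \<alpha>bar by (simp add: T_def l_def)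
    also have "\<dots> = emeasure (dirichlet (\<alpha>bar *\<^sub>R a)) ?Q"
      by (subst nn_integral_indicator) (auto simp: sets_dirichlet_scaled[OF \<alpha>bar a] sets_restrict_space_iff)
    also have "D * h ^ card T = g * u powr \<beta> * \<rho> powr \<beta>"
    proof -
      have "(h powr \<alpha>bar) ^ CARD('k) * h ^ card T = h powr \<beta>"
        using h cardT unfolding \<beta>_def K_def by (simp add: powr_add powr_powr flip: powr_realpow)
      then show ?thesis unfolding D_def h_eq using u \<rho> by (simp add: powr_mult)
    qed
    finally show "ennreal (g * u powr \<beta> * \<rho> powr \<beta>) \<le> emeasure (dirichlet (\<alpha>bar *\<^sub>R a)) ?Q" .
  qed
qed

text \<open>
  Regularity bounds the mass of balls centred in the set \<open>\<Omega>\<close> of full measure. A point of the support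
  need not lie in \<open>\<Omega>\<close>, but every ball around it meets \<open>\<Omega>\<close>, which costs a factor 2 in the radius.
\<close>
lemma prior_ball_mass:
  fixes P :: "(real^'d) measure"
  assumes P: "P \<in> space (prob_algebra simplex_borel)" and reg: "regular_measure P" and x: "x \<in> measure_support P"
  obtains c b where "0 < c" "0 < b"
    "\<And>\<rho>. 0 < \<rho> \<Longrightarrow> \<rho> < b \<Longrightarrow> ennreal (c * \<rho> ^ (CARD('d) - 1)) \<le> emeasure P {\<eta> \<in> prob_simplex. norm (\<eta> - x) < \<rho>}"
proof -
  have sets_P: "sets P = sets simplex_borel" and "prob_space P" using P by (auto simp: space_prob_algebra)
  have space_P: "space P = prob_simplex" using sets_eq_imp_space_eq[OF sets_P] by simp
  interpret prob_space P by fact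
  from reg obtain \<Omega> c where \<Omega>: "\<Omega> \<in> sets P" "\<Omega> \<subseteq> prob_simplex" "prob \<Omega> = 1" and c: "0 < c"
    and ev: "\<forall>\<^sub>F \<epsilon> in at_right 0. \<forall>\<eta>'\<in>\<Omega>. prob {\<eta>\<in>\<Omega>. norm (\<eta> - \<eta>') < \<epsilon>} \<ge> c * \<epsilon> ^ (CARD('d) - 1)"
    unfolding regular_measure_def by blast
  from ev obtain b where b: "0 < b" "\<And>\<epsilon> \<eta>'. 0 < \<epsilon> \<Longrightarrow> \<epsilon> < b \<Longrightarrow> \<eta>' \<in> \<Omega> \<Longrightarrow> prob {\<eta>\<in>\<Omega>. norm (\<eta> - \<eta>') < \<epsilon>} \<ge> c * \<epsilon> ^ (CARD('d) - 1)"
    unfolding eventually_at_right[OF zero_less_one] by blast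
  have meas: "{\<eta>\<in>prob_simplex. norm (\<eta> - y) < \<epsilon>} \<in> events" for y \<epsilon>
  proof -
    have "{\<eta>\<in>prob_simplex. norm (\<eta> - y) < \<epsilon>} \<in> sets borel" by measurable
    then show ?thesis unfolding sets_P by (subst sets_restrict_space_iff) auto
  qed
  show thesis
  proof (rule that[of "c * (1 / 2) ^ (CARD('d) - 1)" b])
    fix \<rho> :: real assume \<rho>: "0 < \<rho>" "\<rho> < b"
    have "\<exists>\<eta>'\<in>\<Omega>. norm (\<eta>' - x) < \<rho> / 2"
    proof (rule ccontr)
      assume "\<not> ?thesis"
      then have disj: "\<Omega> \<inter> {\<eta>\<in>prob_simplex. norm (\<eta> - x) < \<rho> / 2} = {}" by auto
      have "prob \<Omega> + prob {\<eta>\<in>prob_simplex. norm (\<eta> - x) < \<rho> / 2} = prob (\<Omega> \<union> {\<eta>\<in>prob_simplex. norm (\<eta> - x) < \<rho> / 2})"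
        by (rule finite_measure_Union[OF \<Omega>(1) meas disj, symmetric])
      also have "\<dots> \<le> 1" by (rule prob_le_1)
      finally have "prob {\<eta>\<in>prob_simplex. norm (\<eta> - x) < \<rho> / 2} \<le> 0" using \<Omega>(3) by simp
      moreover have "ball x (\<rho> / 2) \<inter> space P = {\<eta>\<in>prob_simplex. norm (\<eta> - x) < \<rho> / 2}"
        by (auto simp: space_P dist_norm norm_minus_commute)
      moreover have "0 < emeasure P (ball x (\<rho> / 2) \<inter> space P)"
        using x \<rho> by (auto simp: measure_support_def)
      ultimately show False by (simp add: emeasure_eq_measure)
    qed
    then obtain \<eta>' where \<eta>': "\<eta>' \<in> \<Omega>" "norm (\<eta>' - x) < \<rho> / 2" by blast
    have "c * (\<rho> / 2) ^ (CARD('d) - 1) \<le> prob {\<eta>\<in>\<Omega>. norm (\<eta> - \<eta>') < \<rho> / 2}"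
      using \<rho> \<eta>' by (intro b(2)) auto
    also have "\<dots> \<le> prob {\<eta>\<in>prob_simplex. norm (\<eta> - x) < \<rho>}"
    proof (rule finite_measure_mono[OF _ meas], safe)
      fix \<eta> assume \<eta>: "\<eta> \<in> \<Omega>" "norm (\<eta> - \<eta>') < \<rho> / 2"
      then show "\<eta> \<in> prob_simplex" using \<Omega> by auto
      have "norm (\<eta> - x) \<le> norm (\<eta> - \<eta>') + norm (\<eta>' - x)" using norm_triangle_ineq[of "\<eta> - \<eta>'" "\<eta>' - x"] by simp
      then show "norm (\<eta> - x) < \<rho>" using \<eta> \<eta>' by linarith
    qed
    finally show "ennreal (c * (1 / 2) ^ (CARD('d) - 1) * \<rho> ^ (CARD('d) - 1)) \<le> emeasure P {\<eta> \<in> prob_simplex. norm (\<eta> - x) < \<rho>}"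
      by (simp add: emeasure_eq_measure ennreal_leI power_divide mult.commute)
  qed (use c b in auto)
qed

section \<open>A lower bound for the evidence\<close>

lemma prod_list_scale:
  fixes f g :: "'a \<Rightarrow> real"
  assumes "0 \<le> c" "\<And>x. x \<in> set xs \<Longrightarrow> c * g x \<le> f x" "\<And>x. x \<in> set xs \<Longrightarrow> 0 \<le> g x"
  shows "c ^ length xs * prod_list (map g xs) \<le> prod_list (map f xs)"
  using assms(2,3)
proof (induction xs)
  case (Cons x xs)
  have "c ^ length (x # xs) * prod_list (map g (x # xs)) = (c * g x) * (c ^ length xs * prod_list (map g xs))"
    by (simp add: mult_ac)
  also have "\<dots> \<le> f x * prod_list (map f xs)"
    using Cons assms(1) by (intro mult_mono Cons.IH) (auto intro!: mult_nonneg_nonneg prod_list_nonneg order_trans[OF _ Cons.prems(1)])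
  finally show ?case by simp
qed simp

lemma pmf_documents_split:
  "pmf (documents_pmf \<alpha>bar N m n a \<Theta> q) (ws, ds) =
    (if length ws = n then prod_list (map (pmf (multi (\<Sum>k\<in>UNIV. q $ k *\<^sub>R \<Theta> k))) ws) else 0) *
    (if length ds = m then prod_list (map (pmf (lda_pmf \<alpha>bar N a \<Theta>)) ds) else 0)"
  by (simp add: documents_pmf_def pmf_pair pmf_replicate_pmf)

lemma pmf_multi_mixture:
  fixes \<Theta> :: "'k::finite \<Rightarrow> real^'v"
  assumes "q \<in> prob_simplex" "\<And>k. \<Theta> k \<in> prob_simplex"
  shows "pmf (multi (\<Sum>k\<in>UNIV. q $ k *\<^sub>R \<Theta> k)) v = (\<Sum>k\<in>UNIV. q $ k * \<Theta> k $ v)"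
  by (subst pmf_multi) (auto intro!: convex_combination_prob_simplex assms)

lemma mixture_ge:
  assumes "q \<in> prob_simplex" "\<And>k. c \<le> f k"
  shows "c \<le> (\<Sum>k\<in>UNIV. q $ k * f k)"
proof -
  have "c = (\<Sum>k\<in>UNIV. q $ k * c)"
    unfolding sum_distrib_right[symmetric] prob_simplexD(2)[OF assms(1)] by simp
  also have "\<dots> \<le> (\<Sum>k\<in>UNIV. q $ k * f k)"
    using assms(2) prob_simplexD(1)[OF assms(1)] by (intro sum_mono mult_left_mono)
  finally show ?thesis .
qed

lemma lda_prob_ge:
  fixes a :: "real^'k" and \<Theta> :: "'k \<Rightarrow> real^'v"
  assumes \<alpha>bar: "0 < \<alpha>bar" and a: "a \<in> prob_simplex" and \<Theta>: "\<And>k. \<Theta> k \<in> prob_simplex"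
    and c: "0 \<le> c" "\<And>k v. c \<le> \<Theta> k $ v"
  shows "c ^ length x \<le> lda_prob \<alpha>bar a \<Theta> x"
proof -
  interpret prob_space "dirichlet (\<alpha>bar *\<^sub>R a)" by (rule prob_space_dirichlet_scaled[OF \<alpha>bar a])
  show ?thesis unfolding lda_prob_def
  proof (rule integral_ge_const)
    show "integrable (dirichlet (\<alpha>bar *\<^sub>R a)) (\<lambda>q. \<Prod>j<length x. \<Sum>k\<in>UNIV. q $ k * \<Theta> k $ (x ! j))"
      using mixture_component_bounds[OF \<alpha>bar a \<Theta>]
      by (intro integrable_dirichlet[OF \<alpha>bar a, of _ 1]) (auto simp: abs_prod intro!: prod_le_1)
    show "AE q in dirichlet (\<alpha>bar *\<^sub>R a). c ^ length x \<le> (\<Prod>j<length x. \<Sum>k\<in>UNIV. q $ k * \<Theta> k $ (x ! j))"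
    proof (rule AE_I2)
      fix q assume "q \<in> space (dirichlet (\<alpha>bar *\<^sub>R a))"
      then have q: "q \<in> prob_simplex" by (simp add: space_dirichlet_scaled[OF \<alpha>bar a])
      have "(\<Prod>j<length x. c) \<le> (\<Prod>j<length x. \<Sum>k\<in>UNIV. q $ k * \<Theta> k $ (x ! j))"
        by (intro prod_mono conjI mixture_ge[OF q] c)
      then show "c ^ length x \<le> (\<Prod>j<length x. \<Sum>k\<in>UNIV. q $ k * \<Theta> k $ (x ! j))" by simp
    qed
  qed
qed

lemma exp_le_one_minus_power:
  fixes t :: real
  assumes "0 \<le> t" "t \<le> 1 / 2"
  shows "exp (- 2 * t * real k) \<le> (1 - t) ^ k"
proof -
  have "- t - 2 * t\<^sup>2 \<le> ln (1 - t)" using assms by (rule ln_one_minus_pos_lower_bound)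
  moreover have "t * t \<le> t * (1 / 2)" using assms by (intro mult_left_mono) auto
  ultimately have "- 2 * t \<le> ln (1 - t)" by (simp add: power2_eq_square)
  then have "exp (- 2 * t) \<le> 1 - t" using assms by (subst ln_ge_iff[symmetric]) auto
  then have "exp (- 2 * t) ^ k \<le> (1 - t) ^ k" by (intro power_mono) auto
  then show ?thesis by (simp add: exp_of_nat_mult[symmetric] mult.commute)
qed

lemma abs_nth_le_norm: "norm (x - y) \<le> r \<Longrightarrow> \<bar>x $ i - y $ i\<bar> \<le> r" for x y :: "real^'n"
  using component_le_norm_cart[of "x - y" i] by simp

text \<open>
  A perturbation of relative size \<open>t\<close> costs a factor \<open>(1 - t)^2\<close> for each of the \<open>n\<close> words and, by
  \<open>lda_prob_shrink\<close>, \<open>(1 - t)^(2 N)\<close> for each of the \<open>m\<close> documents, on arbitrary data.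
\<close>
lemma likelihood_ge_near_truth:
  fixes a0 a :: "real^'k" and \<theta>0 \<Theta> :: "'k \<Rightarrow> real^'v"
  assumes \<alpha>bar: "0 < \<alpha>bar" and a0: "a0 \<in> prob_simplex" and \<theta>0: "\<And>k. \<theta>0 k \<in> prob_simplex" and q0: "q0 \<in> prob_simplex"
    and c0: "0 < c0" "\<And>k v. c0 \<le> \<theta>0 k $ v" and \<mu>: "\<And>k. \<mu> \<le> a0 $ k"
    and a: "a \<in> prob_simplex" and \<Theta>: "\<And>k. \<Theta> k \<in> prob_simplex" and q: "q \<in> prob_simplex"
    and t: "0 \<le> t" "t \<le> 1 / 2"
    and \<rho>: "\<rho> \<le> t * \<mu>" "\<rho> \<le> t * c0" "real CARD('k) * \<rho> \<le> t * c0"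
    and near: "norm (a - a0) \<le> \<rho>" "\<And>k. norm (\<Theta> k - \<theta>0 k) \<le> \<rho>" "norm (q - q0) \<le> \<rho>"
  shows "exp (- 2 * t * (2 * real n + 2 * real N * real m)) * pmf (documents_pmf \<alpha>bar N m n a0 \<theta>0 q0) (ws, ds)
    \<le> pmf (documents_pmf \<alpha>bar N m n a \<Theta> q) (ws, ds)"
proof (cases "length ws = n \<and> length ds = m")
  case False
  then show ?thesis by (auto simp: pmf_documents_split)
next
  case True
  then have len: "length ws = n" "length ds = m" by auto
  have le_a: "(1 - t) * a0 $ k \<le> a $ k" for k
  proof -
    have "t * \<mu> \<le> t * a0 $ k" using \<mu> t by (intro mult_left_mono)
    then show ?thesis using abs_nth_le_norm[OF near(1), of k] \<rho>(1) by (simp add: algebra_simps abs_le_iff)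
  qed
  have le_\<Theta>: "(1 - t) * \<theta>0 k $ v \<le> \<Theta> k $ v" for k v
  proof -
    have "t * c0 \<le> t * \<theta>0 k $ v" using c0 t by (intro mult_left_mono)
    then show ?thesis using abs_nth_le_norm[OF near(2)[of k], of v] \<rho>(2) by (simp add: algebra_simps abs_le_iff)
  qed
  have words: "(1 - t)\<^sup>2 * (\<Sum>k\<in>UNIV. q0 $ k * \<theta>0 k $ v) \<le> (\<Sum>k\<in>UNIV. q $ k * \<Theta> k $ v)" for v
  proof -
    have "(\<Sum>k\<in>UNIV. q0 $ k * \<theta>0 k $ v) - (\<Sum>k\<in>UNIV. q $ k * \<theta>0 k $ v) = (\<Sum>k\<in>UNIV. (q0 $ k - q $ k) * \<theta>0 k $ v)"
      by (simp add: left_diff_distrib sum_subtractf)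
    also have "\<dots> \<le> (\<Sum>k\<in>(UNIV::'k set). \<rho> * 1)"
      using abs_nth_le_norm[OF near(3)] prob_simplexD[OF \<theta>0]
      by (intro sum_mono) (smt (verit) mult_left_le mult_nonneg_nonpos2 mult_right_mono)
    also have "\<dots> \<le> t * c0" using \<rho>(3) by simp
    also have "\<dots> \<le> t * (\<Sum>k\<in>UNIV. q0 $ k * \<theta>0 k $ v)" using t by (intro mult_left_mono mixture_ge q0 c0)
    finally have "(1 - t) * (\<Sum>k\<in>UNIV. q0 $ k * \<theta>0 k $ v) \<le> (\<Sum>k\<in>UNIV. q $ k * \<theta>0 k $ v)" by (simp add: algebra_simps)
    then have "(1 - t) * ((1 - t) * (\<Sum>k\<in>UNIV. q0 $ k * \<theta>0 k $ v)) \<le> (1 - t) * (\<Sum>k\<in>UNIV. q $ k * \<theta>0 k $ v)"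
      using t by (intro mult_left_mono) auto
    also have "\<dots> = (\<Sum>k\<in>UNIV. q $ k * ((1 - t) * \<theta>0 k $ v))" by (simp add: sum_distrib_left mult_ac)
    also have "\<dots> \<le> (\<Sum>k\<in>UNIV. q $ k * \<Theta> k $ v)"
      by (intro sum_mono mult_left_mono le_\<Theta> prob_simplexD(1) q)
    finally show ?thesis by (simp add: power2_eq_square mult.assoc)
  qed
  let ?w = "\<lambda>q \<Theta>. prod_list (map (pmf (multi (\<Sum>k\<in>UNIV. q $ k *\<^sub>R \<Theta> k))) ws)"
  let ?z = "\<lambda>a \<Theta>. prod_list (map (pmf (lda_pmf \<alpha>bar N a \<Theta>)) ds)"
  have W: "((1 - t)\<^sup>2) ^ n * ?w q0 \<theta>0 \<le> ?w q \<Theta>"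
    unfolding len(1)[symmetric]
    by (rule prod_list_scale) (auto simp: pmf_multi_mixture q q0 \<theta>0 \<Theta> words
        intro!: sum_nonneg mult_nonneg_nonneg prob_simplexD(1))
  have Z: "((1 - t) ^ (2 * N)) ^ m * ?z a0 \<theta>0 \<le> ?z a \<Theta>"
    unfolding len(2)[symmetric]
  proof (rule prod_list_scale)
    fix x
    show "(1 - t) ^ (2 * N) * pmf (lda_pmf \<alpha>bar N a0 \<theta>0) x \<le> pmf (lda_pmf \<alpha>bar N a \<Theta>) x"
      unfolding pmf_lda_pmf[OF \<alpha>bar a0, where \<Theta>=\<theta>0, OF \<theta>0] pmf_lda_pmf[OF \<alpha>bar a, where \<Theta>=\<Theta>, OF \<Theta>]
      using lda_prob_shrink[OF \<alpha>bar a a0, where \<Theta>=\<Theta> and \<Theta>'=\<theta>0 and t=t and x=x] prob_simplexD(1)[OF \<theta>0] t le_a le_\<Theta> by auto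
  qed (use t in auto)
  have pow: "exp (- 2 * t * (2 * real n + 2 * real N * real m)) \<le> ((1 - t)\<^sup>2) ^ n * ((1 - t) ^ (2 * N)) ^ m"
  proof -
    have "real (2 * n + 2 * N * m) = 2 * real n + 2 * real N * real m" by simp
    moreover have "((1 - t)\<^sup>2) ^ n * ((1 - t) ^ (2 * N)) ^ m = (1 - t) ^ (2 * n + 2 * N * m)"
      by (simp only: power_mult[symmetric] power_add)
    ultimately show ?thesis using exp_le_one_minus_power[OF t, of "2 * n + 2 * N * m"] by simp
  qed
  have "exp (- 2 * t * (2 * real n + 2 * real N * real m)) * (?w q0 \<theta>0 * ?z a0 \<theta>0) \<le>
      (((1 - t)\<^sup>2) ^ n * ((1 - t) ^ (2 * N)) ^ m) * (?w q0 \<theta>0 * ?z a0 \<theta>0)"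
    by (intro mult_right_mono pow mult_nonneg_nonneg prod_list_pmf_nonneg)
  also have "\<dots> = (((1 - t)\<^sup>2) ^ n * ?w q0 \<theta>0) * (((1 - t) ^ (2 * N)) ^ m * ?z a0 \<theta>0)" by (simp add: mult_ac)
  also have "\<dots> \<le> ?w q \<Theta> * ?z a \<Theta>"
    using t by (intro mult_mono W Z mult_nonneg_nonneg prod_list_pmf_nonneg) auto
  finally show ?thesis by (simp add: pmf_documents_split len)
qed

text \<open>
  Taking \<open>t = 1 / m\<close> in \<open>likelihood_ge_near_truth\<close>, the likelihood on balls of radius of order \<open>1 / m\<close>
  around the true parameters is at least a constant times the true likelihood, because \<open>n\<close> is at most
  \<open>c1 * m * N\<close>. The priors and the Dirichlet laws give these balls polynomial mass.
\<close>
lemma evidence_ge: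
  fixes a0 q0 :: "real^'k" and \<theta>0 :: "'k \<Rightarrow> real^'v"
  assumes \<alpha>bar: "0 < \<alpha>bar" and atoms: "exact_atoms a0 \<theta>0" and c0: "0 < c0" "\<And>k v. c0 \<le> \<theta>0 k $ v"
    and \<Pi>\<alpha>: "\<Pi>\<^sub>\<alpha> \<in> space (prob_algebra simplex_borel)" "regular_measure \<Pi>\<^sub>\<alpha>" "a0 \<in> measure_support \<Pi>\<^sub>\<alpha>"
    and \<Pi>\<theta>: "\<Pi>\<^sub>\<theta> \<in> space (prob_algebra simplex_borel)" "regular_measure \<Pi>\<^sub>\<theta>" "\<And>k. \<theta>0 k \<in> measure_support \<Pi>\<^sub>\<theta>"
    and q0: "q0 \<in> prob_simplex"
  obtains c D m0 where "0 < c" "0 < D"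
    "\<And>m n ws ds. m0 \<le> m \<Longrightarrow> real n \<le> c1 * (real m * real N) \<Longrightarrow>
       ennreal (c * real m powr (- D) * likelihood \<alpha>bar N m n a0 \<theta>0 q0 (ws, ds)) \<le> evidence \<alpha>bar \<Pi>\<^sub>\<alpha> \<Pi>\<^sub>\<theta> N m n (ws, ds)"
proof -
  have a0: "a0 \<in> prob_simplex" "\<And>k. 0 < a0 $ k" and \<theta>0: "\<And>k. \<theta>0 k \<in> prob_simplex"
    using atoms by (auto simp: exact_atoms_def)
  define \<mu> where "\<mu> = Min (range (($) a0))"
  have \<mu>: "0 < \<mu>" "\<And>k. \<mu> \<le> a0 $ k"
    unfolding \<mu>_def using a0(2) by (auto simp: Min_gr_iff)
  define K where "K = real CARD('k)"
  have K: "1 \<le> K" unfolding K_def by (simp add: Suc_leI)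
  define V where "V = CARD('v) - 1"
  obtain ca ba where ca: "0 < ca" "0 < ba" "\<And>\<rho>. 0 < \<rho> \<Longrightarrow> \<rho> < ba \<Longrightarrow>
      ennreal (ca * \<rho> ^ (CARD('k) - 1)) \<le> emeasure \<Pi>\<^sub>\<alpha> {\<eta> \<in> prob_simplex. norm (\<eta> - a0) < \<rho>}"
    using prior_ball_mass[OF \<Pi>\<alpha>] by blast
  have "\<exists>c b. 0 < c \<and> 0 < b \<and> (\<forall>\<rho>. 0 < \<rho> \<longrightarrow> \<rho> < b \<longrightarrow>
      ennreal (c * \<rho> ^ V) \<le> emeasure \<Pi>\<^sub>\<theta> {\<eta> \<in> prob_simplex. norm (\<eta> - \<theta>0 k) < \<rho>})" for k
  proof (rule prior_ball_mass[OF \<Pi>\<theta>(1,2) \<Pi>\<theta>(3)[of k]])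
    fix c b :: real
    assume "0 < c" "0 < b" "\<And>\<rho>. 0 < \<rho> \<Longrightarrow> \<rho> < b \<Longrightarrow>
      ennreal (c * \<rho> ^ (CARD('v) - 1)) \<le> emeasure \<Pi>\<^sub>\<theta> {\<eta> \<in> prob_simplex. norm (\<eta> - \<theta>0 k) < \<rho>}"
    then show ?thesis unfolding V_def by (intro exI[of _ c] exI[of _ b]) simp
  qed
  then have "\<forall>k. \<exists>cb. 0 < fst cb \<and> 0 < snd cb \<and> (\<forall>\<rho>. 0 < \<rho> \<longrightarrow> \<rho> < snd cb \<longrightarrow>
      ennreal (fst cb * \<rho> ^ V) \<le> emeasure \<Pi>\<^sub>\<theta> {\<eta> \<in> prob_simplex. norm (\<eta> - \<theta>0 k) < \<rho>})" by simp
  then obtain cb where cb: "\<forall>k. 0 < fst (cb k) \<and> 0 < snd (cb k) \<and> (\<forall>\<rho>. 0 < \<rho> \<longrightarrow> \<rho> < snd (cb k) \<longrightarrow>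
      ennreal (fst (cb k) * \<rho> ^ V) \<le> emeasure \<Pi>\<^sub>\<theta> {\<eta> \<in> prob_simplex. norm (\<eta> - \<theta>0 k) < \<rho>})"
    unfolding choice_iff by blast
  define ct bt where "ct k = fst (cb k)" and "bt k = snd (cb k)" for k
  have ct: "0 < ct k" "0 < bt k" "0 < \<rho> \<Longrightarrow> \<rho> < bt k \<Longrightarrow>
      ennreal (ct k * \<rho> ^ V) \<le> emeasure \<Pi>\<^sub>\<theta> {\<eta> \<in> prob_simplex. norm (\<eta> - \<theta>0 k) < \<rho>}" for k \<rho>
    using cb by (auto simp: ct_def bt_def)
  obtain cd \<beta> where cd: "0 < cd" "0 < \<beta>"
    "\<And>(a::real^'k) q1 \<rho>. a \<in> prob_simplex \<Longrightarrow> (\<And>k. \<mu> / 2 \<le> a $ k) \<Longrightarrow> q1 \<in> prob_simplex \<Longrightarrow> 0 < \<rho> \<Longrightarrow> \<rho> \<le> 1 \<Longrightarrow>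
      ennreal (cd * \<rho> powr \<beta>) \<le> emeasure (dirichlet (\<alpha>bar *\<^sub>R a)) {q \<in> prob_simplex. norm (q - q1) \<le> \<rho>}"
    using dirichlet_ball_mass[OF \<alpha>bar, of "\<mu> / 2"] \<mu>(1) by auto
  (* \<open>r / m\<close> is the radius of the balls: small enough for relative perturbations of size \<open>1 / m\<close> of the
     weights, topics and proportions, and within the range of the bounds on the prior masses. *)
  define r where "r = min (min 1 \<mu>) (min (c0 / K) (min ba (Min (range bt)))) / 2"
  have bt_min: "0 < Min (range bt)" "\<And>k. Min (range bt) \<le> bt k" using ct(2) by (auto simp: Min_gr_iff)
  have r: "0 < r" "r < 1" "r \<le> \<mu>" "K * r \<le> c0" "r < ba" "\<And>k. r < bt k"
  proof -
    show "0 < r" unfolding r_def using \<mu>(1) c0 K ca(2) bt_min by simp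
    let ?x = "min (min 1 \<mu>) (min (c0 / K) (min ba (Min (range bt))))"
    have x: "?x \<le> 1" "?x \<le> \<mu>" "?x \<le> c0 / K" "?x \<le> ba" "?x \<le> Min (range bt)" by linarith+
    have rx: "r = ?x / 2" by (simp add: r_def)
    show "r < 1" "r \<le> \<mu>" "r < ba" using x rx \<open>0 < r\<close> by linarith+
    show "r < bt k" for k using x rx \<open>0 < r\<close> bt_min(2)[of k] by linarith
    have "r \<le> c0 / K" using x rx \<open>0 < r\<close> by linarith
    then show "K * r \<le> c0" using K by (simp add: field_simps)
  qed
  have rc0: "r \<le> c0" using r(4) mult_right_mono[OF K, of r] r(1) by linarith
  define D where "D = \<beta> + real CARD('k) * real V + real (CARD('k) - 1)"
  define c where "c = exp (- 4 * (\<bar>c1\<bar> * real N + real N)) * (cd * r powr \<beta>) * (\<Prod>k\<in>(UNIV::'k set). ct k * r ^ V) * (ca * r ^ (CARD('k) - 1))"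
  show thesis
  proof (rule that[of c D 2])
    show "0 < c" unfolding c_def using cd r ct ca by (intro mult_pos_pos prod_pos) auto
    show "0 < D" unfolding D_def using cd by (intro add_pos_nonneg) auto
    fix m n :: nat and ws :: "'v list" and ds :: "'v list list"
    assume m: "2 \<le> m" and n: "real n \<le> c1 * (real m * real N)"
    define t \<rho> where "t = 1 / real m" and "\<rho> = r / real m"
    have t: "0 < t" "t \<le> 1 / 2" unfolding t_def using m by (auto simp: field_simps)
    have \<rho>t: "\<rho> = r * t" unfolding \<rho>_def t_def by simp
    have \<rho>: "0 < \<rho>" "\<rho> \<le> r" unfolding \<rho>t using r(1) t by (auto simp: mult_left_le)
    let ?L = "likelihood \<alpha>bar N m n"
    let ?A = "{\<eta> \<in> prob_simplex. norm (\<eta> - a0) < \<rho>}"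
    let ?B = "\<lambda>k. {\<eta> \<in> prob_simplex. norm (\<eta> - \<theta>0 k) < \<rho>}"
    let ?Q = "{q \<in> prob_simplex. norm (q - q0) \<le> \<rho>}"
    define x where "x = exp (- 4 * (\<bar>c1\<bar> * real N + real N)) * ?L a0 \<theta>0 q0 (ws, ds)"
    have x: "0 \<le> x" unfolding x_def by simp
    have pointwise: "x \<le> ?L a \<Theta> q (ws, ds)"
      if "a \<in> ?A" "\<And>k. \<Theta> k \<in> ?B k" "q \<in> ?Q" for a \<Theta> q
    proof -
      have "2 * t * (2 * real n + 2 * real N * real m) \<le> 4 * (\<bar>c1\<bar> * real N + real N)"
      proof -
        have "real n \<le> \<bar>c1\<bar> * (real m * real N)" using n by (rule order_trans) (intro mult_right_mono, auto)
        then have "t * real n \<le> t * (\<bar>c1\<bar> * (real m * real N))" using t by (intro mult_left_mono) auto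
        also have "\<dots> = \<bar>c1\<bar> * real N" unfolding t_def using m by simp
        finally have le: "t * real n \<le> \<bar>c1\<bar> * real N" .
        have tN: "t * (real N * real m) = real N" unfolding t_def using m by simp
        have eq: "2 * t * (2 * real n + 2 * real N * real m) = 4 * (t * real n) + 4 * (t * (real N * real m))"
          by (simp add: algebra_simps)
        show ?thesis
          unfolding eq tN distrib_left[of 4 "\<bar>c1\<bar> * real N"]
          by (intro add_mono mult_left_mono le) auto
      qed
      then have "x \<le> exp (- 2 * t * (2 * real n + 2 * real N * real m)) * ?L a0 \<theta>0 q0 (ws, ds)"
        unfolding x_def by (intro mult_right_mono) auto
      also have "\<dots> \<le> ?L a \<Theta> q (ws, ds)"
      proof (rule likelihood_ge_near_truth[OF \<alpha>bar a0(1) \<theta>0 q0 c0 \<mu>(2), where t=t and \<rho>=\<rho>])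
        show "\<rho> \<le> t * \<mu>" "\<rho> \<le> t * c0" unfolding \<rho>t using r rc0 t by (auto simp: mult.commute)
        show "real CARD('k) * \<rho> \<le> t * c0" unfolding \<rho>t K_def[symmetric] using mult_left_mono[OF r(4), of t] t by (simp add: mult_ac)
      qed (use that t in \<open>auto intro: less_imp_le\<close>)
      finally show ?thesis .
    qed
    have dens: "ennreal (x * (cd * \<rho> powr \<beta>)) \<le> (\<integral>\<^sup>+ q. ennreal (?L a \<Theta> q (ws, ds)) \<partial>dirichlet (\<alpha>bar *\<^sub>R a))"
      if a: "a \<in> ?A" and \<Theta>: "\<And>k. \<Theta> k \<in> ?B k" for a \<Theta>
    proof -
      have as: "a \<in> prob_simplex" using a by simp
      have ak: "\<mu> / 2 \<le> a $ k" for k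
      proof -
        have "\<rho> \<le> \<mu> / 2" unfolding \<rho>t using mult_mono[OF r(3) t(2)] t \<mu> by simp
        then show ?thesis using abs_nth_le_norm[of a a0 \<rho> k] a \<mu>(2)[of k] by auto
      qed
      have [measurable]: "?Q \<in> sets borel" by measurable
      have "ennreal (x * (cd * \<rho> powr \<beta>)) = ennreal x * ennreal (cd * \<rho> powr \<beta>)" using x by (simp add: ennreal_mult')
      also have "\<dots> \<le> ennreal x * emeasure (dirichlet (\<alpha>bar *\<^sub>R a)) ?Q"
        using \<rho> r by (intro mult_left_mono cd(3) as ak q0) auto
      also have "\<dots> = (\<integral>\<^sup>+ q. ennreal x * indicator ?Q q \<partial>dirichlet (\<alpha>bar *\<^sub>R a))"
        by (subst nn_integral_cmult_indicator) (auto simp: sets_dirichlet_scaled[OF \<alpha>bar as] sets_restrict_space_iff)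
      also have "\<dots> \<le> (\<integral>\<^sup>+ q. ennreal (?L a \<Theta> q (ws, ds)) \<partial>dirichlet (\<alpha>bar *\<^sub>R a))"
        by (intro nn_integral_mono) (auto simp: indicator_def intro!: ennreal_leI pointwise a \<Theta>)
      finally show ?thesis .
    qed
    define y where "y = x * (cd * \<rho> powr \<beta>)"
    have y: "0 \<le> y" unfolding y_def using x cd by simp
    define P where "P = (\<Prod>k\<in>(UNIV::'k set). ct k * \<rho> ^ V)"
    have P: "0 \<le> P" unfolding P_def using ct(1) \<rho> by (intro prod_nonneg) (auto intro: less_imp_le)
    note sets_pr = sets_priors[OF \<alpha>bar \<Pi>\<alpha>(1) \<Pi>\<theta>(1)]
    have B_sets: "?B k \<in> sets \<Pi>\<^sub>\<theta>" for k
    proof -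
      have "?B k \<in> sets borel" by measurable
      then show ?thesis unfolding sets_pr by (subst sets_restrict_space_iff) auto
    qed
    have A_sets: "?A \<in> sets \<Pi>\<^sub>\<alpha>"
    proof -
      have "?A \<in> sets borel" by measurable
      then show ?thesis unfolding sets_pr by (subst sets_restrict_space_iff) auto
    qed
    interpret \<Pi>\<theta>: prob_space \<Pi>\<^sub>\<theta> using \<Pi>\<theta>(1) by (simp add: space_prob_algebra)
    interpret product_sigma_finite "\<lambda>_::'k. \<Pi>\<^sub>\<theta>" by standard
    have topics: "ennreal (y * P) \<le> (\<integral>\<^sup>+ \<Theta>. \<integral>\<^sup>+ q. ennreal (?L a \<Theta> q (ws, ds)) \<partial>dirichlet (\<alpha>bar *\<^sub>R a) \<partial>(\<Pi>\<^sub>M k\<in>UNIV. \<Pi>\<^sub>\<theta>))"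
      if a: "a \<in> ?A" for a
    proof -
      have "P \<le> (\<Prod>k\<in>(UNIV::'k set). \<Pi>\<theta>.prob (?B k))"
        unfolding P_def
      proof (rule prod_mono, intro conjI)
        fix k
        show "0 \<le> ct k * \<rho> ^ V" using ct(1)[of k] \<rho> by simp
        have "\<rho> < bt k" using \<rho>(2) r(6)[of k] by linarith
        then show "ct k * \<rho> ^ V \<le> \<Pi>\<theta>.prob (?B k)"
          using ct(3)[of \<rho> k] \<rho>(1) by (simp add: \<Pi>\<theta>.emeasure_eq_measure)
      qed
      then have "ennreal P \<le> ennreal (\<Prod>k\<in>(UNIV::'k set). \<Pi>\<theta>.prob (?B k))" by (rule ennreal_leI)
      also have "\<dots> = (\<Prod>k\<in>(UNIV::'k set). emeasure \<Pi>\<^sub>\<theta> (?B k))"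
        by (simp add: \<Pi>\<theta>.emeasure_eq_measure prod_ennreal)
      also have "\<dots> = emeasure (\<Pi>\<^sub>M k\<in>UNIV. \<Pi>\<^sub>\<theta>) (\<Pi>\<^sub>E k\<in>UNIV. ?B k)"
        by (rule emeasure_PiM[symmetric]) (auto intro: B_sets)
      finally have "ennreal (y * P) \<le> ennreal y * emeasure (\<Pi>\<^sub>M k\<in>UNIV. \<Pi>\<^sub>\<theta>) (\<Pi>\<^sub>E k\<in>UNIV. ?B k)"
        unfolding ennreal_mult'[OF y] by (intro mult_left_mono) auto
      also have "\<dots> = (\<integral>\<^sup>+ \<Theta>. ennreal y * indicator (\<Pi>\<^sub>E k\<in>UNIV. ?B k) \<Theta> \<partial>(\<Pi>\<^sub>M k\<in>UNIV. \<Pi>\<^sub>\<theta>))"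
        by (subst nn_integral_cmult_indicator) (auto intro!: sets_PiM_I_finite B_sets)
      also have "\<dots> \<le> (\<integral>\<^sup>+ \<Theta>. \<integral>\<^sup>+ q. ennreal (?L a \<Theta> q (ws, ds)) \<partial>dirichlet (\<alpha>bar *\<^sub>R a) \<partial>(\<Pi>\<^sub>M k\<in>UNIV. \<Pi>\<^sub>\<theta>))"
      proof (rule nn_integral_mono)
        fix \<Theta>
        show "ennreal y * indicator (\<Pi>\<^sub>E k\<in>UNIV. ?B k) \<Theta> \<le> (\<integral>\<^sup>+ q. ennreal (?L a \<Theta> q (ws, ds)) \<partial>dirichlet (\<alpha>bar *\<^sub>R a))"
        proof (cases "\<Theta> \<in> (\<Pi>\<^sub>E k\<in>UNIV. ?B k)")
          case True
          then have "\<Theta> k \<in> ?B k" for k by (rule PiE_mem) simp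
          then show ?thesis using dens[OF a, of \<Theta>] True by (simp add: y_def)
        qed simp
      qed
      finally show ?thesis .
    qed
    define z where "z = y * P"
    have z: "0 \<le> z" unfolding z_def using y P by simp
    have "ennreal (z * (ca * \<rho> ^ (CARD('k) - 1))) = ennreal z * ennreal (ca * \<rho> ^ (CARD('k) - 1))"
      using z by (simp add: ennreal_mult')
    also have "\<dots> \<le> ennreal z * emeasure \<Pi>\<^sub>\<alpha> ?A"
      using \<rho> r(5) by (intro mult_left_mono ca(3)) auto
    also have "\<dots> = (\<integral>\<^sup>+ a. ennreal z * indicator ?A a \<partial>\<Pi>\<^sub>\<alpha>)"
      by (subst nn_integral_cmult_indicator[OF A_sets]) simp
    also have "\<dots> \<le> evidence \<alpha>bar \<Pi>\<^sub>\<alpha> \<Pi>\<^sub>\<theta> N m n (ws, ds)"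
      using topics by (intro nn_integral_mono) (auto simp: indicator_def z_def)
    also have "z * (ca * \<rho> ^ (CARD('k) - 1)) = c * real m powr (- D) * ?L a0 \<theta>0 q0 (ws, ds)"
    proof -
      have mp: "0 < real m" using m by simp
      have 1: "\<rho> powr \<beta> = r powr \<beta> * real m powr (- \<beta>)"
        unfolding \<rho>_def using r mp by (simp add: powr_divide powr_minus_divide)
      have 2: "\<rho> ^ j = r ^ j * real m powr (- real j)" for j
        unfolding \<rho>_def using r mp by (simp add: power_divide powr_minus_divide powr_realpow)
      have 3: "P = (\<Prod>k\<in>(UNIV::'k set). ct k * r ^ V) * real m powr (- (real CARD('k) * real V))"
      proof -
        have "P = (\<Prod>k\<in>(UNIV::'k set). (ct k * r ^ V) * real m powr (- real V))"
          unfolding P_def 2 by (simp add: mult.assoc)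
        also have "\<dots> = (\<Prod>k\<in>(UNIV::'k set). ct k * r ^ V) * (real m powr (- real V)) ^ CARD('k)"
          unfolding prod.distrib[of "\<lambda>k. ct k * r ^ V"] by simp
        also have "(real m powr (- real V)) ^ CARD('k) = real m powr (- (real CARD('k) * real V))"
          using mp by (simp add: powr_powr mult.commute flip: powr_realpow)
        finally show ?thesis .
      qed
      have 4: "real m powr (- D) = real m powr (- \<beta>) * real m powr (- (real CARD('k) * real V)) * real m powr (- real (CARD('k) - 1))"
        unfolding D_def powr_add[symmetric] by (intro arg_cong[where f="\<lambda>x. real m powr x"]) linarith
      show ?thesis unfolding z_def y_def x_def c_def 1 2 3 4 by (simp only: mult_ac)
    qed
    finally show "ennreal (c * real m powr (- D) * ?L a0 \<theta>0 q0 (ws, ds)) \<le> evidence \<alpha>bar \<Pi>\<^sub>\<alpha> \<Pi>\<^sub>\<theta> N m n (ws, ds)" .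
  qed
qed

section \<open>Contraction of the posterior\<close>

text \<open>
  The family dual to the topics recovers the proportions linearly from the law of a word.
\<close>
lemma mixture_separation:
  fixes \<theta>0 :: "'k::finite \<Rightarrow> real^'v"
  assumes "independent (range \<theta>0)" "inj \<theta>0"
  obtains D where "0 < D"
    "\<And>q q' :: real^'k. \<exists>v. norm (q - q') \<le> D * \<bar>\<Sum>k\<in>UNIV. (q $ k - q' $ k) * \<theta>0 k $ v\<bar>"
proof -
  obtain d :: "'k \<Rightarrow> 'v \<Rightarrow> real" where d: "\<And>l k. (\<Sum>v\<in>UNIV. d l v * \<theta>0 k $ v) = (if l = k then 1 else 0)"
    using dual_family[OF assms] by blast
  define D where "D = 1 + (\<Sum>l\<in>UNIV. \<Sum>v\<in>UNIV. \<bar>d l v\<bar>)"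
  have D: "0 < D" unfolding D_def by (intro add_pos_nonneg sum_nonneg) auto
  show thesis
  proof (rule that[OF D])
    fix q q' :: "real^'k"
    let ?f = "\<lambda>v. \<Sum>k\<in>UNIV. (q $ k - q' $ k) * \<theta>0 k $ v"
    have "Max (range (\<lambda>v. \<bar>?f v\<bar>)) \<in> range (\<lambda>v. \<bar>?f v\<bar>)" by (rule Max_in) auto
    then obtain v where "Max (range (\<lambda>v. \<bar>?f v\<bar>)) = \<bar>?f v\<bar>" by (rule imageE)
    moreover have "\<bar>?f u\<bar> \<le> Max (range (\<lambda>v. \<bar>?f v\<bar>))" for u by (rule Max_ge) auto
    ultimately have v: "\<bar>?f u\<bar> \<le> \<bar>?f v\<bar>" for u by (simp only:)
    have coord: "q $ l - q' $ l = (\<Sum>u\<in>UNIV. d l u * ?f u)" for l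
    proof -
      have "(\<Sum>u\<in>UNIV. d l u * ?f u) = (\<Sum>k\<in>UNIV. (q $ k - q' $ k) * (\<Sum>u\<in>UNIV. d l u * \<theta>0 k $ u))"
        unfolding sum_distrib_left by (subst sum.swap) (simp add: mult_ac)
      then show ?thesis unfolding d by (simp add: if_distrib[of "\<lambda>x. _ * x"] cong: if_cong)
    qed
    have "norm (q - q') \<le> (\<Sum>l\<in>UNIV. \<bar>(q - q') $ l\<bar>)" by (rule norm_le_l1_cart)
    also have "\<dots> \<le> (\<Sum>l\<in>UNIV. \<Sum>u\<in>UNIV. \<bar>d l u\<bar> * \<bar>?f v\<bar>)"
    proof (rule sum_mono)
      fix l
      have "\<bar>(q - q') $ l\<bar> \<le> (\<Sum>u\<in>UNIV. \<bar>d l u * ?f u\<bar>)" using coord[of l] by simp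
      also have "\<dots> \<le> (\<Sum>u\<in>UNIV. \<bar>d l u\<bar> * \<bar>?f v\<bar>)"
        unfolding abs_mult by (intro sum_mono mult_left_mono v) auto
      finally show "\<bar>(q - q') $ l\<bar> \<le> \<dots>" .
    qed
    also have "\<dots> \<le> D * \<bar>?f v\<bar>"
      unfolding sum_distrib_right[symmetric] D_def by (intro mult_right_mono) auto
    finally show "\<exists>v. norm (q - q') \<le> D * \<bar>?f v\<bar>" by blast
  qed
qed

lemma perm_dist_le: "\<sigma> permutes UNIV \<Longrightarrow> perm_dist q q' \<le> norm ((\<chi> k. q $ \<sigma> k) - q')" for \<sigma> :: "'k::finite \<Rightarrow> 'k"
  unfolding perm_dist_def by (rule Min_le) (auto simp: finite_permutations)

lemma sets_perm_dist_ge: "{q. R \<le> perm_dist q q'} \<in> sets borel"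
proof -
  let ?S = "{\<tau>. \<tau> permutes (UNIV :: 'a set)}"
  have S: "finite ?S" "?S \<noteq> {}" using permutes_id[of "UNIV :: 'a set"] by (auto simp: finite_permutations simp del: permutes_id)
  have "{q. R \<le> perm_dist q q'} = (\<Inter>\<tau>\<in>?S. {q. R \<le> norm ((\<chi> k. q $ \<tau> k) - q')})"
    using S by (auto simp: perm_dist_def Min_ge_iff)
  also have "\<dots> \<in> sets borel"
  proof (rule sets.finite_INT[OF S])
    fix \<tau> :: "'a \<Rightarrow> 'a"
    have [measurable]: "(\<lambda>q::real^'a. (\<chi> k. q $ \<tau> k) :: real^'a) \<in> borel_measurable borel"
      unfolding borel_measurable_vec_iff by simp
    show "{q. R \<le> norm ((\<chi> k. q $ \<tau> k) - q')} \<in> sets borel" by measurable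
  qed
  finally show ?thesis .
qed

text \<open>
  The mixing measure is fixed and close to the truth up to the permutation \<open>\<sigma>\<close>. The documents contribute
  the same factor to both sides, so only the \<open>n\<close> words matter. In the numerator the word laws are
  separated by \<open>mixture_separation\<close>, the error \<open>\<zeta>\<close> in the topics using up at most half of the separation.
  The denominator is restricted to proportions within \<open>\<rho>\<close> of the permuted true ones, whose word laws
  are within \<open>K * \<rho> + \<zeta>\<close> of the true one.
\<close>
lemma conditional_posterior_bound:
  fixes a q0 :: "real^'k" and \<theta>0 \<Theta> :: "'k \<Rightarrow> real^'v"
  assumes \<alpha>bar: "0 < \<alpha>bar" and a: "a \<in> prob_simplex" and \<Theta>: "\<And>k. \<Theta> k \<in> prob_simplex"
    and \<theta>0: "\<And>k. \<theta>0 k \<in> prob_simplex" and c0: "0 < c0" "\<And>k v. c0 \<le> \<theta>0 k $ v" and q0: "q0 \<in> prob_simplex"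
    and \<sigma>: "\<sigma> permutes UNIV" and \<zeta>: "\<And>l v. \<bar>\<Theta> (\<sigma> l) $ v - \<theta>0 l $ v\<bar> \<le> \<zeta>"
    and sep: "0 < D" "\<And>q q' :: real^'k. \<exists>v. norm (q - q') \<le> D * \<bar>\<Sum>k\<in>UNIV. (q $ k - q' $ k) * \<theta>0 k $ v\<bar>"
    and mass: "0 < c" "\<And>q1. q1 \<in> prob_simplex \<Longrightarrow> ennreal c \<le> emeasure (dirichlet (\<alpha>bar *\<^sub>R a)) {q \<in> prob_simplex. norm (q - q1) \<le> \<rho>}"
    and data: "length ws = n" "0 < n" "pearson (multi (\<Sum>k\<in>UNIV. q0 $ k *\<^sub>R \<theta>0 k)) ws \<le> L" "length ds = m"
    and R: "2 * D * \<zeta> \<le> R" and \<rho>: "0 \<le> \<rho>" "2 * (real CARD('k) * \<rho> + \<zeta>) \<le> c0"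
  shows "(\<integral>\<^sup>+ q. indicator {q. R \<le> perm_dist q q0} q * ennreal (likelihood \<alpha>bar N m n a \<Theta> q (ws, ds)) \<partial>dirichlet (\<alpha>bar *\<^sub>R a)) \<le>
    ennreal (exp (2 * L - real n / 8 * (R / (2 * D))\<^sup>2) *
      exp (L + real n * ((real CARD('k) * \<rho> + \<zeta>) / c0)\<^sup>2 * (real CARD('v) + 2)) / c) *
    (\<integral>\<^sup>+ q. ennreal (likelihood \<alpha>bar N m n a \<Theta> q (ws, ds)) \<partial>dirichlet (\<alpha>bar *\<^sub>R a))"
proof -
  define K where "K = real CARD('k)"
  define p0 where "p0 = multi (\<Sum>k\<in>UNIV. q0 $ k *\<^sub>R \<theta>0 k)"
  define p where "p q = multi (\<Sum>k\<in>UNIV. q $ k *\<^sub>R \<Theta> k)" for q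
  define W where "W q = prod_list (map (pmf (p q)) ws)" for q
  define W0 where "W0 = prod_list (map (pmf p0) ws)"
  define Z where "Z = prod_list (map (pmf (lda_pmf \<alpha>bar N a \<Theta>)) ds)"
  have W0: "0 \<le> W0" and Z: "0 \<le> Z" unfolding W0_def Z_def by (rule prod_list_pmf_nonneg)+
  have lik: "likelihood \<alpha>bar N m n a \<Theta> q (ws, ds) = W q * Z" for q
    using data by (simp add: pmf_documents_split W_def Z_def p_def)
  have \<zeta>0: "0 \<le> \<zeta>" using \<zeta>[of undefined undefined] by linarith
  have pmf_p0: "pmf p0 v = (\<Sum>k\<in>UNIV. q0 $ k * \<theta>0 k $ v)" for v
    unfolding p0_def by (rule pmf_multi_mixture[OF q0 \<theta>0])
  have p0_ge: "c0 \<le> pmf p0 v" for v unfolding pmf_p0 by (intro mixture_ge q0 c0)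
  have set_p0: "set_pmf p0 = UNIV"
    using p0_ge c0(1) by (auto simp: set_pmf_iff) (metis less_le_not_le)
  have ws: "ws \<noteq> []" using data by auto
  have pmf_p: "pmf (p q) v = (\<Sum>l\<in>UNIV. q $ \<sigma> l * \<Theta> (\<sigma> l) $ v)" if "q \<in> prob_simplex" for q v
    unfolding p_def pmf_multi_mixture[OF that \<Theta>]
    using sum.permute[OF \<sigma>, of "\<lambda>k. q $ k * \<Theta> k $ v"] by (simp add: o_def)
  have diff: "pmf (p q) v - pmf p0 v = (\<Sum>l\<in>UNIV. (q $ \<sigma> l - q0 $ l) * \<theta>0 l $ v) + (\<Sum>l\<in>UNIV. q $ \<sigma> l * (\<Theta> (\<sigma> l) $ v - \<theta>0 l $ v))"
    if "q \<in> prob_simplex" for q v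
    unfolding pmf_p[OF that] pmf_p0 sum.distrib[symmetric] sum_subtractf[symmetric]
    by (intro sum.cong) (simp_all add: algebra_simps)
  have topics: "\<bar>\<Sum>l\<in>UNIV. q $ \<sigma> l * (\<Theta> (\<sigma> l) $ v - \<theta>0 l $ v)\<bar> \<le> \<zeta>" if q: "q \<in> prob_simplex" for q v
  proof -
    have "\<bar>\<Sum>l\<in>UNIV. q $ \<sigma> l * (\<Theta> (\<sigma> l) $ v - \<theta>0 l $ v)\<bar> \<le> (\<Sum>l\<in>UNIV. q $ \<sigma> l * \<zeta>)"
      using prob_simplexD(1)[OF q] \<zeta>
      by (intro order_trans[OF sum_abs] sum_mono) (simp add: abs_mult mult_left_mono)
    also have "\<dots> = (\<Sum>l\<in>UNIV. q $ \<sigma> l) * \<zeta>" by (simp add: sum_distrib_right)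
    also have "(\<Sum>l\<in>UNIV. q $ \<sigma> l) = 1"
      using sum.permute[OF \<sigma>, of "\<lambda>k. q $ k"] prob_simplexD(2)[OF q] by (simp add: o_def)
    finally show ?thesis by simp
  qed
  have R0: "0 \<le> R" using R sep(1) \<zeta>0 by (meson mult_nonneg_nonneg less_imp_le order_trans zero_le_numeral)
  have upper: "W q \<le> W0 * exp (2 * L - real n / 8 * (R / (2 * D))\<^sup>2)"
    if q: "q \<in> prob_simplex" and far: "R \<le> perm_dist q q0" for q
  proof -
    obtain v where v: "norm ((\<chi> k. q $ \<sigma> k) - q0) \<le> D * \<bar>\<Sum>k\<in>UNIV. (q $ \<sigma> k - q0 $ k) * \<theta>0 k $ v\<bar>"
      using sep(2)[of "\<chi> k. q $ \<sigma> k" q0] by auto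
    have "R \<le> D * \<bar>\<Sum>k\<in>UNIV. (q $ \<sigma> k - q0 $ k) * \<theta>0 k $ v\<bar>"
      using far perm_dist_le[OF \<sigma>, of q q0] v by linarith
    then have "R / D \<le> \<bar>\<Sum>k\<in>UNIV. (q $ \<sigma> k - q0 $ k) * \<theta>0 k $ v\<bar>" using sep(1) by (simp add: field_simps)
    moreover have "\<zeta> \<le> R / D / 2" using R sep(1) by (simp add: field_simps)
    moreover have "x / 2 \<le> \<bar>e\<bar>" if "x \<le> \<bar>s\<bar>" "\<zeta> \<le> x / 2" "e = s + t" "\<bar>t\<bar> \<le> \<zeta>" for x s t e
      using that by linarith
    ultimately have "R / D / 2 \<le> \<bar>pmf (p q) v - pmf p0 v\<bar>"
      using diff[OF q, of v] topics[OF q, of v] by blast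
    then have "(R / (2 * D))\<^sup>2 \<le> \<bar>pmf (p q) v - pmf p0 v\<bar>\<^sup>2"
      using R0 sep(1) by (intro power_mono) (auto simp: field_simps)
    also have "\<dots> = (pmf (p q) v - pmf p0 v)\<^sup>2" by simp
    also have "\<dots> \<le> (\<Sum>v\<in>set_pmf p0. (pmf (p q) v - pmf p0 v)\<^sup>2)"
      unfolding set_p0 by (rule member_le_sum) auto
    finally have sq: "real n / 8 * (R / (2 * D))\<^sup>2 \<le> real n / 8 * (\<Sum>v\<in>set_pmf p0. (pmf (p q) v - pmf p0 v)\<^sup>2)"
      by (intro mult_left_mono) auto
    have "W q \<le> W0 * exp (2 * pearson p0 ws - real n / 8 * (\<Sum>v\<in>set_pmf p0. (pmf (p q) v - pmf p0 v)\<^sup>2))"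
      unfolding W_def W0_def data(1)[symmetric]
      by (rule likelihood_ratio_le) (auto simp: set_p0 ws)
    also have "\<dots> \<le> W0 * exp (2 * L - real n / 8 * (R / (2 * D))\<^sup>2)"
      using sq data(3) W0 by (intro mult_left_mono) (auto simp: p0_def[symmetric])
    finally show ?thesis .
  qed
  define q1 :: "real^'k" where "q1 = (\<chi> k. q0 $ inv \<sigma> k)"
  have q1\<sigma>: "q1 $ \<sigma> l = q0 $ l" for l
    unfolding q1_def using permutes_inverses(2)[OF \<sigma>] by simp
  have q1: "q1 \<in> prob_simplex"
  proof -
    have "(\<Sum>k\<in>UNIV. q0 $ inv \<sigma> k) = 1"
      using sum.permute[OF permutes_inv[OF \<sigma>], of "\<lambda>k. q0 $ k"] prob_simplexD(2)[OF q0] by (simp add: o_def)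
    then show ?thesis using prob_simplexD(1)[OF q0] by (auto simp: prob_simplex_def q1_def)
  qed
  define E where "E = L + real n * ((K * \<rho> + \<zeta>) / c0)\<^sup>2 * (real CARD('v) + 2)"
  have lower: "W0 * exp (- E) \<le> W q"
    if q: "q \<in> prob_simplex" and near: "norm (q - q1) \<le> \<rho>" for q
  proof -
    have close: "\<bar>pmf (p q) v - pmf p0 v\<bar> \<le> K * \<rho> + \<zeta>" for v
    proof -
      have "\<bar>\<Sum>l\<in>UNIV. (q $ \<sigma> l - q0 $ l) * \<theta>0 l $ v\<bar> \<le> K * \<rho>"
        unfolding K_def
      proof (rule abs_sum_le_card)
        fix l
        have "\<bar>q $ \<sigma> l - q0 $ l\<bar> \<le> \<rho>" using abs_nth_le_norm[OF near, of "\<sigma> l"] by (simp add: q1\<sigma>)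
        then have "\<bar>q $ \<sigma> l - q0 $ l\<bar> * \<bar>\<theta>0 l $ v\<bar> \<le> \<rho> * 1"
          using abs_prob_simplex_le[OF \<theta>0] \<rho> by (intro mult_mono) auto
        then show "\<bar>(q $ \<sigma> l - q0 $ l) * \<theta>0 l $ v\<bar> \<le> \<rho>" by (simp add: abs_mult)
      qed
      then show ?thesis using diff[OF q, of v] topics[OF q, of v] by linarith
    qed
    have "W0 * exp (- (pearson p0 ws + real n * ((K * \<rho> + \<zeta>) / c0)\<^sup>2 * (real (card (set_pmf p0)) + 2))) \<le> W q"
      unfolding W_def W0_def data(1)[symmetric]
      by (rule likelihood_ratio_ge) (use p0_ge c0 close \<rho> in \<open>auto simp: set_p0 ws K_def\<close>)
    moreover have "W0 * exp (- E) \<le> W0 * exp (- (pearson p0 ws + real n * ((K * \<rho> + \<zeta>) / c0)\<^sup>2 * (real (card (set_pmf p0)) + 2)))"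
      using data(3) W0 unfolding E_def set_p0 p0_def[symmetric] by (intro mult_left_mono) auto
    ultimately show ?thesis by linarith
  qed
  interpret prob_space "dirichlet (\<alpha>bar *\<^sub>R a)" by (rule prob_space_dirichlet_scaled[OF \<alpha>bar a])
  let ?U = "W0 * exp (2 * L - real n / 8 * (R / (2 * D))\<^sup>2) * Z"
  let ?Q = "{q \<in> prob_simplex. norm (q - q1) \<le> \<rho>}"
  have "(\<integral>\<^sup>+ q. indicator {q. R \<le> perm_dist q q0} q * ennreal (likelihood \<alpha>bar N m n a \<Theta> q (ws, ds)) \<partial>dirichlet (\<alpha>bar *\<^sub>R a)) \<le>
    (\<integral>\<^sup>+ q. ennreal ?U \<partial>dirichlet (\<alpha>bar *\<^sub>R a))"
  proof (rule nn_integral_mono)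
    fix q assume "q \<in> space (dirichlet (\<alpha>bar *\<^sub>R a))"
    then have "q \<in> prob_simplex" by (simp add: space_dirichlet_scaled[OF \<alpha>bar a])
    then show "indicator {q. R \<le> perm_dist q q0} q * ennreal (likelihood \<alpha>bar N m n a \<Theta> q (ws, ds)) \<le> ennreal ?U"
      unfolding lik using upper[of q] Z by (auto simp: indicator_def intro!: ennreal_leI mult_right_mono)
  qed
  also have "\<dots> = ennreal ?U" by (simp add: emeasure_space_1)
  also have "?U = (exp (2 * L - real n / 8 * (R / (2 * D))\<^sup>2) * exp E / c) * (W0 * exp (- E) * Z * c)"
    using mass(1) by (simp add: exp_minus field_simps)
  also have "ennreal \<dots> = ennreal (exp (2 * L - real n / 8 * (R / (2 * D))\<^sup>2) * exp E / c) * ennreal (W0 * exp (- E) * Z * c)"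
    using mass(1) by (intro ennreal_mult') auto
  also have "\<dots> \<le> ennreal (exp (2 * L - real n / 8 * (R / (2 * D))\<^sup>2) * exp E / c) *
    (\<integral>\<^sup>+ q. ennreal (likelihood \<alpha>bar N m n a \<Theta> q (ws, ds)) \<partial>dirichlet (\<alpha>bar *\<^sub>R a))"
  proof (rule mult_left_mono)
    have [measurable]: "?Q \<in> sets borel" by measurable
    have "ennreal (W0 * exp (- E) * Z * c) = ennreal (W0 * exp (- E) * Z) * ennreal c"
      using W0 Z by (intro ennreal_mult') auto
    also have "\<dots> \<le> ennreal (W0 * exp (- E) * Z) * emeasure (dirichlet (\<alpha>bar *\<^sub>R a)) ?Q"
      by (intro mult_left_mono mass(2) q1) auto
    also have "\<dots> = (\<integral>\<^sup>+ q. ennreal (W0 * exp (- E) * Z) * indicator ?Q q \<partial>dirichlet (\<alpha>bar *\<^sub>R a))"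
      by (subst nn_integral_cmult_indicator) (auto simp: sets_dirichlet_scaled[OF \<alpha>bar a] sets_restrict_space_iff)
    also have "\<dots> \<le> (\<integral>\<^sup>+ q. ennreal (likelihood \<alpha>bar N m n a \<Theta> q (ws, ds)) \<partial>dirichlet (\<alpha>bar *\<^sub>R a))"
      unfolding lik using Z by (intro nn_integral_mono) (auto simp: indicator_def intro!: ennreal_leI mult_right_mono lower)
    finally show "ennreal (W0 * exp (- E) * Z * c) \<le> \<dots>" .
  qed simp
  finally show ?thesis unfolding E_def K_def .
qed

text \<open>
  \<open>ln x / x\<close> is essentially decreasing, and \<open>n \<le> g * m\<close>.
\<close>
lemma ln_ratio_le:
  fixes g :: real and m n :: nat
  assumes n: "3 \<le> n" and m: "1 \<le> m" and g: "1 \<le> g" and le: "real n \<le> g * real m"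
  shows "ln (real m) / real m \<le> 2 * g * (ln (real n) / real n)"
proof -
  have ln_n: "1 \<le> ln (real n)"
    using n exp_le by (subst ln_ge_iff) linarith+
  have pos: "0 < real n" "0 < real m" "0 < g" "0 < g * real m" using n m g by auto
  have "ln (g * real m) = ln (real n) + ln (g * real m / real n)"
    using pos by (simp add: ln_div)
  also have "ln (g * real m / real n) \<le> g * real m / real n - 1"
    using pos by (intro ln_le_minus_one) simp
  finally have "real n * ln (g * real m) \<le> real n * (ln (real n) + (g * real m / real n - 1))"
    by (intro mult_left_mono) auto
  also have "\<dots> = real n * ln (real n) + g * real m - real n" using pos by (simp add: field_simps)
  also have "\<dots> \<le> g * real m * ln (real n) + g * real m * ln (real n)"
  proof -
    have "real n * ln (real n) \<le> g * real m * ln (real n)" using le ln_n by (intro mult_right_mono) auto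
    moreover have "g * real m * 1 \<le> g * real m * ln (real n)" using pos ln_n by (intro mult_left_mono) auto
    ultimately show ?thesis using pos by linarith
  qed
  finally have "real n * ln (g * real m) \<le> 2 * g * real m * ln (real n)" by simp
  moreover have "real n * ln (real m) \<le> real n * ln (g * real m)"
    using pos g by (intro mult_left_mono) (auto simp: mult_le_cancel_right1)
  ultimately have "real n * ln (real m) \<le> 2 * g * real m * ln (real n)" by linarith
  then show ?thesis using pos by (simp add: field_simps)
qed

text \<open>
  As \<open>n * \<rho>^2 = ln n\<close>, all exponents are multiples of \<open>ln n\<close>: the gain \<open>C^2 / (32 D^2)\<close> from the separation
  \<open>R \<ge> C * \<rho>\<close> must exceed the losses from the denominator and the Dirichlet mass by 1.
\<close>
lemma conditional_exponent_le:
  fixes n :: nat and R \<rho> \<zeta> K c0 L C b D V c \<beta> :: real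
  assumes n: "3 \<le> n" and \<rho>: "\<rho> = sqrt (ln (real n) / real n)"
    and D: "0 < D" and C: "0 \<le> C" and R: "C * \<rho> \<le> R" and \<zeta>: "0 \<le> \<zeta>" "\<zeta> \<le> b * \<rho>" and K: "0 \<le> K" and c0: "0 < c0" and V: "0 \<le> V"
    and c: "0 < c" and \<beta>: "0 < \<beta>"
    and C_large: "((K + b) / c0)\<^sup>2 * V + \<beta> / 2 + 1 \<le> C\<^sup>2 / (32 * D\<^sup>2)"
  shows "exp (2 * L - real n / 8 * (R / (2 * D))\<^sup>2) * exp (L + real n * ((K * \<rho> + \<zeta>) / c0)\<^sup>2 * V) / (c * \<rho> powr \<beta>)
    \<le> exp (3 * L) / c / real n"
proof -
  let ?l = "ln (real n)"
  have l: "1 \<le> ?l" using n exp_le by (subst ln_ge_iff) linarith+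
  have np: "0 < real n" using n by simp
  have \<rho>_pos: "0 < \<rho>" unfolding \<rho> using l np by (intro real_sqrt_gt_zero divide_pos_pos) linarith+
  have n\<rho>: "real n * \<rho>\<^sup>2 = ?l" unfolding \<rho> using l np by simp
  have 1: "C\<^sup>2 / (32 * D\<^sup>2) * ?l \<le> real n / 8 * (R / (2 * D))\<^sup>2"
  proof -
    have "C\<^sup>2 / (32 * D\<^sup>2) * ?l = real n / 8 * (C * \<rho> / (2 * D))\<^sup>2"
      unfolding n\<rho>[symmetric] by (simp add: power_divide power_mult_distrib)
    also have "\<dots> \<le> real n / 8 * (R / (2 * D))\<^sup>2"
      using R C \<rho>_pos D by (intro mult_left_mono power_mono divide_right_mono) auto
    finally show ?thesis .
  qed
  have 2: "real n * ((K * \<rho> + \<zeta>) / c0)\<^sup>2 * V \<le> ((K + b) / c0)\<^sup>2 * V * ?l"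
  proof -
    have "((K * \<rho> + \<zeta>) / c0)\<^sup>2 \<le> ((K + b) * \<rho> / c0)\<^sup>2"
      using \<zeta> K \<rho>_pos c0 by (intro power_mono divide_right_mono) (auto simp: algebra_simps)
    then have "real n * ((K * \<rho> + \<zeta>) / c0)\<^sup>2 * V \<le> real n * ((K + b) * \<rho> / c0)\<^sup>2 * V"
      using V by (intro mult_right_mono mult_left_mono) auto
    also have "\<dots> = ((K + b) / c0)\<^sup>2 * V * ?l"
      unfolding n\<rho>[symmetric] by (simp add: power_divide power_mult_distrib)
    finally show ?thesis .
  qed
  have 3: "exp (- (\<beta> / 2 * ?l)) \<le> \<rho> powr \<beta>"
  proof -
    have "exp (- (\<beta> / 2 * ?l)) = (1 / real n) powr (\<beta> / 2)"
      using np by (simp add: powr_def ln_div)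
    also have "\<dots> \<le> (?l / real n) powr (\<beta> / 2)"
      using \<beta> l np by (intro powr_mono2 divide_right_mono) auto
    also have "\<dots> = \<rho> powr \<beta>"
      unfolding \<rho> using l np by (simp add: powr_half_sqrt[symmetric] powr_powr)
    finally show ?thesis .
  qed
  have "exp (2 * L - real n / 8 * (R / (2 * D))\<^sup>2) * exp (L + real n * ((K * \<rho> + \<zeta>) / c0)\<^sup>2 * V) =
      exp (3 * L - real n / 8 * (R / (2 * D))\<^sup>2 + real n * ((K * \<rho> + \<zeta>) / c0)\<^sup>2 * V)"
    by (simp add: exp_add[symmetric])
  also have "\<dots> \<le> exp (3 * L + - (\<beta> / 2 * ?l) + - ?l)"
  proof -
    have "(((K + b) / c0)\<^sup>2 * V + \<beta> / 2 + 1) * ?l \<le> C\<^sup>2 / (32 * D\<^sup>2) * ?l"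
      using C_large l by (intro mult_right_mono) auto
    then have "((K + b) / c0)\<^sup>2 * V * ?l + \<beta> / 2 * ?l + ?l \<le> C\<^sup>2 / (32 * D\<^sup>2) * ?l"
      by (simp only: distrib_right mult_1)
    moreover have "3 * L - x + y \<le> 3 * L + - v + - ?l" if "u + v + ?l \<le> w" "w \<le> x" "y \<le> u" for u v w x y :: real
      using that by linarith
    ultimately show ?thesis using 1 2 unfolding exp_le_cancel_iff by blast
  qed
  also have "\<dots> = exp (3 * L) * exp (- (\<beta> / 2 * ?l)) * (1 / real n)"
    unfolding exp_add using np by (simp add: exp_minus inverse_eq_divide)
  also have "\<dots> \<le> exp (3 * L) * \<rho> powr \<beta> * (1 / real n)"
    using 3 by (intro mult_right_mono mult_left_mono) auto
  finally have "exp (2 * L - real n / 8 * (R / (2 * D))\<^sup>2) * exp (L + real n * ((K * \<rho> + \<zeta>) / c0)\<^sup>2 * V) / (c * \<rho> powr \<beta>)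
    \<le> exp (3 * L) * \<rho> powr \<beta> * (1 / real n) / (c * \<rho> powr \<beta>)"
    using c by (intro divide_right_mono) auto
  also have "\<dots> = exp (3 * L) / c / real n" using \<rho>_pos by simp
  finally show ?thesis .
qed

lemma eventually_regime_iff:
  "eventually P (regime c N) \<longleftrightarrow> (\<exists>M. \<forall>m\<ge>M. \<forall>n\<ge>M. real n \<le> c * (real m * real N) \<longrightarrow> P (m, n))"
  unfolding regime_def eventually_inf_principal eventually_prod_sequentially
  by auto

lemma eventually_regime_fst: "eventually P sequentially \<Longrightarrow> \<forall>\<^sub>F x in regime c N. P (fst x)"
  unfolding eventually_regime_iff eventually_sequentially by (metis fst_conv)

lemma eventually_regime_snd: "eventually P sequentially \<Longrightarrow> \<forall>\<^sub>F x in regime c N. P (snd x)"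
  unfolding eventually_regime_iff eventually_sequentially by (metis snd_conv)

lemma eventually_regime_le: "\<forall>\<^sub>F x in regime c N. real (snd x) \<le> c * (real (fst x) * real N)"
  unfolding eventually_regime_iff by simp

text \<open>
  The law of a document either differs from the true one by more than \<open>\<eta> = M * sqrt (ln m / m)\<close> at some
  document, or by at most \<open>\<eta>\<close> at all of them. In the first case the documents alone make the likelihood
  small compared with the evidence; in the second, identifiability places the mixing measure near the
  true one and \<open>conditional_posterior_bound\<close> applies.
\<close>
lemma posterior_le_on_typical_data:
  fixes a0 q0 :: "real^'k" and \<theta>0 :: "'k \<Rightarrow> real^'v"
    and \<alpha>bar c0 c1 :: real and N :: nat
    and \<Pi>\<^sub>\<alpha> :: "(real^'k) measure" and \<Pi>\<^sub>\<theta> :: "(real^'v) measure"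
    and C :: "nat \<Rightarrow> nat \<Rightarrow> real"
  defines "p0 \<equiv> multi (\<Sum>k\<in>UNIV. q0 $ k *\<^sub>R \<theta>0 k)"
    and "d0 \<equiv> lda_pmf \<alpha>bar N a0 \<theta>0"
    and "rate \<equiv> (\<lambda>m n. C m n * (sqrt (ln (real m * real N) / real m) + sqrt (ln (real n) / real n)))"
  assumes \<alpha>bar: "0 < \<alpha>bar"
    and atoms: "exact_atoms a0 \<theta>0"
    and c0: "0 < c0" "\<And>k v. c0 \<le> \<theta>0 k $ v"
    and \<Pi>\<alpha>: "\<Pi>\<^sub>\<alpha> \<in> space (prob_algebra simplex_borel)" "regular_measure \<Pi>\<^sub>\<alpha>" "a0 \<in> measure_support \<Pi>\<^sub>\<alpha>"
    and \<Pi>\<theta>: "\<Pi>\<^sub>\<theta> \<in> space (prob_algebra simplex_borel)" "regular_measure \<Pi>\<^sub>\<theta>" "\<And>k. \<theta>0 k \<in> measure_support \<Pi>\<^sub>\<theta>"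
    and indep: "independent (range \<theta>0)"
    and N: "3 \<le> N"
    and q0: "q0 \<in> prob_simplex"
    and C: "filterlim (\<lambda>(m, n). C m n) at_top (regime c1 N)"
  obtains b1 b2 where "0 < b1" "0 < b2"
    "\<And>L. \<forall>\<^sub>F x in regime c1 N. \<forall>ws ds. length ws = snd x \<longrightarrow> length ds = fst x \<longrightarrow>
        set ds \<subseteq> {y. length y = N} \<longrightarrow> pearson p0 ws \<le> L \<longrightarrow> pearson d0 ds \<le> L \<longrightarrow>
        posterior \<alpha>bar \<Pi>\<^sub>\<alpha> \<Pi>\<^sub>\<theta> N (fst x) (snd x) (ws, ds) {q. rate (fst x) (snd x) \<le> perm_dist q q0}
          \<le> exp (4 * L) / b1 / real (fst x) + exp (3 * L) / b2 / real (snd x)"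
proof -
  have a0: "a0 \<in> prob_simplex" "\<And>k. 0 < a0 $ k" and \<theta>0: "\<And>k. \<theta>0 k \<in> prob_simplex" and "inj \<theta>0"
    using atoms by (auto simp: exact_atoms_def)
  define \<mu> where "\<mu> = Min (range (($) a0))"
  have \<mu>: "0 < \<mu>" "\<And>k. \<mu> \<le> a0 $ k"
    unfolding \<mu>_def using a0(2) by (auto simp: Min_gr_iff)
  define K where "K = real CARD('k)"
  define V where "V = real CARD('v) + 2"
  obtain Ci \<delta> where Ci: "0 < Ci" "0 < \<delta>" and ident:
    "\<And>a \<Theta> \<eta>. a \<in> prob_simplex \<Longrightarrow> (\<And>k. \<Theta> k \<in> prob_simplex) \<Longrightarrow> \<eta> \<le> \<delta> \<Longrightarrow>
       (\<And>x. length x = N \<Longrightarrow> \<bar>lda_prob \<alpha>bar a \<Theta> x - lda_prob \<alpha>bar a0 \<theta>0 x\<bar> \<le> \<eta>) \<Longrightarrow>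
       \<exists>\<sigma>. \<sigma> permutes UNIV \<and> (\<forall>l. \<bar>a $ \<sigma> l - a0 $ l\<bar> \<le> Ci * \<eta> \<and> (\<forall>v. \<bar>\<Theta> (\<sigma> l) $ v - \<theta>0 l $ v\<bar> \<le> Ci * \<eta>))"
    using lda_identifiable[OF \<alpha>bar atoms indep N] by blast
  obtain Ds where Ds: "0 < Ds" "\<And>q q' :: real^'k. \<exists>v. norm (q - q') \<le> Ds * \<bar>\<Sum>k\<in>UNIV. (q $ k - q' $ k) * \<theta>0 k $ v\<bar>"
    using mixture_separation[OF indep \<open>inj \<theta>0\<close>] by blast
  obtain cd \<beta> where cd: "0 < cd" "0 < \<beta>" and ball:
    "\<And>(a::real^'k) q1 \<rho>. a \<in> prob_simplex \<Longrightarrow> (\<And>k. \<mu> / 2 \<le> a $ k) \<Longrightarrow> q1 \<in> prob_simplex \<Longrightarrow> 0 < \<rho> \<Longrightarrow> \<rho> \<le> 1 \<Longrightarrow>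
      ennreal (cd * \<rho> powr \<beta>) \<le> emeasure (dirichlet (\<alpha>bar *\<^sub>R a)) {q \<in> prob_simplex. norm (q - q1) \<le> \<rho>}"
    using dirichlet_ball_mass[OF \<alpha>bar, of "\<mu> / 2"] \<mu>(1) by auto
  obtain ce De m0 where ce: "0 < ce" "0 < De" and ev:
    "\<And>m n ws ds. m0 \<le> m \<Longrightarrow> real n \<le> c1 * (real m * real N) \<Longrightarrow>
       ennreal (ce * real m powr (- De) * likelihood \<alpha>bar N m n a0 \<theta>0 q0 (ws, ds)) \<le> evidence \<alpha>bar \<Pi>\<^sub>\<alpha> \<Pi>\<^sub>\<theta> N m n (ws, ds)"
    using evidence_ge[OF \<alpha>bar atoms c0 \<Pi>\<alpha> \<Pi>\<theta> q0] by blast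
  (* With this \<open>M\<close> a distance \<open>\<eta>\<close> costs the factor \<open>m powr - (De + 1)\<close>, one power of \<open>m\<close> more than the
     lower bound on the evidence. *)
  define M where "M = sqrt (8 * (De + 1))"
  have M: "0 < M" "M\<^sup>2 = 8 * (De + 1)" unfolding M_def using ce by auto
  define g where "g = max 1 (c1 * real N)"
  define b where "b = Ci * M * sqrt (2 * g)"
  (* The first summand makes the error in the topics negligible at the scale of the rate, the second is
     the requirement of \<open>conditional_exponent_le\<close>. *)
  define Cstar where "Cstar = 2 * Ds * Ci * M + sqrt (32 * Ds\<^sup>2 * (((K + b) / c0)\<^sup>2 * V + \<beta> / 2 + 1))"
  have pmf_p0: "pmf p0 v = (\<Sum>k\<in>UNIV. q0 $ k * \<theta>0 k $ v)" for v
    unfolding p0_def by (rule pmf_multi_mixture[OF q0 \<theta>0])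
  have set_p0: "set_pmf p0 = UNIV"
  proof -
    have "0 < pmf p0 v" for v unfolding pmf_p0
      using mixture_ge[OF q0, where f="\<lambda>k. \<theta>0 k $ v" and c=c0] c0 by force
    then show ?thesis by (auto simp: set_pmf_iff) (metis less_irrefl)
  qed
  have pmf_d0: "pmf d0 x = (if length x = N then lda_prob \<alpha>bar a0 \<theta>0 x else 0)" for x
    unfolding d0_def by (rule pmf_lda_pmf[OF \<alpha>bar a0(1) \<theta>0])
  have set_d0: "set_pmf d0 = {x. length x = N}"
  proof -
    have "0 < lda_prob \<alpha>bar a0 \<theta>0 x" for x
      using lda_prob_ge[OF \<alpha>bar a0(1), where \<Theta>=\<theta>0 and c=c0 and x=x] \<theta>0 c0 by (smt (verit) zero_less_power)
    then show ?thesis by (auto simp: set_pmf_iff pmf_d0 split: if_splits) (metis less_irrefl)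
  qed
  have fin_d0: "finite (set_pmf d0)"
    unfolding set_d0 using finite_lists_length_eq[of "UNIV::'v set" N] by simp
  show thesis
  proof (rule that[of ce cd])
    show "0 < ce" "0 < cd" by (rule ce cd)+
    fix L :: real
    have "((\<lambda>m. M * sqrt (ln (real m) / real m)) \<longlongrightarrow> 0) sequentially" by real_asymp
    then have e1: "\<forall>\<^sub>F m in sequentially. M * sqrt (ln (real m) / real m) < min \<delta> (\<mu> / (2 * Ci))"
      by (rule order_tendstoD) (use Ci \<mu> in auto)
    have "((\<lambda>n. 2 * (K + b) * sqrt (ln (real n) / real n)) \<longlongrightarrow> 0) sequentially" by real_asymp
    then have e2: "\<forall>\<^sub>F n in sequentially. 2 * (K + b) * sqrt (ln (real n) / real n) < c0"
      by (rule order_tendstoD) (use c0 in auto)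
    have e3: "\<forall>\<^sub>F x in regime c1 N. Cstar \<le> C (fst x) (snd x)"
      using C[unfolded filterlim_at_top, rule_format, of Cstar] by (simp add: case_prod_beta')
    show "\<forall>\<^sub>F x in regime c1 N. \<forall>ws ds. length ws = snd x \<longrightarrow> length ds = fst x \<longrightarrow>
        set ds \<subseteq> {y. length y = N} \<longrightarrow> pearson p0 ws \<le> L \<longrightarrow> pearson d0 ds \<le> L \<longrightarrow>
        posterior \<alpha>bar \<Pi>\<^sub>\<alpha> \<Pi>\<^sub>\<theta> N (fst x) (snd x) (ws, ds) {q. rate (fst x) (snd x) \<le> perm_dist q q0}
          \<le> exp (4 * L) / ce / real (fst x) + exp (3 * L) / cd / real (snd x)"
      using eventually_regime_fst[OF e1] eventually_regime_snd[OF e2] e3 eventually_regime_le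
        eventually_regime_fst[OF eventually_ge_at_top[of "max 3 m0"]] eventually_regime_snd[OF eventually_ge_at_top[of 3]]
    proof eventually_elim
      case (elim x)
      define m n where "m = fst x" and "n = snd x"
      define \<eta> where "\<eta> = M * sqrt (ln (real m) / real m)"
      define \<rho> where "\<rho> = sqrt (ln (real n) / real n)"
      define R where "R = rate m n"
      have m3: "3 \<le> m" "m0 \<le> m" and n3: "3 \<le> n" and nm: "real n \<le> c1 * (real m * real N)"
        and C_ge: "Cstar \<le> C m n" and \<eta>_small: "\<eta> < \<delta>" "\<eta> < \<mu> / (2 * Ci)" and \<rho>_small: "2 * (K + b) * \<rho> < c0"
        using elim unfolding m_def n_def \<eta>_def \<rho>_def by auto
      have ln_n: "1 \<le> ln (real n)" and ln_m: "1 \<le> ln (real m)"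
        using n3 m3 exp_le by (subst ln_ge_iff; linarith)+
      have \<eta>0: "0 \<le> \<eta>" unfolding \<eta>_def using M ln_m by (intro mult_nonneg_nonneg) auto
      have \<rho>0: "0 < \<rho>" unfolding \<rho>_def using ln_n n3 by (intro real_sqrt_gt_zero divide_pos_pos) linarith+
      have \<rho>1: "\<rho> \<le> 1"
      proof -
        have "ln (real n) \<le> real n" using ln_le_minus_one[of "real n"] n3 by linarith
        then show ?thesis unfolding \<rho>_def using n3 by (simp add: divide_le_eq_1)
      qed
      have g: "1 \<le> g" "real n \<le> g * real m"
      proof -
        show "1 \<le> g" unfolding g_def by simp
        have "c1 * real N * real m \<le> g * real m" unfolding g_def by (intro mult_right_mono) auto
        then show "real n \<le> g * real m" using nm by (simp add: mult_ac)
      qed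
      have \<zeta>: "Ci * \<eta> \<le> b * \<rho>"
      proof -
        have "sqrt (ln (real m) / real m) \<le> sqrt (2 * g * (ln (real n) / real n))"
          using ln_ratio_le[OF n3 _ g] m3 by (intro real_sqrt_le_mono) auto
        also have "\<dots> = sqrt (2 * g) * \<rho>" unfolding \<rho>_def by (rule real_sqrt_mult)
        finally have "Ci * M * sqrt (ln (real m) / real m) \<le> Ci * M * (sqrt (2 * g) * \<rho>)"
          using Ci M by (intro mult_left_mono) auto
        then show ?thesis by (simp add: \<eta>_def b_def mult_ac)
      qed
      have K0: "0 \<le> K" and V0: "0 \<le> V" and b0: "0 \<le> b" unfolding K_def V_def b_def using Ci M g by auto
      have root: "0 \<le> ((K + b) / c0)\<^sup>2 * V + \<beta> / 2 + 1" using V0 cd by simp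
      have Cstar: "0 \<le> 2 * Ds * Ci * M" "0 \<le> sqrt (32 * Ds\<^sup>2 * (((K + b) / c0)\<^sup>2 * V + \<beta> / 2 + 1))"
        using Ds Ci M root by auto
      have C0: "0 \<le> C m n" using C_ge Cstar unfolding Cstar_def by linarith
      have R1: "C m n * \<rho> \<le> R"
      proof -
        have "1 * 1 \<le> real m * real N" using N m3 by (intro mult_mono) auto
        then show ?thesis unfolding R_def rate_def \<rho>_def using C0 by (intro mult_left_mono) auto
      qed
      have R2: "2 * Ds * (Ci * \<eta>) \<le> R"
      proof -
        have "2 * Ds * (Ci * \<eta>) = (2 * Ds * Ci * M) * sqrt (ln (real m) / real m)" by (simp add: \<eta>_def mult_ac)
        also have "\<dots> \<le> C m n * sqrt (ln (real m) / real m)"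
        proof (rule mult_right_mono)
          show "2 * Ds * Ci * M \<le> C m n" using C_ge Cstar unfolding Cstar_def by linarith
        qed (use ln_m in auto)
        also have "\<dots> \<le> C m n * (sqrt (ln (real m * real N) / real m) + sqrt (ln (real n) / real n))"
        proof (rule mult_left_mono[OF _ C0])
          have "real m * 1 \<le> real m * real N" using N by (intro mult_left_mono) auto
          then have "ln (real m) \<le> ln (real m * real N)" using m3 by simp
          then have "sqrt (ln (real m) / real m) \<le> sqrt (ln (real m * real N) / real m)"
            by (intro real_sqrt_le_mono divide_right_mono) auto
          moreover have "0 \<le> sqrt (ln (real n) / real n)" using ln_n by auto
          ultimately show "sqrt (ln (real m) / real m) \<le> sqrt (ln (real m * real N) / real m) + sqrt (ln (real n) / real n)" by linarith
        qed
        finally show ?thesis unfolding R_def rate_def .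
      qed
      have C_large: "((K + b) / c0)\<^sup>2 * V + \<beta> / 2 + 1 \<le> (C m n)\<^sup>2 / (32 * Ds\<^sup>2)"
      proof -
        have "sqrt (32 * Ds\<^sup>2 * (((K + b) / c0)\<^sup>2 * V + \<beta> / 2 + 1)) \<le> C m n"
          using C_ge Cstar unfolding Cstar_def by linarith
        then have "(sqrt (32 * Ds\<^sup>2 * (((K + b) / c0)\<^sup>2 * V + \<beta> / 2 + 1)))\<^sup>2 \<le> (C m n)\<^sup>2"
          using Cstar by (intro power_mono) auto
        then have "32 * Ds\<^sup>2 * (((K + b) / c0)\<^sup>2 * V + \<beta> / 2 + 1) \<le> (C m n)\<^sup>2"
          using root Ds by (subst (asm) real_sqrt_pow2) auto
        then show ?thesis using Ds by (simp add: pos_le_divide_eq mult.commute)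
      qed
      show ?case
      proof (intro allI impI, fold m_def n_def, fold R_def)
        fix ws :: "'v list" and ds :: "'v list list"
        assume len: "length ws = n" "length ds = m" and ds: "set ds \<subseteq> {y. length y = N}"
          and good: "pearson p0 ws \<le> L" "pearson d0 ds \<le> L"
        have ws_ne: "ws \<noteq> []" and ds_ne: "ds \<noteq> []" using len n3 m3 by auto
        define L0 where "L0 = likelihood \<alpha>bar N m n a0 \<theta>0 q0 (ws, ds)"
        have L0_eq: "L0 = prod_list (map (pmf p0) ws) * prod_list (map (pmf d0) ds)"
          unfolding L0_def p0_def d0_def using len by (simp add: pmf_documents_split)
        have prod_pos: "0 < prod_list (map (pmf p) xs)" if "set xs \<subseteq> set_pmf p" for p :: "'x pmf" and xs
          using that by (induction xs) (auto simp: pmf_positive_iff)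
        have L0: "0 < L0"
          unfolding L0_eq by (intro mult_pos_pos prod_pos) (use ds in \<open>auto simp: set_p0 set_d0\<close>)
        define B where "B = L0 * exp (4 * L) * real m powr (- (De + 1))"
        have B0: "0 \<le> B" unfolding B_def using L0 by simp
        have "posterior \<alpha>bar \<Pi>\<^sub>\<alpha> \<Pi>\<^sub>\<theta> N m n (ws, ds) {q. R \<le> perm_dist q q0} \<le>
          B / (ce * real m powr (- De) * L0) + exp (3 * L) / cd / real n"
        proof (rule posterior_le[OF \<alpha>bar \<Pi>\<alpha>(1) \<Pi>\<theta>(1) sets_perm_dist_ge])
          show "0 < ce * real m powr (- De) * L0" using ce L0 m3 by simp
          show "0 \<le> B" by (rule B0)
          show "0 \<le> exp (3 * L) / cd / real n" using cd by simp
          show "ennreal (ce * real m powr (- De) * L0) \<le> evidence \<alpha>bar \<Pi>\<^sub>\<alpha> \<Pi>\<^sub>\<theta> N m n (ws, ds)"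
            unfolding L0_def by (rule ev[OF m3(2) nm])
          fix a :: "real^'k" and \<Theta> :: "'k \<Rightarrow> real^'v"
          assume a: "a \<in> prob_simplex" and \<Theta>: "\<And>k. \<Theta> k \<in> prob_simplex"
          let ?I = "\<integral>\<^sup>+ q. indicator {q. R \<le> perm_dist q q0} q * ennreal (likelihood \<alpha>bar N m n a \<Theta> q (ws, ds)) \<partial>dirichlet (\<alpha>bar *\<^sub>R a)"
          let ?J = "\<integral>\<^sup>+ q. ennreal (likelihood \<alpha>bar N m n a \<Theta> q (ws, ds)) \<partial>dirichlet (\<alpha>bar *\<^sub>R a)"
          show "?I \<le> ennreal B + ennreal (exp (3 * L) / cd / real n) * ?J"
          proof (cases "\<forall>y. length y = N \<longrightarrow> \<bar>lda_prob \<alpha>bar a \<Theta> y - lda_prob \<alpha>bar a0 \<theta>0 y\<bar> \<le> \<eta>")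
            case True
            then obtain \<sigma> where \<sigma>: "\<sigma> permutes UNIV"
              and close: "\<And>l. \<bar>a $ \<sigma> l - a0 $ l\<bar> \<le> Ci * \<eta>" "\<And>l v. \<bar>\<Theta> (\<sigma> l) $ v - \<theta>0 l $ v\<bar> \<le> Ci * \<eta>"
              using ident[OF a, where \<Theta>=\<Theta> and \<eta>=\<eta>, OF \<Theta> less_imp_le[OF \<eta>_small(1)]] by blast
            have ak: "\<mu> / 2 \<le> a $ k" for k
            proof -
              have "Ci * \<eta> \<le> \<mu> / 2" using \<eta>_small(2) Ci by (simp add: field_simps)
              then have "\<mu> / 2 \<le> a $ \<sigma> l" for l using close(1)[of l] \<mu>(2)[of l] by linarith
              from this[of "inv \<sigma> k"] show ?thesis using permutes_inverses(1)[OF \<sigma>] by simp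
            qed
            have "?I \<le> ennreal (exp (2 * L - real n / 8 * (R / (2 * Ds))\<^sup>2) *
              exp (L + real n * ((real CARD('k) * \<rho> + Ci * \<eta>) / c0)\<^sup>2 * (real CARD('v) + 2)) / (cd * \<rho> powr \<beta>)) * ?J"
            proof (rule conditional_posterior_bound[where \<Theta>=\<Theta> and ?\<theta>0.0=\<theta>0, OF \<alpha>bar a \<Theta> \<theta>0 c0 q0 \<sigma> close(2) Ds])
              show "0 < cd * \<rho> powr \<beta>" using cd \<rho>0 by simp
              show "ennreal (cd * \<rho> powr \<beta>) \<le> emeasure (dirichlet (\<alpha>bar *\<^sub>R a)) {q \<in> prob_simplex. norm (q - q1) \<le> \<rho>}"
                if "q1 \<in> prob_simplex" for q1
                using that \<rho>0 \<rho>1 by (intro ball a ak)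
              show "length ws = n" "length ds = m" "0 < n" using len n3 by auto
              show "pearson (multi (\<Sum>k\<in>UNIV. q0 $ k *\<^sub>R \<theta>0 k)) ws \<le> L" using good(1) by (simp add: p0_def)
              show "2 * Ds * (Ci * \<eta>) \<le> R" by (rule R2)
              show "0 \<le> \<rho>" using \<rho>0 by simp
              have "2 * (K * \<rho> + Ci * \<eta>) \<le> 2 * (K + b) * \<rho>" using \<zeta> by (simp add: algebra_simps)
              then show "2 * (real CARD('k) * \<rho> + Ci * \<eta>) \<le> c0" using \<rho>_small unfolding K_def by linarith
            qed
            also have "\<dots> \<le> ennreal (exp (3 * L) / cd / real n) * ?J"
              unfolding K_def[symmetric] V_def[symmetric]
              using \<zeta> \<eta>0 Ci
              by (intro mult_right_mono ennreal_leI conditional_exponent_le[OF n3 \<rho>_def Ds(1) C0 R1 _ \<zeta> K0 c0(1) V0 cd C_large]) auto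
            finally show ?thesis by (rule order_trans) simp
          next
            case False
            then obtain y where y: "length y = N" "\<eta> < \<bar>lda_prob \<alpha>bar a \<Theta> y - lda_prob \<alpha>bar a0 \<theta>0 y\<bar>" by auto
            let ?d = "lda_pmf \<alpha>bar N a \<Theta>"
            have "\<eta>\<^sup>2 \<le> \<bar>pmf ?d y - pmf d0 y\<bar>\<^sup>2"
              using y \<eta>0 by (intro power_mono) (auto simp: pmf_d0 pmf_lda_pmf[OF \<alpha>bar a, where \<Theta>=\<Theta>, OF \<Theta>])
            also have "\<dots> = (pmf ?d y - pmf d0 y)\<^sup>2" by simp
            also have "\<dots> \<le> (\<Sum>x\<in>set_pmf d0. (pmf ?d x - pmf d0 x)\<^sup>2)"
              by (rule member_le_sum) (use y fin_d0 in \<open>auto simp: set_d0\<close>)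
            finally have "real m / 8 * \<eta>\<^sup>2 \<le> real m / 8 * (\<Sum>x\<in>set_pmf d0. (pmf ?d x - pmf d0 x)\<^sup>2)"
              by (intro mult_left_mono) auto
            moreover have "real m / 8 * \<eta>\<^sup>2 = (De + 1) * ln (real m)"
              unfolding \<eta>_def power_mult_distrib M(2) using ln_m m3 by simp
            ultimately have expo: "2 * pearson d0 ds - real m / 8 * (\<Sum>x\<in>set_pmf d0. (pmf ?d x - pmf d0 x)\<^sup>2) \<le>
                2 * L + - (De + 1) * ln (real m)"
              using good(2) by linarith
            have Zle: "prod_list (map (pmf ?d) ds) \<le> prod_list (map (pmf d0) ds) * (exp (2 * L) * real m powr (- (De + 1)))"
            proof -
              have "prod_list (map (pmf ?d) ds) \<le> prod_list (map (pmf d0) ds) *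
                exp (2 * pearson d0 ds - real (length ds) / 8 * (\<Sum>x\<in>set_pmf d0. (pmf ?d x - pmf d0 x)\<^sup>2))"
                by (rule likelihood_ratio_le[OF fin_d0 _ ds_ne]) (use ds set_d0 in auto)
              also have "\<dots> \<le> prod_list (map (pmf d0) ds) * exp (2 * L + - (De + 1) * ln (real m))"
                using expo unfolding len by (intro mult_left_mono prod_list_pmf_nonneg) simp
              also have "exp (2 * L + - (De + 1) * ln (real m)) = exp (2 * L) * real m powr (- (De + 1))"
                unfolding exp_add powr_def using m3 by simp
              finally show ?thesis .
            qed
            have le: "likelihood \<alpha>bar N m n a \<Theta> q (ws, ds) \<le> B" for q
            proof -
              let ?p = "multi (\<Sum>k\<in>UNIV. q $ k *\<^sub>R \<Theta> k)"
              have "prod_list (map (pmf ?p) ws) \<le> prod_list (map (pmf p0) ws) *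
                exp (2 * pearson p0 ws - real (length ws) / 8 * (\<Sum>x\<in>set_pmf p0. (pmf ?p x - pmf p0 x)\<^sup>2))"
                by (rule likelihood_ratio_le[OF _ _ ws_ne]) (auto simp: set_p0)
              also have "\<dots> \<le> prod_list (map (pmf p0) ws) * exp (2 * L)"
              proof (intro mult_left_mono prod_list_pmf_nonneg)
                have "0 \<le> real (length ws) / 8 * (\<Sum>x\<in>set_pmf p0. (pmf ?p x - pmf p0 x)\<^sup>2)"
                  by (intro mult_nonneg_nonneg sum_nonneg) auto
                then show "exp (2 * pearson p0 ws - real (length ws) / 8 * (\<Sum>x\<in>set_pmf p0. (pmf ?p x - pmf p0 x)\<^sup>2)) \<le> exp (2 * L)"
                  using good(1) unfolding exp_le_cancel_iff by linarith
              qed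
              finally have "prod_list (map (pmf ?p) ws) * prod_list (map (pmf ?d) ds) \<le>
                (prod_list (map (pmf p0) ws) * exp (2 * L)) * (prod_list (map (pmf d0) ds) * (exp (2 * L) * real m powr (- (De + 1))))"
                by (intro mult_mono Zle mult_nonneg_nonneg prod_list_pmf_nonneg) auto
              also have "\<dots> = L0 * (exp (2 * L) * exp (2 * L)) * real m powr (- (De + 1))"
                unfolding L0_eq by (simp only: mult_ac)
              also have "exp (2 * L) * exp (2 * L) = exp (4 * L)" by (simp flip: exp_add)
              finally show ?thesis unfolding B_def using len by (simp add: pmf_documents_split)
            qed
            interpret prob_space "dirichlet (\<alpha>bar *\<^sub>R a)" by (rule prob_space_dirichlet_scaled[OF \<alpha>bar a])
            have "?I \<le> (\<integral>\<^sup>+ q. ennreal B \<partial>dirichlet (\<alpha>bar *\<^sub>R a))"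
              using le by (intro nn_integral_mono) (auto simp: indicator_def intro: ennreal_leI)
            also have "\<dots> = ennreal B" by (simp add: emeasure_space_1)
            finally show ?thesis by (rule order_trans) simp
          qed
        qed
        also have "B / (ce * real m powr (- De) * L0) = exp (4 * L) / ce / real m"
        proof -
          have "real m powr (- (De + 1)) = real m powr (- De) / real m"
            using m3 by (simp add: powr_diff minus_add_distrib flip: diff_conv_add_uminus)
          then show ?thesis unfolding B_def using L0 m3 by simp
        qed
        finally show "posterior \<alpha>bar \<Pi>\<^sub>\<alpha> \<Pi>\<^sub>\<theta> N m n (ws, ds) {q. R \<le> perm_dist q q0}
          \<le> exp (4 * L) / ce / real m + exp (3 * L) / cd / real n" .
      qed
    qed
  qed
qed

text \<open>
  Atypical data have probability at most \<open>S / L\<close>, and there the posterior mass is at most 1.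
\<close>
theorem theorem4:
  fixes a0 q0 :: "real^'k" and \<theta>0 :: "'k \<Rightarrow> real^'v"
    and \<alpha>bar c0 c1 :: real and N :: nat
    and \<Pi>\<^sub>\<alpha> :: "(real^'k) measure" and \<Pi>\<^sub>\<theta> :: "(real^'v) measure"
    and C :: "nat \<Rightarrow> nat \<Rightarrow> real"
  assumes "0 < \<alpha>bar"
    and "exact_atoms a0 \<theta>0"
    and "0 < c0" and "\<And>k v. c0 \<le> \<theta>0 k $ v"
    and "\<Pi>\<^sub>\<alpha> \<in> space (prob_algebra simplex_borel)" and "regular_measure \<Pi>\<^sub>\<alpha>"
    and "\<Pi>\<^sub>\<theta> \<in> space (prob_algebra simplex_borel)" and "regular_measure \<Pi>\<^sub>\<theta>"
    and "a0 \<in> measure_support \<Pi>\<^sub>\<alpha>" and "\<And>k. \<theta>0 k \<in> measure_support \<Pi>\<^sub>\<theta>"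
    and "independent (range \<theta>0)"
    and "3 \<le> N"
    and "q0 \<in> prob_simplex"
    and "filterlim (\<lambda>(m, n). C m n) at_top (regime c1 N)"
  shows "((\<lambda>(m, n).
            measure_pmf.expectation (documents_pmf \<alpha>bar N m n a0 \<theta>0 q0)
              (\<lambda>d. posterior \<alpha>bar \<Pi>\<^sub>\<alpha> \<Pi>\<^sub>\<theta> N m n d
                 {q. perm_dist q q0 \<ge>
                       C m n * (sqrt (ln (real m * real N) / real m) + sqrt (ln (real n) / real n))}))
          \<longlongrightarrow> 0) (regime c1 N)"
proof (rule tendstoI)
  fix e :: real assume e: "0 < e"
  let ?A = "\<lambda>x. {q. perm_dist q q0 \<ge> C (fst x) (snd x) *
    (sqrt (ln (real (fst x) * real N) / real (fst x)) + sqrt (ln (real (snd x)) / real (snd x)))}"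
  define p0 where "p0 = multi (\<Sum>k\<in>UNIV. q0 $ k *\<^sub>R \<theta>0 k)"
  define d0 where "d0 = lda_pmf \<alpha>bar N a0 \<theta>0"
  have a0: "a0 \<in> prob_simplex" and \<theta>0: "\<And>k. \<theta>0 k \<in> prob_simplex"
    using assms(2) by (auto simp: exact_atoms_def)
  obtain b1 b2 where b: "0 < b1" "0 < b2" and typical:
    "\<And>L. \<forall>\<^sub>F x in regime c1 N. \<forall>ws ds. length ws = snd x \<longrightarrow> length ds = fst x \<longrightarrow>
        set ds \<subseteq> {y. length y = N} \<longrightarrow> pearson p0 ws \<le> L \<longrightarrow> pearson d0 ds \<le> L \<longrightarrow>
        posterior \<alpha>bar \<Pi>\<^sub>\<alpha> \<Pi>\<^sub>\<theta> N (fst x) (snd x) (ws, ds) (?A x)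
          \<le> exp (4 * L) / b1 / real (fst x) + exp (3 * L) / b2 / real (snd x)"
    using posterior_le_on_typical_data[OF assms(1-4) assms(5,6,9) assms(7,8,10) assms(11-14)]
    unfolding p0_def[symmetric] d0_def[symmetric] by blast
  have set_d0: "set_pmf d0 \<subseteq> {y. length y = N}"
    by (auto simp: d0_def set_pmf_iff pmf_lda_pmf[OF assms(1) a0 \<theta>0] split: if_splits)
  have fin_d0: "finite (set_pmf d0)"
    by (rule finite_subset[OF set_d0]) (use finite_lists_length_eq[of "UNIV::'v set" N] in simp)
  have fin_p0: "finite (set_pmf p0)" by simp
  define S where "S = real (card (set_pmf p0)) + real (card (set_pmf d0))"
  define L where "L = 2 * S / e + 1"
  have S: "0 \<le> S" unfolding S_def by simp
  have L: "0 < L" unfolding L_def using S e by (intro add_nonneg_pos) auto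
  have SL: "S / L < e / 2"
  proof -
    have "2 * S < e * L" unfolding L_def using e by (simp add: field_simps)
    then show ?thesis using L by (simp add: field_simps)
  qed
  have "((\<lambda>m::nat. exp (4 * L) / b1 / real m) \<longlongrightarrow> 0) sequentially" by real_asymp
  then have e1: "\<forall>\<^sub>F m in sequentially. exp (4 * L) / b1 / real m < e / 4"
    by (rule order_tendstoD) (use e in auto)
  have "((\<lambda>n::nat. exp (3 * L) / b2 / real n) \<longlongrightarrow> 0) sequentially" by real_asymp
  then have e2: "\<forall>\<^sub>F n in sequentially. exp (3 * L) / b2 / real n < e / 4"
    by (rule order_tendstoD) (use e in auto)
  show "\<forall>\<^sub>F x in regime c1 N. dist (case x of (m, n) \<Rightarrow>
            measure_pmf.expectation (documents_pmf \<alpha>bar N m n a0 \<theta>0 q0)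
              (\<lambda>d. posterior \<alpha>bar \<Pi>\<^sub>\<alpha> \<Pi>\<^sub>\<theta> N m n d
                 {q. perm_dist q q0 \<ge>
                       C m n * (sqrt (ln (real m * real N) / real m) + sqrt (ln (real n) / real n))})) 0 < e"
    using typical[of L] eventually_regime_fst[OF e1] eventually_regime_snd[OF e2]
      eventually_regime_fst[OF eventually_gt_at_top[of 0]] eventually_regime_snd[OF eventually_gt_at_top[of 0]]
  proof eventually_elim
    case (elim x)
    define m n where "m = fst x" and "n = snd x"
    have x: "x = (m, n)" by (simp add: m_def n_def)
    have mn: "0 < m" "0 < n" using elim by (auto simp: m_def n_def)
    let ?P = "documents_pmf \<alpha>bar N m n a0 \<theta>0 q0"
    let ?post = "\<lambda>d. posterior \<alpha>bar \<Pi>\<^sub>\<alpha> \<Pi>\<^sub>\<theta> N m n d (?A (m, n))"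
    have P: "?P = pair_pmf (replicate_pmf n p0) (replicate_pmf m d0)"
      by (simp add: documents_pmf_def p0_def d0_def)
    have int: "integrable ?P f" for f :: "'v list \<times> 'v list list \<Rightarrow> real"
      unfolding P by (intro integrable_measure_pmf_finite) (simp add: finite_set_replicate_pmf fin_d0 fin_p0)
    define s where "s = exp (4 * L) / b1 / real m + exp (3 * L) / b2 / real n"
    have s: "0 \<le> s" "s < e / 2"
    proof -
      show "0 \<le> s" unfolding s_def using b by (intro add_nonneg_nonneg) auto
      show "s < e / 2" unfolding s_def m_def n_def using elim(2,3) by linarith
    qed
    let ?F = "indicator {ws. L \<le> pearson p0 ws} :: 'v list \<Rightarrow> real"
    let ?G = "indicator {ds. L \<le> pearson d0 ds} :: 'v list list \<Rightarrow> real"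
    have bound: "?post d \<le> ?F (fst d) + ?G (snd d) + s" if d: "d \<in> set_pmf ?P" for d
    proof -
      obtain ws ds where d_eq: "d = (ws, ds)" by (cases d)
      have len: "length ws = n" "length ds = m" "set ds \<subseteq> {y. length y = N}"
        using d set_d0 unfolding P d_eq by (auto simp: set_replicate_pmf lists_eq_set)
      show ?thesis
      proof (cases "pearson p0 ws < L \<and> pearson d0 ds < L")
        case True
        then have "?post d \<le> s"
          using elim(1) len unfolding d_eq s_def x fst_conv snd_conv by auto
        then show ?thesis by (simp add: d_eq add_nonneg_nonneg add_increasing)
      next
        case False
        have "?post d \<le> 1" by (rule posterior_bounds[OF assms(1,5,7)])
        moreover have "1 \<le> ?F ws + ?G ds" using False by (auto simp: indicator_def)
        ultimately show ?thesis using s by (simp add: d_eq)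
      qed
    qed
    have "measure_pmf.expectation ?P ?post \<le> measure_pmf.expectation ?P (\<lambda>d. ?F (fst d) + ?G (snd d) + s)"
      by (intro integral_mono_AE int) (use bound in \<open>simp only: AE_measure_pmf_iff, blast\<close>)
    also have "\<dots> = measure_pmf.expectation ?P (\<lambda>d. ?F (fst d)) + measure_pmf.expectation ?P (\<lambda>d. ?G (snd d)) + s"
      by (simp add: int)
    also have "\<dots> = measure_pmf.prob (replicate_pmf n p0) {ws. L \<le> pearson p0 ws} + measure_pmf.prob (replicate_pmf m d0) {ds. L \<le> pearson d0 ds} + s"
      unfolding P by (simp add: expectation_pair_pmf_fst expectation_pair_pmf_snd)
    also have "\<dots> \<le> real (card (set_pmf p0)) / L + real (card (set_pmf d0)) / L + s"
      by (intro add_mono prob_pearson_ge fin_p0 fin_d0 mn L order_refl)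
    also have "\<dots> = S / L + s" by (simp add: S_def add_divide_distrib)
    finally have "measure_pmf.expectation ?P ?post < e" using SL s by linarith
    moreover have "0 \<le> measure_pmf.expectation ?P ?post"
      by (intro integral_nonneg_AE AE_I2 posterior_bounds[OF assms(1,5,7)])
    ultimately show ?case unfolding x by (simp add: dist_real_def)
  qed
qed

end
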